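(* Let $X=\{X(t),\,t\ge 0\}$ and $\widehat X=\{\widehat X(t),\,t\ge 0\}$ be real-valued L\'evy processes such that, for some nonstochastic function $a(t)>0$ with $a(t)\to 0$ as $t\to 0$, $$\left\{\frac{X(ts)}{a(t)},\ s\ge 0\right\}\to\{\widehat X(s),\ s\ge 0\}\quad\text{as } t\to 0$$ in the sense of convergence of all finite-dimensional distributions. Let $(\gamma,\sigma,\Pi)$ be the characteristic triplet of $X$, let $\beta^0,\beta^\infty$ be the indices of $\Pi$ defined in the context, and let $$\tau^0(q)=\lim_{t\to 0}\frac{\log \mathbb{E}|X(t)|^q}{\log(1/t)}$$ be the scaling function of $X$. Then: (i) Suppose $\widehat X$ is Brownian motion. If $\Pi\not\equiv 0$, then for $q\in(0,\beta^\infty)$ $$\tau^0(q)=\begin{cases}-\frac12 q,&\text{if }0<q\le 2,\\ -1,&\text{if } q>2.\end{cases}$$ If $\Pi\equiv 0$, then $\tau^0(q)=-q/2$ for $q\in(0,\beta^\infty)$. (ii) Suppose $\widehat X$ is a linear drift. If $\Pi\not\equiv 0$, then for $q\in(0,\beta^\infty)$ $$\tau^0(q)=\begin{cases}-q,&\text{if }0<q\le 1,\\ -1,&\text{if } q>1.\end{cases}$$ If $\Pi\equiv 0$, then $\tau^0(q)=-q$ for $q\in(0,\beta^\infty)$. (iii) If $\widehat X$ is a strictly stable L\'evy process, then for $q\in(0,\beta^\infty)$ $$\tau^0(q)=\begin{cases}-\frac{1}{\beta^0} q,&\text{if }0<q\le \beta^0,\\ -1,&\text{if } q>\beta^0.\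end{cases}$$
   Context: A real-valued L\'evy process $X$ has characteristic triplet $(\gamma,\sigma,\Pi)$ if $\mathbb{E}[e^{i\zeta X(t)}]=e^{t\Psi(\zeta)}$ for all $t\ge0$, $\zeta\in\mathbb{R}$, with $$\Psi(\zeta)=i\gamma\zeta-\frac{\sigma^2}{2}\zeta^2+\int_{\mathbb{R}}\left(e^{i\zeta x}-1-i\zeta x\mathbf{1}_{\{|x|\le1\}}\right)\Pi(dx),$$ where $\gamma\in\mathbb{R}$, $\sigma\ge 0$ and $\Pi$ is a measure on $\mathbb{R}\setminus\{0\}$ with $\int(1\wedge x^2)\,\Pi(dx)<\infty$. Indices: $$\beta^0=\inf\left\{\beta\ge0:\int_{|x|\le1}|x|^\beta\,\Pi(dx)<\infty\right\}\in[0,2],\qquad \beta^\infty=\sup\left\{\beta\ge0:\int_{|x|>1}|x|^\beta\,\Pi(dx)<\infty\right\}\in[0,\infty].$$ Types of limit $\widehat X$: - Brownian motion: characteristic triplet $(0,\widehat\sigma,0)$ with $\widehat\sigma>0$. - Linear drift: characteristic triplet $(\widehat\gamma,0,0)$ with $\widehat\gamma\ne0$. - Strictly $\alpha$-stable L\'evy process, $0<\alpha<2$: characteristic triplet $(\widehat\gamma,0,\widehat\Pi)$ with $\widehat\Pi(dx)=c_+x^{-1-\alpha}\mathbf{1}_{\{x>0\}}dx+c_-|x|^{-1-\alpha}\mathbf{1}_{\{x<0\}}dx$, $c_+,c_-\ge0$, $c_++c_->0$; if $\alpha\neq1$ then $\widehat\gamma=(c_+-c_-)/(1-\alpha)$,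 and if $\alpha=1$ then $c_+=c_-$ (and $\widehat\gamma\in\mathbb{R}$ is arbitrary). "Strictly stable" means strictly $\alpha$-stable for some $\alpha\in(0,2)$. The assertion that $\tau^0(q)$ equals a given value includes the existence of the limit defining it. *)

theory Defs
  imports "HOL-Probability.Probability"
begin

locale levy_process = prob_space M for M :: "'a measure" +
  fixes X :: "real \<Rightarrow> 'a \<Rightarrow> real"
  assumes random_variable: "\<And>t. 0 \<le> t \<Longrightarrow> X t \<in> borel_measurable M"
    and start_zero: "AE \<omega> in M. X 0 \<omega> = 0"
    and independent_increments:
      "\<And>n (s :: nat \<Rightarrow> real). 0 \<le> s 0 \<Longrightarrow> (\<And>i. i < n \<Longrightarrow> s i \<le> s (Suc i)) \<Longrightarrow>
         indep_vars (\<lambda>_. borel) (\<lambda>i \<omega>. X (s (Suc i)) \<omega> - X (s i) \<omega>) {..<n}"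
    and stationary_increments:
      "\<And>s t. 0 \<le> s \<Longrightarrow> 0 \<le> t \<Longrightarrow>
         distr M borel (\<lambda>\<omega>. X (s + t) \<omega> - X s \<omega>) = distr M borel (X t)"
    and stochastically_continuous:
      "\<And>t \<epsilon>. 0 \<le> t \<Longrightarrow> 0 < \<epsilon> \<Longrightarrow>
         ((\<lambda>s. prob {\<omega> \<in> space M. \<bar>X s \<omega> - X t \<omega>\<bar> > \<epsilon>}) \<longlongrightarrow> 0) (at t within {0..})"
    and cadlag:
      "AE \<omega> in M. (\<forall>t\<ge>0. ((\<lambda>s. X s \<omega>) \<longlongrightarrow> X t \<omega>) (at_right t)) \<and>
                  (\<forall>t>0. \<exists>l. ((\<lambda>s. X s \<omega>) \<longlongrightarrow> l) (at_left t))"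

text \<open>The Levy measure \<open>\<nu>\<close>, a measure on the punctured line, is represented as a Borel measure on the whole line
  that does not charge the origin; the zero measure is \<open>null_measure borel\<close>.\<close>

definition levy_measure :: "real measure \<Rightarrow> bool" where
  "levy_measure \<nu> \<longleftrightarrow> sets \<nu> = sets borel \<and> emeasure \<nu> {0} = 0 \<and>
     (\<integral>\<^sup>+x. ennreal (min 1 (x\<^sup>2)) \<partial>\<nu>) < \<infinity>"

definition levy_exponent :: "real \<Rightarrow> real \<Rightarrow> real measure \<Rightarrow> real \<Rightarrow> complex" where
  "levy_exponent \<gamma> \<sigma> \<nu> \<zeta> =
     \<i> * complex_of_real (\<gamma> * \<zeta>) - complex_of_real (\<sigma>\<^sup>2 / 2 * \<zeta>\<^sup>2) +
     (CLINT x|\<nu>. iexp (\<zeta> * x) - 1 - \<i> * complex_of_real (\<zeta> * x * indicator {-1..1} x))"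

definition has_triplet ::
    "'a measure \<Rightarrow> (real \<Rightarrow> 'a \<Rightarrow> real) \<Rightarrow> real \<Rightarrow> real \<Rightarrow> real measure \<Rightarrow> bool" where
  "has_triplet M X \<gamma> \<sigma> \<nu> \<longleftrightarrow> 0 \<le> \<sigma> \<and> levy_measure \<nu> \<and>
     (\<forall>t\<ge>0. \<forall>\<zeta>. (CLINT \<omega>|M. iexp (\<zeta> * X t \<omega>)) =
        exp (complex_of_real t * levy_exponent \<gamma> \<sigma> \<nu> \<zeta>))"

text \<open>For a Levy measure the set in \<open>beta_zero\<close> contains 2 and the one in \<open>beta_inf\<close>
  contains 0, so neither bound is taken over the empty set. The convention \<open>0 powr 0 = 0\<close>
  is harmless since the origin is not charged.\<close>

definition beta_zero :: "real measure \<Rightarrow> real" where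
  "beta_zero \<nu> =
     Inf {\<beta>. 0 \<le> \<beta> \<and> (\<integral>\<^sup>+x\<in>{x. \<bar>x\<bar> \<le> 1}. ennreal (\<bar>x\<bar> powr \<beta>) \<partial>\<nu>) < \<infinity>}"

definition beta_inf :: "real measure \<Rightarrow> ereal" where
  "beta_inf \<nu> =
     Sup (ereal ` {\<beta>. 0 \<le> \<beta> \<and> (\<integral>\<^sup>+x\<in>{x. \<bar>x\<bar> > 1}. ennreal (\<bar>x\<bar> powr \<beta>) \<partial>\<nu>) < \<infinity>})"

definition brownian_limit :: "'a measure \<Rightarrow> (real \<Rightarrow> 'a \<Rightarrow> real) \<Rightarrow> bool" where
  "brownian_limit M X \<longleftrightarrow> (\<exists>\<sigma>>0. has_triplet M X 0 \<sigma> (null_measure borel))"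

definition drift_limit :: "'a measure \<Rightarrow> (real \<Rightarrow> 'a \<Rightarrow> real) \<Rightarrow> bool" where
  "drift_limit M X \<longleftrightarrow> (\<exists>\<gamma>. \<gamma> \<noteq> 0 \<and> has_triplet M X \<gamma> 0 (null_measure borel))"

definition stable_levy_measure :: "real \<Rightarrow> real \<Rightarrow> real \<Rightarrow> real measure" where
  "stable_levy_measure \<alpha> cp cm = density lborel (\<lambda>x. ennreal
     (cp * x powr (-1 - \<alpha>) * indicator {0<..} x + cm * \<bar>x\<bar> powr (-1 - \<alpha>) * indicator {..<0} x))"

definition strictly_stable :: "'a measure \<Rightarrow> (real \<Rightarrow> 'a \<Rightarrow> real) \<Rightarrow> real \<Rightarrow> bool" where
  "strictly_stable M X \<alpha> \<longleftrightarrow> 0 < \<alpha> \<and> \<alpha> < 2 \<and>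
     (\<exists>\<gamma> cp cm. 0 \<le> cp \<and> 0 \<le> cm \<and> 0 < cp + cm \<and>
        (\<alpha> \<noteq> 1 \<longrightarrow> \<gamma> = (cp - cm) / (1 - \<alpha>)) \<and> (\<alpha> = 1 \<longrightarrow> cp = cm) \<and>
        has_triplet M X \<gamma> 0 (stable_levy_measure \<alpha> cp cm))"

text \<open>Convergence along the filter \<open>F\<close> of all finite-dimensional distributions, as weak
  convergence against bounded continuous functions. The space \<open>\<real>\<^sup>n\<close> is embedded in
  \<open>nat \<Rightarrow> real\<close> (with the product topology) by padding with zeros; its bounded continuous
  functions are exactly the restrictions of those on \<open>nat \<Rightarrow> real\<close>.\<close>

definition fdd_converges ::
    "'a measure \<Rightarrow> ('t \<Rightarrow> real \<Rightarrow> 'a \<Rightarrow> real) \<Rightarrow> 't filter \<Rightarrow>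
     'b measure \<Rightarrow> (real \<Rightarrow> 'b \<Rightarrow> real) \<Rightarrow> bool" where
  "fdd_converges M Y F N Z \<longleftrightarrow>
     (\<forall>(n :: nat) (s :: nat \<Rightarrow> real) (f :: (nat \<Rightarrow> real) \<Rightarrow> real).
        (\<forall>i<n. 0 \<le> s i) \<and> continuous_on UNIV f \<and> bounded (range f) \<longrightarrow>
        ((\<lambda>t. LINT \<omega>|M. f (\<lambda>i. if i < n then Y t (s i) \<omega> else 0)) \<longlongrightarrow>
         (LINT \<omega>|N. f (\<lambda>i. if i < n then Z (s i) \<omega> else 0))) F)"

text \<open>\<open>has_tau_zero M X q v\<close> says that the limit defining \<open>\<tau>\<^sup>0(q)\<close> exists and equals \<open>v\<close>.
  Since the Lebesgue integral of a non-integrable function and \<open>ln 0\<close> are both 0 in HOL,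
  we require the moments near time 0 to be finite and positive, so that their logarithms
  are the real numbers intended.\<close>

definition has_tau_zero :: "'a measure \<Rightarrow> (real \<Rightarrow> 'a \<Rightarrow> real) \<Rightarrow> real \<Rightarrow> real \<Rightarrow> bool" where
  "has_tau_zero M X q v \<longleftrightarrow>
     (\<forall>\<^sub>F t in at_right 0. integrable M (\<lambda>\<omega>. \<bar>X t \<omega>\<bar> powr q) \<and>
                          0 < (LINT \<omega>|M. \<bar>X t \<omega>\<bar> powr q)) \<and>
     ((\<lambda>t. ln (LINT \<omega>|M. \<bar>X t \<omega>\<bar> powr q) / ln (1 / t)) \<longlongrightarrow> v) (at_right 0)"

end

theory Submission
  imports Defs
begin

text \<open>Why the theorem holds. Write \<open>\<Psi>\<close> for the characteristic exponent, so that
\<open>E exp(iuX(t)) = exp(t\<Psi>(u))\<close>, and \<open>\<alpha>\<close> for the self-similarity index of the limit: 2 for Brownian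
motion, 1 for a drift, the stability index otherwise. If \<open>X\<close> has jumps, the claim is
\<open>\<tau>\<^sup>0(q) = - min (q/\<alpha>) 1\<close>: either the typical size \<open>a(t)\<close> of \<open>X(t)\<close> or a single jump of fixed size, which
has probability of order \<open>t\<close>, dominates the moment. For a stable limit one must also identify \<open>\<alpha>\<close>
with \<open>\<beta>\<^sup>0\<close>. Without jumps \<open>X(t)\<close> is normal or deterministic, and \<open>\<tau>\<^sup>0(q) = - q/\<alpha>\<close> follows from
its explicit law.

Upper bounds. Moments are read off from the characteristic function. For \<open>q > 0\<close>, \<open>|x|^q\<close> is
dominated by a constant times the sum of \<open>u^(-q) sin(ux/2)^(2m)\<close> over all dyadic frequencies \<open>u = 2^k\<close>,
k an integer, so \<open>E|X(t)|^q\<close> is controlled by the sine moments \<open>E sin(uX(t)/2)^(2m)\<close>, which are linear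
combinations of the numbers \<open>Re exp(t\<Psi>(ku))\<close>. At high frequency they are at most
\<open>min 1 (t |\<Psi>(u)|)\<close>, and \<open>|\<Psi>(u)|\<close> is \<open>O(u^\<theta>)\<close> for each \<open>\<theta> > \<alpha>\<close>; if \<open>q \<ge> 2\<close>, \<open>O(u\<^sup>2)\<close> is enough. At low frequency they are
\<open>O(t u^p)\<close> with \<open>p > q\<close>: for \<open>q < 2\<close> directly from the behaviour of \<open>\<Psi>\<close> at 0
(\<open>moment_bound_order_less_2\<close>); for \<open>q \<ge> 2\<close> after centring, by integrating Kolmogorov's forward
equation and induction on \<open>m\<close> (\<open>sine_moment_low_frequency\<close>, \<open>moment_bound_order_ge_2\<close>). Such a \<open>p\<close>
exists because \<open>q < \<beta>\<^sup>\<infinity>\<close>. This gives \<open>E|X(t)|^q = O(t^\<kappa>)\<close> for every \<open>\<kappa> < min (q/\<alpha>) 1\<close>.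

Lower bounds. Weak convergence of \<open>X(t)/a(t)\<close> to a variable that is not identically 0 gives
\<open>E|X(t)|^q \<ge> c a(t)^q\<close> (\<open>moment_ge_scaling\<close>), and a nonzero Levy measure gives \<open>E|X(t)|^q \<ge> c t\<close>
(\<open>moment_ge_linear\<close>).

The scaling function. Weak convergence implies \<open>t\<Psi>(u/a(t)) \<longrightarrow> \<Psi>h(u)\<close> uniformly on the unit interval
(\<open>exponents_converge_uniformly\<close>); the branches of the logarithm agree because both sides are continuous and vanish at
\<open>u = 0\<close>. A homogeneous real or imaginary part of \<open>\<Psi>h\<close> forces \<open>a(st)/a(t)\<close> to be close to \<open>s^(1/\<alpha>)\<close>
uniformly for \<open>1/2 \<le> s \<le> 1\<close>, and iterated halving of \<open>t\<close> places \<open>a(t)\<close>, up to constant factors, between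
\<open>t^(1/\<alpha> + \<epsilon>)\<close> and \<open>t^(1/\<alpha> - \<epsilon>)\<close>. This turns \<open>c a(t)^q\<close> into a power of \<open>t\<close>, gives the growth of \<open>\<Psi>\<close> used above, and
identifies \<open>\<beta>\<^sup>0\<close> in the stable case.\<close>

section \<open>The characteristic exponent\<close>

definition levy_kernel :: "real \<Rightarrow> real \<Rightarrow> complex" where
  "levy_kernel u x = iexp (u * x) - 1 - \<i> * complex_of_real (u * x * indicator {-1..1} x)"

lemma levy_kernel_Re: "Re (levy_kernel u x) = cos (u * x) - 1"
  by (simp add: levy_kernel_def Re_exp)

lemma levy_kernel_Im: "Im (levy_kernel u x) = sin (u * x) - u * x * indicator {-1..1} x"
  by (simp add: levy_kernel_def Im_exp)

lemma cmod_iexp_minus_le_sq: "cmod (iexp z - 1 - \<i> * complex_of_real z) \<le> z\<^sup>2 / 2"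
  using iexp_approx1[of z 1] by (simp add: algebra_simps numeral_2_eq_2)

lemma levy_kernel_bound: "cmod (levy_kernel u x) \<le> (2 + u\<^sup>2) * min 1 (x\<^sup>2)"
proof (cases "\<bar>x\<bar> \<le> 1")
  case True
  then have i: "indicator {-1..1} x = (1::real)" and m: "min 1 (x\<^sup>2) = x\<^sup>2"
    by (auto simp: abs_le_iff abs_square_le_1)
  have "cmod (levy_kernel u x) \<le> (u * x)\<^sup>2 / 2"
    using cmod_iexp_minus_le_sq[of "u * x"] unfolding levy_kernel_def i by simp
  also have "\<dots> \<le> (2 + u\<^sup>2) * x\<^sup>2"
    by (simp add: power_mult_distrib algebra_simps)
  finally show ?thesis by (simp add: m)
next
  case False
  then have i: "indicator {-1..1} x = (0::real)" and m: "min 1 (x\<^sup>2) = 1"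
    by (auto simp: indicator_def abs_le_iff abs_square_less_1 not_le)
       (metis False abs_square_le_1 linorder_le_cases min_absorb1)
  have "cmod (levy_kernel u x) \<le> cmod (iexp (u * x)) + cmod 1"
    unfolding levy_kernel_def i using norm_triangle_ineq4[of "iexp (u*x)" 1] by simp
  then have "cmod (levy_kernel u x) \<le> 2" by simp
  then show ?thesis unfolding m using zero_le_power2[of u] by (simp add: add_increasing2)
qed

lemma levy_kernel_measurable[measurable]: "levy_kernel u \<in> borel_measurable borel"
  unfolding levy_kernel_def by measurable

context
  fixes \<nu> :: "real measure"
  assumes lm: "levy_measure \<nu>"
begin

lemma levy_sets: "sets \<nu> = sets borel"
  using lm by (simp add: levy_measure_def)

lemma levy_space: "space \<nu> = UNIV"
  using sets_eq_imp_space_eq[OF levy_sets] by simp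

lemma levy_integrable_min: "integrable \<nu> (\<lambda>x. min 1 (x\<^sup>2))"
proof (rule integrableI_nonneg)
  note [measurable_cong] = levy_sets
  show "(\<lambda>x. min 1 (x\<^sup>2)) \<in> borel_measurable \<nu>" by measurable
qed (use lm in \<open>auto simp: levy_measure_def\<close>)

lemma levy_integrable_dominated:
  fixes f :: "real \<Rightarrow> 'b::{banach, second_countable_topology}"
  assumes [measurable]: "f \<in> borel_measurable borel" and b: "\<And>x. norm (f x) \<le> C * min 1 (x\<^sup>2)"
  shows "integrable \<nu> f"
proof (rule Bochner_Integration.integrable_bound)
  note [measurable_cong] = levy_sets
  show "f \<in> borel_measurable \<nu>" by measurable
  show "integrable \<nu> (\<lambda>x. C * min 1 (x\<^sup>2))" using levy_integrable_min by simp
  show "AE x in \<nu>. norm (f x) \<le> norm (C * min 1 (x\<^sup>2))"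
    using b by (auto intro!: AE_I2 order_trans[OF b])
qed

lemma levy_kernel_integrable: "integrable \<nu> (levy_kernel u)"
  by (rule levy_integrable_dominated[OF _ levy_kernel_bound]) measurable

lemma one_minus_cos_integrable: "integrable \<nu> (\<lambda>x. 1 - cos (u * x))"
  using Bochner_Integration.integrable_minus[OF levy_kernel_integrable[THEN integrable_Re, of u]]
  by (simp add: levy_kernel_Re)

lemma levy_exponent_kernel:
  "levy_exponent \<gamma> \<sigma> \<nu> u =
     \<i> * complex_of_real (\<gamma> * u) - complex_of_real (\<sigma>\<^sup>2 / 2 * u\<^sup>2) + (CLINT x|\<nu>. levy_kernel u x)"
  unfolding levy_exponent_def levy_kernel_def ..

lemma levy_exponent_Re:
  "Re (levy_exponent \<gamma> \<sigma> \<nu> u) = - (\<sigma>\<^sup>2 / 2 * u\<^sup>2) - (LINT x|\<nu>. 1 - cos (u * x))"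
proof -
  have "Re (CLINT x|\<nu>. levy_kernel u x) = (LINT x|\<nu>. cos (u * x) - 1)"
    by (subst integral_Re[OF levy_kernel_integrable, symmetric]) (simp add: levy_kernel_Re)
  also have "\<dots> = - (LINT x|\<nu>. 1 - cos (u * x))"
    by (subst integral_minus[symmetric]) simp
  finally show ?thesis by (simp add: levy_exponent_kernel)
qed

lemma levy_exponent_Im:
  "Im (levy_exponent \<gamma> \<sigma> \<nu> u) = \<gamma> * u + (LINT x|\<nu>. sin (u * x) - u * x * indicator {-1..1} x)"
  by (simp add: levy_exponent_kernel integral_Im[OF levy_kernel_integrable, symmetric] levy_kernel_Im)

lemma levy_exponent_Re_nonpos: "Re (levy_exponent \<gamma> \<sigma> \<nu> u) \<le> 0"
proof -
  have "0 \<le> (LINT x|\<nu>. 1 - cos (u * x))" by (rule integral_nonneg_AE) auto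
  then show ?thesis unfolding levy_exponent_Re
    by (smt (verit) mult_nonneg_nonneg zero_le_power2 divide_nonneg_pos)
qed

lemma levy_exponent_0: "levy_exponent \<gamma> \<sigma> \<nu> 0 = 0"
  by (simp add: levy_exponent_def)

text \<open>The bound \<open>levy_kernel_bound\<close> is locally uniform in the frequency, which is what dominated convergence needs.\<close>
lemma levy_exponent_continuous: "continuous_on UNIV (levy_exponent \<gamma> \<sigma> \<nu>)"
proof -
  note [measurable_cong] = levy_sets
  have "((\<lambda>n. CLINT x|\<nu>. levy_kernel (s n) x) \<longlonglongrightarrow> (CLINT x|\<nu>. levy_kernel u x))"
    if s: "s \<longlonglongrightarrow> u" for s u
  proof -
    have "Bseq s" using s by (meson convergentI convergent_imp_Bseq)
    then obtain K where K: "\<And>n. \<bar>s n\<bar> \<le> K" by (auto simp: Bseq_def)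
    show ?thesis
    proof (rule integral_dominated_convergence[where w = "\<lambda>x. (2 + K\<^sup>2) * min 1 (x\<^sup>2)"])
      show "integrable \<nu> (\<lambda>x. (2 + K\<^sup>2) * min 1 (x\<^sup>2))" using levy_integrable_min by simp
      show "AE x in \<nu>. (\<lambda>n. levy_kernel (s n) x) \<longlonglongrightarrow> levy_kernel u x"
        unfolding levy_kernel_def by (intro AE_I2 tendsto_intros s)
      fix n
      have "(s n)\<^sup>2 \<le> K\<^sup>2" using K[of n] by (metis abs_ge_zero power2_abs power_mono)
      then have "(2 + (s n)\<^sup>2) * min 1 (x\<^sup>2) \<le> (2 + K\<^sup>2) * min 1 (x\<^sup>2)" for x :: real
        by (intro mult_right_mono) auto
      then show "AE x in \<nu>. cmod (levy_kernel (s n) x) \<le> (2 + K\<^sup>2) * min 1 (x\<^sup>2)"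
        using levy_kernel_bound order_trans by (intro AE_I2) blast
    qed measurable
  qed
  then have "continuous_on UNIV (\<lambda>u. CLINT x|\<nu>. levy_kernel u x)"
    by (auto simp: continuous_on_sequentially o_def)
  then show ?thesis
    unfolding levy_exponent_kernel[abs_def] by (intro continuous_intros)
qed

end

lemma levy_exponent_null_measure:
  "levy_exponent \<gamma> \<sigma> (null_measure borel) u = \<i> * complex_of_real (\<gamma> * u) - complex_of_real (\<sigma>\<^sup>2 / 2 * u\<^sup>2)"
proof -
  have "has_bochner_integral (null_measure borel)
      (\<lambda>x. iexp (u * x) - 1 - \<i> * complex_of_real (u * x * indicator {-1..1} x)) 0" by simp
  then show ?thesis unfolding levy_exponent_def by (simp add: has_bochner_integral_integral_eq)
qed

section \<open>Growth of the exponent\<close>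

lemma one_minus_cos_le_sq: "1 - cos z \<le> z\<^sup>2 / 2" for z :: real
  using cmod_iexp_minus_le_sq[of z] abs_Re_le_cmod[of "iexp z - 1 - \<i> * complex_of_real z"]
  by (simp add: Re_exp)

lemma abs_sin_minus_le_sq: "\<bar>sin z - z\<bar> \<le> z\<^sup>2 / 2" for z :: real
  using cmod_iexp_minus_le_sq[of z] abs_Im_le_cmod[of "iexp z - 1 - \<i> * complex_of_real z"]
  by (simp add: Im_exp)

lemma powr_le_powr_of_le_one: "0 \<le> z \<Longrightarrow> z \<le> 1 \<Longrightarrow> a \<le> b \<Longrightarrow> z powr b \<le> z powr a" for z :: real
  by (simp add: powr_mono')

lemma sq_eq_powr: "z\<^sup>2 = \<bar>z\<bar> powr 2" for z :: real
  by (cases "z = 0") (simp_all add: powr_numeral)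

text \<open>Interpolation between the bounds 2 and \<open>z\<^sup>2/2\<close>. It converts a fractional moment of the Levy measure
into a power of the frequency.\<close>
lemma one_minus_cos_le_powr:
  fixes z :: real assumes "0 \<le> p" "p \<le> 2"
  shows "1 - cos z \<le> 2 * \<bar>z\<bar> powr p"
proof (cases "\<bar>z\<bar> \<le> 1")
  case True
  have "1 - cos z \<le> z\<^sup>2" using one_minus_cos_le_sq[of z] zero_le_power2[of z] by linarith
  also have "\<dots> \<le> \<bar>z\<bar> powr p" unfolding sq_eq_powr using True assms by (intro powr_le_powr_of_le_one) auto
  finally show ?thesis by (smt (verit) powr_ge_zero)
next
  case False
  have "1 - cos z \<le> 2" using cos_ge_minus_one[of z] by linarith
  also have "\<dots> \<le> 2 * \<bar>z\<bar> powr p" using False assms by (simp add: ge_one_powr_ge_zero)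
  finally show ?thesis .
qed

lemma abs_sin_le_powr:
  fixes z :: real assumes "0 \<le> p" "p \<le> 1"
  shows "\<bar>sin z\<bar> \<le> \<bar>z\<bar> powr p"
proof (cases "\<bar>z\<bar> \<le> 1")
  case True
  have "\<bar>sin z\<bar> \<le> \<bar>z\<bar> powr 1" using abs_sin_x_le_abs_x[of z] by simp
  also have "\<dots> \<le> \<bar>z\<bar> powr p" using True assms by (intro powr_le_powr_of_le_one) auto
  finally show ?thesis .
next
  case False
  have "\<bar>sin z\<bar> \<le> 1" by simp
  also have "\<dots> \<le> \<bar>z\<bar> powr p" using False assms by (simp add: ge_one_powr_ge_zero)
  finally show ?thesis .
qed

text \<open>The Bochner-integrability form of the condition that defines \<open>beta_inf\<close>.\<close>
definition tail_moment :: "real measure \<Rightarrow> real \<Rightarrow> bool" where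
  "tail_moment \<nu> p \<longleftrightarrow> integrable \<nu> (\<lambda>x. \<bar>x\<bar> powr p * indicator {x. 1 < \<bar>x\<bar>} x)"

lemma tail_moment_mono:
  assumes lm: "levy_measure \<nu>" and "tail_moment \<nu> p" "r \<le> p"
  shows "tail_moment \<nu> r"
  unfolding tail_moment_def
proof (rule Bochner_Integration.integrable_bound)
  note [measurable_cong] = levy_sets[OF lm]
  show "(\<lambda>x. \<bar>x\<bar> powr r * indicator {x. 1 < \<bar>x\<bar>} x) \<in> borel_measurable \<nu>" by measurable
  show "integrable \<nu> (\<lambda>x. \<bar>x\<bar> powr p * indicator {x. 1 < \<bar>x\<bar>} x)"
    using assms by (simp add: tail_moment_def)
  show "AE x in \<nu>. norm (\<bar>x\<bar> powr r * indicator {x. 1 < \<bar>x\<bar>} x)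
      \<le> norm (\<bar>x\<bar> powr p * indicator {x. 1 < \<bar>x\<bar>} x)"
    using assms by (auto simp: indicator_def intro!: powr_mono)
qed

lemma beta_inf_tail_moment:
  assumes lm: "levy_measure \<nu>" and "ereal q < beta_inf \<nu>"
  obtains p where "q < p" "tail_moment \<nu> p"
proof -
  note [measurable_cong] = levy_sets[OF lm]
  obtain p where p: "q < p" "(\<integral>\<^sup>+x\<in>{x. \<bar>x\<bar> > 1}. ennreal (\<bar>x\<bar> powr p) \<partial>\<nu>) < \<infinity>"
    using assms(2) unfolding beta_inf_def less_Sup_iff by auto
  have "integrable \<nu> (\<lambda>x. \<bar>x\<bar> powr p * indicator {x. 1 < \<bar>x\<bar>} x)"
  proof (rule integrableI_nonneg)
    have "(\<integral>\<^sup>+x. ennreal (\<bar>x\<bar> powr p * indicator {x. 1 < \<bar>x\<bar>} x) \<partial>\<nu>) =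
      (\<integral>\<^sup>+x\<in>{x. \<bar>x\<bar> > 1}. ennreal (\<bar>x\<bar> powr p) \<partial>\<nu>)"
      by (intro nn_integral_cong) (auto simp: indicator_def)
    then show "(\<integral>\<^sup>+x. ennreal (\<bar>x\<bar> powr p * indicator {x. 1 < \<bar>x\<bar>} x) \<partial>\<nu>) < \<infinity>" using p by simp
  qed (auto)
  then show thesis using that p by (simp add: tail_moment_def)
qed

text \<open>A single integrable majorant for the low-frequency estimates: quadratic at the small jumps and of
order \<open>p\<close> at the large ones.\<close>
definition jump_weight :: "real \<Rightarrow> real \<Rightarrow> real" where
  "jump_weight p x = min 1 (x\<^sup>2) + \<bar>x\<bar> powr p * indicator {x. 1 < \<bar>x\<bar>} x"

lemma jump_weight_measurable[measurable]: "jump_weight p \<in> borel_measurable borel"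
  unfolding jump_weight_def by measurable

lemma jump_weight_nonneg: "0 \<le> jump_weight p x"
  by (simp add: jump_weight_def)

lemma jump_weight_integrable:
  assumes "levy_measure \<nu>" "tail_moment \<nu> p"
  shows "integrable \<nu> (jump_weight p)"
  unfolding jump_weight_def using levy_integrable_min[OF assms(1)] assms(2)
  by (auto simp: tail_moment_def)

lemma jump_weight_small: "\<bar>x\<bar> \<le> 1 \<Longrightarrow> jump_weight p x = x\<^sup>2"
  by (simp add: jump_weight_def abs_square_le_1)

lemma jump_weight_large: "1 < \<bar>x\<bar> \<Longrightarrow> \<bar>x\<bar> powr p \<le> jump_weight p x"
  by (simp add: jump_weight_def)

lemma integral_abs_le_bound:
  fixes f g :: "'a \<Rightarrow> real"
  assumes "f \<in> borel_measurable M" "integrable M g" "\<And>x. \<bar>f x\<bar> \<le> g x"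
  shows "integrable M f" "\<bar>LINT x|M. f x\<bar> \<le> (LINT x|M. g x)"
proof -
  show i: "integrable M f"
    by (rule Bochner_Integration.integrable_bound[OF assms(2,1)])
       (use assms(3) in \<open>auto intro!: AE_I2 order_trans[OF assms(3)]\<close>)
  have "\<bar>LINT x|M. f x\<bar> \<le> (LINT x|M. \<bar>f x\<bar>)" by (rule integral_abs_bound)
  also have "\<dots> \<le> (LINT x|M. g x)" using i assms by (intro integral_mono) auto
  finally show "\<bar>LINT x|M. f x\<bar> \<le> (LINT x|M. g x)" .
qed

text \<open>Large jumps with a moment of order \<open>p\<close> contribute \<open>u^p\<close> to the real part. The imaginary part is only
\<open>O(u^(p/2))\<close>, since the drift and the sine are first-order terms; this suffices, as it enters the sine moments
through its square.\<close>
lemma levy_exponent_near_0: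
  assumes lm: "levy_measure \<nu>" and tm: "tail_moment \<nu> p" and p: "0 < p" "p \<le> 2"
  obtains C where "0 \<le> C" "\<And>u. 0 < u \<Longrightarrow> u \<le> 1 \<Longrightarrow> \<bar>Re (levy_exponent \<gamma> \<sigma> \<nu> u)\<bar> \<le> C * u powr p"
    "\<And>u. 0 < u \<Longrightarrow> u \<le> 1 \<Longrightarrow> \<bar>Im (levy_exponent \<gamma> \<sigma> \<nu> u)\<bar> \<le> C * u powr (p / 2)"
proof -
  note [measurable_cong] = levy_sets[OF lm]
  define W where "W = (LINT x|\<nu>. jump_weight p x)"
  have iW: "integrable \<nu> (\<lambda>x. c * jump_weight p x)" for c
    using jump_weight_integrable[OF lm tm] by simp
  have W0: "0 \<le> W" unfolding W_def by (rule integral_nonneg_AE) (simp add: jump_weight_nonneg)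
  define C where "C = \<bar>\<gamma>\<bar> + \<sigma>\<^sup>2 + 2 * W"
  have "\<bar>Re (levy_exponent \<gamma> \<sigma> \<nu> u)\<bar> \<le> C * u powr p \<and> \<bar>Im (levy_exponent \<gamma> \<sigma> \<nu> u)\<bar> \<le> C * u powr (p / 2)"
    if u: "0 < u" "u \<le> 1" for u
  proof
    have u2: "u\<^sup>2 \<le> u powr p" using u p powr_le_powr_of_le_one[of u _ 2] by (simp add: powr_numeral)
    have u2': "u\<^sup>2 \<le> u powr (p/2)" using u p powr_le_powr_of_le_one[of u _ 2] by (simp add: powr_numeral)
    have u1: "u \<le> u powr (p/2)" using u p powr_le_powr_of_le_one[of u "p/2" 1] by auto
    have b1: "\<bar>1 - cos (u * x)\<bar> \<le> 2 * u powr p * jump_weight p x" for x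
    proof (cases "\<bar>x\<bar> \<le> 1")
      case True
      have "\<bar>1 - cos (u * x)\<bar> \<le> u\<^sup>2 * x\<^sup>2"
        using one_minus_cos_le_sq[of "u * x"] zero_le_power2[of "u*x"] abs_of_nonneg[of "1 - cos (u * x)"] cos_le_one[of "u*x"]
        unfolding power_mult_distrib by linarith
      also have "\<dots> \<le> u powr p * x\<^sup>2" using u2 by (intro mult_right_mono) auto
      also have "\<dots> \<le> 2 * u powr p * x\<^sup>2" by simp
      finally show ?thesis using True by (simp add: jump_weight_small)
    next
      case False
      have "\<bar>1 - cos (u * x)\<bar> \<le> 2 * \<bar>u * x\<bar> powr p"
        using one_minus_cos_le_powr[of p "u * x"] p by (simp add: abs_le_iff)
      also have "\<dots> = 2 * u powr p * \<bar>x\<bar> powr p" using u by (simp add: abs_mult powr_mult)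
      also have "\<dots> \<le> 2 * u powr p * jump_weight p x"
        using False by (intro mult_left_mono jump_weight_large) auto
      finally show ?thesis .
    qed
    have "\<bar>LINT x|\<nu>. 1 - cos (u * x)\<bar> \<le> (LINT x|\<nu>. 2 * u powr p * jump_weight p x)"
      by (rule integral_abs_le_bound(2)[OF _ iW b1]) measurable
    then have "\<bar>LINT x|\<nu>. 1 - cos (u * x)\<bar> \<le> 2 * u powr p * W" by (simp add: W_def)
    moreover have "\<sigma>\<^sup>2 / 2 * u\<^sup>2 \<le> \<sigma>\<^sup>2 * u powr p" using u2 by (intro mult_mono) auto
    moreover have "0 \<le> \<bar>\<gamma>\<bar> * u powr p" by auto
    moreover have "0 \<le> (LINT x|\<nu>. 1 - cos (u * x))" by (rule integral_nonneg_AE) auto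
    ultimately have "\<sigma>\<^sup>2 / 2 * u\<^sup>2 + (LINT x|\<nu>. 1 - cos (u * x)) \<le> C * u powr p"
      unfolding C_def distrib_right mult.assoc by (simp only: mult.commute[of W])
    then show "\<bar>Re (levy_exponent \<gamma> \<sigma> \<nu> u)\<bar> \<le> C * u powr p"
      using levy_exponent_Re_nonpos[OF lm, of \<gamma> \<sigma> u] levy_exponent_Re[OF lm, of \<gamma> \<sigma> u] by linarith
    have b2: "\<bar>sin (u * x) - u * x * indicator {-1..1} x\<bar> \<le> u powr (p/2) * jump_weight p x" for x
    proof (cases "\<bar>x\<bar> \<le> 1")
      case True
      then have "indicator {-1..1} x = (1::real)" by (auto simp: abs_le_iff)
      then have "\<bar>sin (u * x) - u * x * indicator {-1..1} x\<bar> \<le> u\<^sup>2 * x\<^sup>2 / 2"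
        using abs_sin_minus_le_sq[of "u * x"] by (simp add: power_mult_distrib)
      also have "\<dots> \<le> u\<^sup>2 * x\<^sup>2" by simp
      also have "\<dots> \<le> u powr (p/2) * x\<^sup>2" using u2' by (intro mult_right_mono) auto
      finally show ?thesis using True by (simp add: jump_weight_small)
    next
      case False
      then have "indicator {-1..1} x = (0::real)" by (auto simp: indicator_def)
      then have "\<bar>sin (u * x) - u * x * indicator {-1..1} x\<bar> \<le> \<bar>u * x\<bar> powr (p/2)"
        using abs_sin_le_powr[of "p/2" "u * x"] p by simp
      also have "\<dots> = u powr (p/2) * \<bar>x\<bar> powr (p/2)" using u by (simp add: abs_mult powr_mult)
      also have "\<dots> \<le> u powr (p/2) * \<bar>x\<bar> powr p"
        using False p by (intro mult_left_mono powr_mono) auto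
      also have "\<dots> \<le> u powr (p/2) * jump_weight p x"
        using False by (intro mult_left_mono jump_weight_large) auto
      finally show ?thesis .
    qed
    have "\<bar>LINT x|\<nu>. sin (u * x) - u * x * indicator {-1..1} x\<bar> \<le> (LINT x|\<nu>. u powr (p/2) * jump_weight p x)"
      by (rule integral_abs_le_bound(2)[OF _ iW b2]) measurable
    then have "\<bar>LINT x|\<nu>. sin (u * x) - u * x * indicator {-1..1} x\<bar> \<le> u powr (p/2) * W"
      by (simp add: W_def)
    moreover have "\<bar>\<gamma> * u\<bar> \<le> \<bar>\<gamma>\<bar> * u powr (p/2)" using u1 u by (simp add: abs_mult mult_left_mono)
    moreover have "0 \<le> \<sigma>\<^sup>2 * u powr (p/2)" "0 \<le> u powr (p/2) * W" using W0 by auto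
    ultimately show "\<bar>Im (levy_exponent \<gamma> \<sigma> \<nu> u)\<bar> \<le> C * u powr (p/2)"
      unfolding levy_exponent_Im[OF lm] C_def distrib_right mult.assoc by (simp only: mult.commute[of W])
  qed
  then show thesis using that[of C] W0 by (auto simp: C_def)
qed

text \<open>When second moments exist, the mean can be removed from the process. The compensator then acts on all
jumps and the exponent is quadratic at every frequency, with no linear term; the induction for
moments of order at least 2 depends on this.\<close>
definition centred_kernel :: "real \<Rightarrow> real \<Rightarrow> complex" where
  "centred_kernel u x = iexp (u * x) - 1 - \<i> * complex_of_real (u * x)"

lemma centred_kernel_measurable[measurable]: "centred_kernel u \<in> borel_measurable borel"
  unfolding centred_kernel_def by measurable

lemma centred_kernel_bound: "cmod (centred_kernel u x) \<le> u\<^sup>2 / 2 * x\<^sup>2"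
  using cmod_iexp_minus_le_sq[of "u * x"] by (simp add: centred_kernel_def power_mult_distrib)

definition centred_exponent :: "real \<Rightarrow> real measure \<Rightarrow> real \<Rightarrow> complex" where
  "centred_exponent \<sigma> \<nu> u = - complex_of_real (\<sigma>\<^sup>2 / 2 * u\<^sup>2) + (CLINT x|\<nu>. centred_kernel u x)"

lemma tail_moment_2_integrable_sq:
  assumes lm: "levy_measure \<nu>" and tm: "tail_moment \<nu> p" and p: "2 \<le> p"
  shows "integrable \<nu> (\<lambda>x. x\<^sup>2)"
proof -
  note [measurable_cong] = levy_sets[OF lm]
  have "\<bar>x\<^sup>2\<bar> \<le> jump_weight p x" for x :: real
  proof (cases "\<bar>x\<bar> \<le> 1")
    case False
    have "x\<^sup>2 \<le> \<bar>x\<bar> powr p" unfolding sq_eq_powr using False p by (intro powr_mono) auto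
    then show ?thesis using jump_weight_large[of x p] False by auto
  qed (simp add: jump_weight_small)
  then show ?thesis
    by (intro integral_abs_le_bound(1)[OF _ jump_weight_integrable[OF lm tm]]) auto
qed

lemma
  assumes lm: "levy_measure \<nu>" and i2: "integrable \<nu> (\<lambda>x. x\<^sup>2)"
  shows centred_kernel_integrable: "integrable \<nu> (centred_kernel u)"
    and centred_exponent_bound:
      "cmod (centred_exponent \<sigma> \<nu> u) \<le> (\<sigma>\<^sup>2 / 2 + (LINT x|\<nu>. x\<^sup>2) / 2) * u\<^sup>2"
    and levy_exponent_centred:
      "levy_exponent \<gamma> \<sigma> \<nu> u = centred_exponent \<sigma> \<nu> u +
        \<i> * complex_of_real ((\<gamma> + (LINT x|\<nu>. x * indicator {x. 1 < \<bar>x\<bar>} x)) * u)"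
proof -
  note [measurable_cong] = levy_sets[OF lm]
  show i: "integrable \<nu> (centred_kernel u)"
  proof (rule Bochner_Integration.integrable_bound)
    show "integrable \<nu> (\<lambda>x. u\<^sup>2 / 2 * x\<^sup>2)" using i2 by simp
    show "AE x in \<nu>. cmod (centred_kernel u x) \<le> norm (u\<^sup>2 / 2 * x\<^sup>2)"
      using centred_kernel_bound[of u] by auto
  qed measurable
  have "cmod (CLINT x|\<nu>. centred_kernel u x) \<le> (LINT x|\<nu>. cmod (centred_kernel u x))"
    by (rule integral_norm_bound)
  also have "\<dots> \<le> (LINT x|\<nu>. u\<^sup>2 / 2 * x\<^sup>2)"
    using i i2 centred_kernel_bound by (intro integral_mono) auto
  finally have *: "cmod (CLINT x|\<nu>. centred_kernel u x) \<le> u\<^sup>2 / 2 * (LINT x|\<nu>. x\<^sup>2)" by simp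
  have "cmod (centred_exponent \<sigma> \<nu> u) \<le> cmod (- complex_of_real (\<sigma>\<^sup>2 / 2 * u\<^sup>2)) + cmod (CLINT x|\<nu>. centred_kernel u x)"
    unfolding centred_exponent_def by (rule norm_triangle_ineq)
  also have "cmod (- complex_of_real (\<sigma>\<^sup>2 / 2 * u\<^sup>2)) = \<sigma>\<^sup>2 / 2 * u\<^sup>2"
    unfolding norm_minus_cancel norm_of_real by simp
  finally show "cmod (centred_exponent \<sigma> \<nu> u) \<le> (\<sigma>\<^sup>2 / 2 + (LINT x|\<nu>. x\<^sup>2) / 2) * u\<^sup>2"
    using * by (simp add: algebra_simps)
  have it: "integrable \<nu> (\<lambda>x. x * indicator {x. 1 < \<bar>x\<bar>} x)"
  proof (rule integral_abs_le_bound(1)[OF _ i2])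
    show "\<bar>x * indicator {x. 1 < \<bar>x\<bar>} x\<bar> \<le> x\<^sup>2" for x :: real
      using self_le_power[of "\<bar>x\<bar>" 2] by (auto simp: indicator_def)
  qed measurable
  have "(CLINT x|\<nu>. levy_kernel u x) =
      (CLINT x|\<nu>. centred_kernel u x + \<i> * complex_of_real u * complex_of_real (x * indicator {x. 1 < \<bar>x\<bar>} x))"
    by (intro Bochner_Integration.integral_cong)
       (auto simp: levy_kernel_def centred_kernel_def indicator_def abs_le_iff abs_less_iff not_le)
  also have "\<dots> = (CLINT x|\<nu>. centred_kernel u x) +
      \<i> * complex_of_real u * complex_of_real (LINT x|\<nu>. x * indicator {x. 1 < \<bar>x\<bar>} x)"
    using i it by (simp del: of_real_mult add: integral_complex_of_real)
  finally show "levy_exponent \<gamma> \<sigma> \<nu> u = centred_exponent \<sigma> \<nu> u +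
        \<i> * complex_of_real ((\<gamma> + (LINT x|\<nu>. x * indicator {x. 1 < \<bar>x\<bar>} x)) * u)"
    by (simp add: levy_exponent_kernel[OF lm] centred_exponent_def algebra_simps)
qed

section \<open>Absolute moments from sine moments at dyadic frequencies\<close>

abbreviation abs_moment :: "'a measure \<Rightarrow> ('a \<Rightarrow> real) \<Rightarrow> real \<Rightarrow> real" where
  "abs_moment M Y q \<equiv> LINT \<omega>|M. \<bar>Y \<omega>\<bar> powr q"

abbreviation has_abs_moment :: "'a measure \<Rightarrow> ('a \<Rightarrow> real) \<Rightarrow> real \<Rightarrow> bool" where
  "has_abs_moment M Y q \<equiv> integrable M (\<lambda>\<omega>. \<bar>Y \<omega>\<bar> powr q)"

abbreviation sine_moment :: "'a measure \<Rightarrow> ('a \<Rightarrow> real) \<Rightarrow> nat \<Rightarrow> real \<Rightarrow> real" where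
  "sine_moment M Y m u \<equiv> LINT \<omega>|M. sin (u * Y \<omega> / 2) ^ (2 * m)"

lemma sin_half_pos: "0 < sin (1/2::real)"
  by (rule sin_gt_zero) (use pi_gt3 in auto)

text \<open>At a frequency with \<open>1 \<le> u|x| \<le> 2\<close> the sine is bounded away from 0, so one term of the dyadic
series already captures \<open>|x|^q\<close>.\<close>
lemma powr_le_sin_of_scaled:
  fixes x u q :: real
  assumes q: "0 < q" and u: "0 < u" "1 \<le> u * \<bar>x\<bar>" "u * \<bar>x\<bar> \<le> 2"
  shows "\<bar>x\<bar> powr q \<le> 2 powr q / sin (1/2) ^ (2 * m) * (u powr (-q) * sin (u * x / 2) ^ (2 * m))"
proof -
  have "sin (1/2) \<le> sin (u * \<bar>x\<bar> / 2)"
    using u pi_gt3 by (intro sin_mono_le_eq[THEN iffD2]) auto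
  also have "\<dots> \<le> \<bar>sin (u * x / 2)\<bar>" using u by (cases "0 \<le> x") auto
  finally have "sin (1/2) ^ (2 * m) \<le> \<bar>sin (u * x / 2)\<bar> ^ (2 * m)"
    using sin_half_pos by (intro power_mono) auto
  also have "\<dots> = sin (u * x / 2) ^ (2 * m)" by (simp add: power_mult)
  finally have 1: "1 \<le> sin (u * x / 2) ^ (2 * m) / sin (1/2) ^ (2 * m)" using sin_half_pos by simp
  have "\<bar>x\<bar> powr q \<le> (2 / u) powr q"
    using u q by (intro powr_mono2) (auto simp: field_simps)
  also have "\<dots> = 2 powr q * u powr (-q)" using u by (simp add: powr_divide powr_minus_divide)
  also have "\<dots> \<le> 2 powr q * u powr (-q) * (sin (u * x / 2) ^ (2 * m) / sin (1/2) ^ (2 * m))"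
    using mult_left_mono[OF 1, of "2 powr q * u powr (-q)"] by simp
  finally show ?thesis by (simp add: field_simps)
qed

lemma dyadic_scale_exists:
  fixes x :: real assumes "x \<noteq> 0"
  obtains k :: nat where "1 \<le> 2 ^ k * \<bar>x\<bar>" "2 ^ k * \<bar>x\<bar> \<le> 2"
    | k :: nat where "1 \<le> (1/2) ^ k * \<bar>x\<bar>" "(1/2) ^ k * \<bar>x\<bar> \<le> 2"
proof -
  define n where "n = \<lfloor>log 2 \<bar>x\<bar>\<rfloor>"
  have n: "2 powr n \<le> \<bar>x\<bar>" "\<bar>x\<bar> < 2 powr (n + 1)"
    using assms floor_log_eq_powr_iff[of "\<bar>x\<bar>" 2 n] by (auto simp: n_def)
  show thesis
  proof (cases "0 \<le> n")
    case True
    then have "2 powr n = 2 ^ nat n" by (simp add: powr_int)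
    then show thesis using n that(2)[of "nat n"] by (simp add: powr_add field_simps power_one_over)
  next
    case False
    then have "2 powr n = 1 / 2 ^ nat (-n)" using powr_int[of 2 n] by simp
    moreover have "\<bar>x\<bar> < 2 * 2 powr n" using n by (simp add: powr_add)
    ultimately have "1 / 2 ^ nat (-n) \<le> \<bar>x\<bar>" "\<bar>x\<bar> < 2 * (1 / 2 ^ nat (-n))" using n by simp_all
    then show thesis by (intro that(1)[of "nat (-n)"]) (simp_all add: field_simps)
  qed
qed

text \<open>A discrete Mellin transform: the sum of \<open>u^(-q) F(u)\<close> over \<open>u = 2^k\<close>, k ranging over the integers.
Frequency 1 is counted in both series, which is harmless for upper bounds.\<close>
definition dyadic_sum :: "real \<Rightarrow> (real \<Rightarrow> ennreal) \<Rightarrow> ennreal" where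
  "dyadic_sum q F = (\<Sum>k. ennreal ((2 ^ k) powr (-q)) * F (2 ^ k)) +
     (\<Sum>k. ennreal (((1/2) ^ k) powr (-q)) * F ((1/2) ^ k))"

lemma powr_le_dyadic_sum:
  fixes x q :: real assumes q: "0 < q"
  shows "ennreal (\<bar>x\<bar> powr q) \<le> ennreal (2 powr q / sin (1/2) ^ (2 * m)) *
    dyadic_sum q (\<lambda>u. ennreal (sin (u * x / 2) ^ (2 * m)))"
proof (cases "x = 0")
  case False
  have le: "ennreal (\<bar>x\<bar> powr q) \<le> ennreal (2 powr q / sin (1/2) ^ (2 * m)) *
      (ennreal (u powr (-q)) * ennreal (sin (u * x / 2) ^ (2 * m)))"
    if "0 < u" "1 \<le> u * \<bar>x\<bar>" "u * \<bar>x\<bar> \<le> 2" for u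
    using powr_le_sin_of_scaled[OF q that, of m]
    by (simp add: ennreal_mult'[symmetric] ennreal_leI)
  have S: "f k \<le> (\<Sum>k. f k)" for f :: "nat \<Rightarrow> ennreal" and k
    using sum_le_suminf[of f "{k}"] by simp
  show ?thesis
  proof (cases rule: dyadic_scale_exists[OF False])
    case (1 k)
    show ?thesis
      by (rule order_trans[OF le[of "2 ^ k"]])
         (use 1 in \<open>auto simp: dyadic_sum_def intro!: mult_left_mono add_increasing2
            S[of "\<lambda>k. ennreal ((2 ^ k) powr (-q)) * ennreal (sin (2 ^ k * x / 2) ^ (2 * m))"]\<close>)
  next
    case (2 k)
    show ?thesis
      by (rule order_trans[OF le[of "(1/2) ^ k"]])
         (use 2 in \<open>auto simp: dyadic_sum_def intro!: mult_left_mono add_increasing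
            S[of "\<lambda>k. ennreal (((1/2) ^ k) powr (-q)) * ennreal (sin ((1/2) ^ k * x / 2) ^ (2 * m))"]\<close>)
  qed
qed simp

lemma sum_geometric_powr_ennreal:
  fixes r s C :: real assumes "0 < r" "r powr s < 1" "0 \<le> C"
  shows "(\<Sum>k. ennreal (C * (r ^ k) powr s)) = ennreal (C / (1 - r powr s))"
proof -
  have e: "(r ^ k) powr s = (r powr s) ^ k" for k
    using assms(1) by (simp add: powr_realpow[symmetric] powr_powr mult.commute)
  have "(\<lambda>k. C * (r powr s) ^ k) sums (C * (1 / (1 - r powr s)))"
    using assms by (intro sums_mult geometric_sums) auto
  then show ?thesis
    unfolding e using assms by (intro suminf_ennreal_eq) auto
qed

text \<open>The product of the domination constant of \<open>powr_le_dyadic_sum\<close> and the two geometric series of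
\<open>dyadic_sum_le\<close>. It must not depend on the law of the random variable, so that the moment bounds are uniform in time.\<close>
definition moment_const :: "nat \<Rightarrow> real \<Rightarrow> real \<Rightarrow> real \<Rightarrow> real" where
  "moment_const m q p \<eta> = 2 powr q / sin (1/2) ^ (2 * m) *
     (1 / (1 - 2 powr (\<eta> - q)) + 1 / (1 - 2 powr (q - p)))"

lemma moment_const_nonneg:
  assumes "q < p" "\<eta> < q" shows "0 \<le> moment_const m q p \<eta>"
proof -
  have "2 powr (\<eta> - q) < 1" "2 powr (q - p) < (1::real)" using assms by (simp_all add: powr_less_one)
  then show ?thesis unfolding moment_const_def using sin_half_pos by auto
qed

lemma powr_minus_mult_powr: "0 < r \<Longrightarrow> r powr (-q) * (A * r powr p) = A * r powr (p - q)" for r :: real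
  by (simp add: powr_diff powr_minus divide_inverse)

text \<open>Decay faster than \<open>u^q\<close> at low frequency and growth slower than \<open>u^q\<close> at high frequency make both
halves of the series geometric.\<close>
lemma dyadic_sum_le:
  assumes q: "0 < q" "q < p" "\<eta> < q" and A: "0 \<le> A"
    and low: "\<And>u. 0 < u \<Longrightarrow> u \<le> 1 \<Longrightarrow> F u \<le> ennreal (A * u powr p)"
    and high: "\<And>u. 1 \<le> u \<Longrightarrow> F u \<le> ennreal (A * u powr \<eta>)"
  shows "dyadic_sum q F \<le> ennreal (A * (1 / (1 - 2 powr (\<eta> - q)) + 1 / (1 - 2 powr (q - p))))"
proof -
  have 1: "2 powr (\<eta> - q) < (1::real)" "2 powr (q - p) < (1::real)" using q by (simp_all add: powr_less_one)
  have h: "(1/2) powr (p - q) = (2::real) powr (q - p)"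
    using powr_minus_divide[of 2 "p - q"] by (simp add: powr_divide)
  have "(\<Sum>k. ennreal ((2 ^ k) powr (-q)) * F (2 ^ k)) \<le> (\<Sum>k. ennreal (A * (2 ^ k) powr (\<eta> - q)))"
  proof (rule suminf_le)
    fix k :: nat
    have "ennreal ((2 ^ k) powr (-q)) * F (2 ^ k) \<le> ennreal ((2 ^ k) powr (-q)) * ennreal (A * (2 ^ k) powr \<eta>)"
      by (intro mult_left_mono high) auto
    also have "\<dots> = ennreal (A * (2 ^ k) powr (\<eta> - q))"
      by (subst ennreal_mult'[symmetric]) (simp_all only: powr_ge_zero powr_minus_mult_powr zero_less_power zero_less_divide_1_iff zero_less_numeral)
    finally show "ennreal ((2 ^ k) powr (-q)) * F (2 ^ k) \<le> ennreal (A * (2 ^ k) powr (\<eta> - q))" .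
  qed auto
  also have "\<dots> = ennreal (A / (1 - 2 powr (\<eta> - q)))" using 1 A by (intro sum_geometric_powr_ennreal) auto
  finally have a: "(\<Sum>k. ennreal ((2 ^ k) powr (-q)) * F (2 ^ k)) \<le> ennreal (A / (1 - 2 powr (\<eta> - q)))" .
  have "(\<Sum>k. ennreal (((1/2) ^ k) powr (-q)) * F ((1/2) ^ k)) \<le> (\<Sum>k. ennreal (A * ((1/2) ^ k) powr (p - q)))"
  proof (rule suminf_le)
    fix k :: nat
    have "ennreal (((1/2) ^ k) powr (-q)) * F ((1/2) ^ k) \<le> ennreal (((1/2) ^ k) powr (-q)) * ennreal (A * ((1/2) ^ k) powr p)"
      by (intro mult_left_mono low) (auto simp: power_le_one)
    also have "\<dots> = ennreal (A * ((1/2) ^ k) powr (p - q))"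
      by (subst ennreal_mult'[symmetric]) (simp_all only: powr_ge_zero powr_minus_mult_powr zero_less_power zero_less_divide_1_iff zero_less_numeral)
    finally show "ennreal (((1/2) ^ k) powr (-q)) * F ((1/2) ^ k) \<le> ennreal (A * ((1/2) ^ k) powr (p - q))" .
  qed auto
  also have "\<dots> = ennreal (A / (1 - (1/2) powr (p - q)))"
    using 1 A by (intro sum_geometric_powr_ennreal) (auto simp: h)
  finally have b: "(\<Sum>k. ennreal (((1/2) ^ k) powr (-q)) * F ((1/2) ^ k)) \<le> ennreal (A / (1 - 2 powr (q - p)))"
    by (simp add: h)
  have "dyadic_sum q F \<le> ennreal (A / (1 - 2 powr (\<eta> - q))) + ennreal (A / (1 - 2 powr (q - p)))"
    unfolding dyadic_sum_def using a b by (rule add_mono)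
  also have "\<dots> = ennreal (A * (1 / (1 - 2 powr (\<eta> - q)) + 1 / (1 - 2 powr (q - p))))"
    using 1 A by (subst ennreal_plus[symmetric]) (auto simp: algebra_simps)
  finally show ?thesis .
qed

lemma nn_integral_powr_le_dyadic_sum:
  assumes Y[measurable]: "Y \<in> borel_measurable M" and q: "0 < q"
  shows "(\<integral>\<^sup>+\<omega>. ennreal (\<bar>Y \<omega>\<bar> powr q) \<partial>M) \<le> ennreal (2 powr q / sin (1/2) ^ (2 * m)) *
    dyadic_sum q (\<lambda>u. \<integral>\<^sup>+\<omega>. ennreal (sin (u * Y \<omega> / 2) ^ (2 * m)) \<partial>M)"
proof -
  have "(\<integral>\<^sup>+\<omega>. ennreal (\<bar>Y \<omega>\<bar> powr q) \<partial>M) \<le>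
     (\<integral>\<^sup>+\<omega>. ennreal (2 powr q / sin (1/2) ^ (2 * m)) *
        dyadic_sum q (\<lambda>u. ennreal (sin (u * Y \<omega> / 2) ^ (2 * m))) \<partial>M)"
    by (intro nn_integral_mono powr_le_dyadic_sum q)
  also have "\<dots> = ennreal (2 powr q / sin (1/2) ^ (2 * m)) *
    dyadic_sum q (\<lambda>u. \<integral>\<^sup>+\<omega>. ennreal (sin (u * Y \<omega> / 2) ^ (2 * m)) \<partial>M)"
    unfolding dyadic_sum_def by (simp add: nn_integral_cmult nn_integral_add nn_integral_suminf)
  finally show ?thesis .
qed

lemma (in prob_space) moment_le_of_sine_moments:
  assumes Y[measurable]: "Y \<in> borel_measurable M" and q: "0 < q" "q < p" "\<eta> < q" and A: "0 \<le> A"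
    and low: "\<And>u. 0 < u \<Longrightarrow> u \<le> 1 \<Longrightarrow> sine_moment M Y m u \<le> A * u powr p"
    and high: "\<And>u. 1 \<le> u \<Longrightarrow> sine_moment M Y m u \<le> A * u powr \<eta>"
  shows "has_abs_moment M Y q"
    and "abs_moment M Y q \<le> moment_const m q p \<eta> * A"
proof -
  define c :: real where "c = 2 powr q / sin (1/2) ^ (2 * m)"
  have c0: "0 \<le> c" using sin_half_pos by (simp add: c_def)
  define F where "F u = ennreal (sine_moment M Y m u)" for u
  have i: "integrable M (\<lambda>\<omega>. sin (u * Y \<omega> / 2) ^ (2 * m))" for u
    by (rule integrable_const_bound[where B = 1]) (auto simp: power_abs abs_sin_le_one intro!: power_le_one)
  have F: "(\<integral>\<^sup>+\<omega>. ennreal (sin (u * Y \<omega> / 2) ^ (2 * m)) \<partial>M) = F u" for u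
    unfolding F_def by (rule nn_integral_eq_integral[OF i]) simp
  have "(\<integral>\<^sup>+\<omega>. ennreal (\<bar>Y \<omega>\<bar> powr q) \<partial>M) \<le> ennreal c * dyadic_sum q F"
    using nn_integral_powr_le_dyadic_sum[OF Y q(1), of m] unfolding F c_def .
  also have "\<dots> \<le> ennreal c * ennreal (A * (1 / (1 - 2 powr (\<eta> - q)) + 1 / (1 - 2 powr (q - p))))"
    using low high unfolding F_def by (intro mult_left_mono dyadic_sum_le q A ennreal_leI) auto
  also have "\<dots> = ennreal (moment_const m q p \<eta> * A)"
    using c0 by (simp add: ennreal_mult'[symmetric] moment_const_def c_def ac_simps)
  finally have *: "(\<integral>\<^sup>+\<omega>. ennreal (\<bar>Y \<omega>\<bar> powr q) \<partial>M) \<le> ennreal (moment_const m q p \<eta> * A)" .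
  show I: "has_abs_moment M Y q"
    by (rule integrableI_nonneg) (use * in \<open>auto intro: le_less_trans\<close>)
  have "ennreal (abs_moment M Y q) \<le> ennreal (moment_const m q p \<eta> * A)"
    using * by (subst nn_integral_eq_integral[OF I, symmetric]) auto
  then show "abs_moment M Y q \<le> moment_const m q p \<eta> * A"
    using moment_const_nonneg[OF q(2,3), of m] A by (subst (asm) ennreal_le_iff) auto
qed

section \<open>Moments of order below 2\<close>

lemma one_minus_Re_exp_le:
  assumes "Re z \<le> 0"
  shows "1 - Re (exp z) \<le> \<bar>Re z\<bar> + \<bar>Im z\<bar>\<^sup>2 / 2" "1 - Re (exp z) \<le> 2 * cmod z"
proof -
  have e: "1 - Re (exp z) = (1 - exp (Re z)) + exp (Re z) * (1 - cos (Im z))"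
    by (simp add: Re_exp algebra_simps)
  have 1: "1 - exp (Re z) \<le> \<bar>Re z\<bar>" using assms exp_ge_add_one_self[of "Re z"] by linarith
  have 2: "exp (Re z) * (1 - cos (Im z)) \<le> 1 - cos (Im z)"
    using assms by (intro mult_left_le_one_le) auto
  show "1 - Re (exp z) \<le> \<bar>Re z\<bar> + \<bar>Im z\<bar>\<^sup>2 / 2"
    using 1 2 one_minus_cos_le_sq[of "Im z"] e by simp
  have "1 - cos (Im z) \<le> \<bar>Im z\<bar>"
  proof (cases "\<bar>Im z\<bar> \<le> 2")
    case True
    have "(Im z)\<^sup>2 / 2 \<le> \<bar>Im z\<bar>" using mult_right_mono[OF True, of "\<bar>Im z\<bar>"] by (simp add: power2_eq_square)
    then show ?thesis using one_minus_cos_le_sq[of "Im z"] by linarith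
  next
    case False
    then show ?thesis using cos_ge_minus_one[of "Im z"] by linarith
  qed
  then show "1 - Re (exp z) \<le> 2 * cmod z"
    using 1 2 e abs_Re_le_cmod[of z] abs_Im_le_cmod[of z] by linarith
qed

text \<open>Trades the factor \<open>t\<close> for the smaller power \<open>t^\<kappa>\<close> in order to slow down the growth in the frequency.\<close>
lemma min_one_le_powr:
  fixes z \<kappa> :: real assumes "0 \<le> z" "0 \<le> \<kappa>" "\<kappa> \<le> 1" shows "min 1 z \<le> z powr \<kappa>"
proof (cases "z \<le> 1")
  case True
  then have "z powr 1 \<le> z powr \<kappa>" using assms by (intro powr_le_powr_of_le_one) auto
  then show ?thesis using assms True by simp
next
  case False
  then show ?thesis using assms by (simp add: ge_one_powr_ge_zero min_def)
qed

lemma (in prob_space) integrable_trig: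
  assumes [measurable]: "Y \<in> borel_measurable M"
  shows "integrable M (\<lambda>\<omega>. cos (u * Y \<omega>))" "integrable M (\<lambda>\<omega>. sin (u * Y \<omega>))"
    "integrable M (\<lambda>\<omega>. sin (u * Y \<omega> / 2) ^ n)" "complex_integrable M (\<lambda>\<omega>. iexp (u * Y \<omega>))"
  by (rule integrable_const_bound[where B = 1]; auto simp: power_abs intro!: power_le_one)+

lemma (in prob_space)
  assumes Y[measurable]: "Y \<in> borel_measurable M" and ch: "(CLINT \<omega>|M. iexp (u * Y \<omega>)) = exp z"
  shows expectation_cos: "expectation (\<lambda>\<omega>. cos (u * Y \<omega>)) = Re (exp z)"
    and expectation_sin: "expectation (\<lambda>\<omega>. sin (u * Y \<omega>)) = Im (exp z)"
    and expectation_sine_square: "expectation (\<lambda>\<omega>. sin (u * Y \<omega> / 2) ^ 2) = (1 - Re (exp z)) / 2"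
proof -
  have *: "Re (iexp (u * Y \<omega>)) = cos (u * Y \<omega>)" "Im (iexp (u * Y \<omega>)) = sin (u * Y \<omega>)" for \<omega>
    by (simp_all add: Re_exp Im_exp)
  have "Re (CLINT \<omega>|M. iexp (u * Y \<omega>)) = (LINT \<omega>|M. Re (iexp (u * Y \<omega>)))"
    by (rule integral_Re[OF integrable_trig(4)[OF Y], symmetric])
  then show c: "expectation (\<lambda>\<omega>. cos (u * Y \<omega>)) = Re (exp z)" unfolding ch * by simp
  have "Im (CLINT \<omega>|M. iexp (u * Y \<omega>)) = (LINT \<omega>|M. Im (iexp (u * Y \<omega>)))"
    by (rule integral_Im[OF integrable_trig(4)[OF Y], symmetric])
  then show "expectation (\<lambda>\<omega>. sin (u * Y \<omega>)) = Im (exp z)" unfolding ch * by simp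
  have "sin (a / 2) ^ 2 = (1 - cos a) / 2" for a :: real
    using cos_double_sin[of "a / 2"] by simp
  then have "expectation (\<lambda>\<omega>. sin (u * Y \<omega> / 2) ^ 2) = expectation (\<lambda>\<omega>. (1 - cos (u * Y \<omega>)) / 2)" by (simp only:)
  also have "\<dots> = (1 - expectation (\<lambda>\<omega>. cos (u * Y \<omega>))) / 2"
    using integrable_trig(1)[OF Y, of u] by (simp add: prob_space)
  finally show "expectation (\<lambda>\<omega>. sin (u * Y \<omega> / 2) ^ 2) = (1 - Re (exp z)) / 2" unfolding c .
qed

text \<open>The exponent \<open>\<kappa>\<close> is free: small \<open>\<kappa>\<close> makes the bound summable against \<open>u^(-q)\<close> as soon as \<open>\<kappa>\<theta> < q\<close>, and \<open>t^\<kappa>\<close> is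
then the rate of the moment. This is where the two regimes \<open>q \<le> \<alpha>\<close> and \<open>q > \<alpha>\<close> come from.\<close>
lemma (in prob_space) sine_moment_high_frequency:
  assumes Y[measurable]: "Y \<in> borel_measurable M"
    and ch: "(CLINT \<omega>|M. iexp (u * Y \<omega>)) = exp (complex_of_real t * \<psi>)"
    and re: "Re \<psi> \<le> 0" and t: "0 \<le> t" and u: "0 < u"
    and growth: "cmod \<psi> \<le> B * u powr \<theta>" and B: "0 \<le> B" and l: "0 < \<kappa>" "\<kappa> \<le> 1"
    and m: "1 \<le> m"
  shows "sine_moment M Y m u \<le> t powr \<kappa> * B powr \<kappa> * u powr (\<kappa> * \<theta>)"
proof -
  have "sin a ^ (2 * m) \<le> sin a ^ 2" for a :: real
  proof -
    have "sin a ^ 2 \<le> 1" by (simp add: abs_square_le_1)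
    then have "(sin a ^ 2) ^ m \<le> (sin a ^ 2) ^ 1" using m by (intro power_decreasing) auto
    then show ?thesis by (simp add: power_mult)
  qed
  then have "sine_moment M Y m u \<le> expectation (\<lambda>\<omega>. sin (u * Y \<omega> / 2) ^ 2)"
    using integrable_trig(3)[OF Y] by (intro integral_mono) auto
  also have "\<dots> = (1 - Re (exp (complex_of_real t * \<psi>))) / 2" by (rule expectation_sine_square[OF Y ch])
  also have "\<dots> \<le> min 1 (t * (B * u powr \<theta>))"
  proof -
    have "Re (complex_of_real t * \<psi>) \<le> 0" using re t by (simp add: mult_nonneg_nonpos)
    then have "1 - Re (exp (complex_of_real t * \<psi>)) \<le> 2 * (t * cmod \<psi>)"
      and "cmod (exp (complex_of_real t * \<psi>)) \<le> 1"
      using one_minus_Re_exp_le(2)[of "complex_of_real t * \<psi>"] t by (auto simp: norm_mult)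
    moreover have "t * cmod \<psi> \<le> t * (B * u powr \<theta>)" using growth t by (rule mult_left_mono)
    moreover have "- 1 \<le> Re (exp (complex_of_real t * \<psi>))"
      using abs_Re_le_cmod[of "exp (complex_of_real t * \<psi>)"] calculation(2) by linarith
    ultimately show ?thesis by simp
  qed
  also have "\<dots> \<le> (t * (B * u powr \<theta>)) powr \<kappa>"
    using t B l by (intro min_one_le_powr) auto
  also have "\<dots> = t powr \<kappa> * B powr \<kappa> * u powr (\<kappa> * \<theta>)"
    using t B by (simp add: powr_mult powr_powr mult.commute)
  finally show ?thesis .
qed

lemma has_triplet_char:
  "has_triplet M X \<gamma> \<sigma> \<nu> \<Longrightarrow> 0 \<le> t \<Longrightarrow>
    (CLINT \<omega>|M. iexp (u * X t \<omega>)) = exp (complex_of_real t * levy_exponent \<gamma> \<sigma> \<nu> u)"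
  by (simp add: has_triplet_def)

lemma has_triplet_levy_measure: "has_triplet M X \<gamma> \<sigma> \<nu> \<Longrightarrow> levy_measure \<nu>"
  by (simp add: has_triplet_def)

text \<open>Here \<open>m = 1\<close>, and \<open>E sin(uX(t)/2)^2\<close> is an explicit function of \<open>\<Psi>(u)\<close>. The order of the tail moment is
first lowered to at most 2, beyond which the quadratic behaviour of \<open>\<Psi>\<close> at 0 gives nothing more.\<close>
lemma moment_bound_order_less_2:
  assumes X: "levy_process M X" and tr: "has_triplet M X \<gamma> \<sigma> \<nu>"
    and tm: "tail_moment \<nu> p" and q: "0 < q" "q < p" "q < 2"
    and growth: "\<And>u. 1 \<le> u \<Longrightarrow> cmod (levy_exponent \<gamma> \<sigma> \<nu> u) \<le> B * u powr \<theta>"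
    and l: "0 < \<kappa>" "\<kappa> \<le> 1" "\<kappa> * \<theta> < q"
  obtains C where "0 \<le> C" "\<And>t. 0 < t \<Longrightarrow> t \<le> 1 \<Longrightarrow>
    has_abs_moment M (X t) q \<and> abs_moment M (X t) q \<le> C * t powr \<kappa>"
proof -
  interpret levy_process M X by fact
  note lm = has_triplet_levy_measure[OF tr]
  define r where "r = min p 2"
  have r: "0 < r" "r \<le> 2" "q < r" using q by (auto simp: r_def)
  have tmr: "tail_moment \<nu> r" by (rule tail_moment_mono[OF lm tm]) (simp add: r_def)
  obtain D where D: "0 \<le> D" "\<And>u. 0 < u \<Longrightarrow> u \<le> 1 \<Longrightarrow> \<bar>Re (levy_exponent \<gamma> \<sigma> \<nu> u)\<bar> \<le> D * u powr r"
    "\<And>u. 0 < u \<Longrightarrow> u \<le> 1 \<Longrightarrow> \<bar>Im (levy_exponent \<gamma> \<sigma> \<nu> u)\<bar> \<le> D * u powr (r / 2)"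
    by (rule levy_exponent_near_0[OF lm tmr r(1,2), where \<gamma> = \<gamma> and \<sigma> = \<sigma>]) (rule that, assumption+)
  have B: "0 \<le> B" using order_trans[OF norm_ge_zero growth[of 1]] by simp
  define E where "E = max (D + D\<^sup>2) (B powr \<kappa>)"
  have E0: "0 \<le> E" by (simp add: E_def le_max_iff_disj)
  show thesis
  proof (rule that[of "moment_const 1 q r (\<kappa> * \<theta>) * E"])
    show "0 \<le> moment_const 1 q r (\<kappa> * \<theta>) * E"
      using moment_const_nonneg[of q r "\<kappa> * \<theta>" 1] r l E0 by simp
    fix t :: real assume t: "0 < t" "t \<le> 1"
    have tl: "t \<le> t powr \<kappa>" using powr_le_powr_of_le_one[of t \<kappa> 1] t l by simp
    have [measurable]: "X t \<in> borel_measurable M" using t by (intro random_variable) auto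
    have ch: "(CLINT \<omega>|M. iexp (u * X t \<omega>)) = exp (complex_of_real t * levy_exponent \<gamma> \<sigma> \<nu> u)" for u
      using has_triplet_char[OF tr] t by simp
    have low: "sine_moment M (X t) 1 u \<le> (t powr \<kappa> * E) * u powr r"
      if u: "0 < u" "u \<le> 1" for u
    proof -
      let ?z = "complex_of_real t * levy_exponent \<gamma> \<sigma> \<nu> u"
      have a: "\<bar>Re ?z\<bar> \<le> t * (D * u powr r)" using D(2)[OF u] t by (simp add: abs_mult mult_left_mono)
      have "\<bar>Im ?z\<bar> \<le> t * (D * u powr (r/2))" using D(3)[OF u] t by (simp add: abs_mult mult_left_mono)
      then have "\<bar>Im ?z\<bar>\<^sup>2 \<le> (t * (D * u powr (r/2)))\<^sup>2" by (intro power_mono) auto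
      also have "\<dots> = t\<^sup>2 * (D\<^sup>2 * u powr r)"
      proof -
        have "u powr (r/2) * u powr (r/2) = u powr r" by (simp flip: powr_add)
        then show ?thesis by (simp add: power_mult_distrib power2_eq_square)
      qed
      also have "\<dots> \<le> t * (D\<^sup>2 * u powr r)"
        using t by (intro mult_right_mono) (auto simp: power2_eq_square mult_left_le)
      finally have b: "\<bar>Im ?z\<bar>\<^sup>2 \<le> t * (D\<^sup>2 * u powr r)" .
      have "Re ?z \<le> 0" using levy_exponent_Re_nonpos[OF lm, of \<gamma> \<sigma> u] t by (simp add: mult_nonneg_nonpos)
      then have "expectation (\<lambda>\<omega>. sin (u * X t \<omega> / 2) ^ 2) \<le> \<bar>Re ?z\<bar> + \<bar>Im ?z\<bar>\<^sup>2"
        unfolding expectation_sine_square[OF \<open>X t \<in> borel_measurable M\<close> ch]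
        using one_minus_Re_exp_le(1)[of ?z] zero_le_power2[of "\<bar>Im ?z\<bar>"] by argo
      also have "\<dots> \<le> t * ((D + D\<^sup>2) * u powr r)" using a b by (simp add: algebra_simps)
      also have "\<dots> \<le> t powr \<kappa> * (E * u powr r)"
        using tl D(1) by (intro mult_mono) (auto simp: E_def le_max_iff_disj)
      finally show ?thesis by (simp add: mult_ac)
    qed
    have high: "sine_moment M (X t) 1 u \<le> (t powr \<kappa> * E) * u powr (\<kappa> * \<theta>)"
      if u: "1 \<le> u" for u
    proof -
      have "sine_moment M (X t) 1 u \<le> t powr \<kappa> * B powr \<kappa> * u powr (\<kappa> * \<theta>)"
        by (rule sine_moment_high_frequency[OF _ ch levy_exponent_Re_nonpos[OF lm] _ _ growth[OF u] B])
           (use t u l in auto)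
      also have "\<dots> \<le> t powr \<kappa> * E * u powr (\<kappa> * \<theta>)"
        by (intro mult_right_mono mult_left_mono) (auto simp: E_def)
      finally show ?thesis .
    qed
    note mm = moment_le_of_sine_moments[where m = 1, OF _ q(1) r(3) l(3) _ low high]
    show "has_abs_moment M (X t) q \<and>
        abs_moment M (X t) q \<le> moment_const 1 q r (\<kappa> * \<theta>) * E * t powr \<kappa>"
      using mm E0 by (simp add: mult_ac)
  qed
qed

section \<open>Moments of order at least 2\<close>

text \<open>Proved by induction on the exponent: the remainder \<open>R_n\<close> satisfies
\<open>R_(n+1) = (s + d) R_n + n s^(n-1) d\<^sup>2\<close>.\<close>

lemma power_taylor2_bound:
  obtains C :: real where "0 \<le> C"
    "\<And>s d :: real. \<bar>(s + d) ^ (k + 2) - s ^ (k + 2) - real (k + 2) * s ^ (k + 1) * d\<bar> \<le>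
       C * (d\<^sup>2 * \<bar>s\<bar> ^ k + \<bar>d\<bar> ^ (k + 2))"
proof -
  have "\<exists>C\<ge>0. \<forall>s d :: real. \<bar>(s + d) ^ (k + 2) - s ^ (k + 2) - real (k + 2) * s ^ (k + 1) * d\<bar> \<le>
       C * (d\<^sup>2 * \<bar>s\<bar> ^ k + \<bar>d\<bar> ^ (k + 2))"
  proof (induction k)
    case 0
    show ?case by (intro exI[of _ 1]) (auto simp: power2_eq_square algebra_simps)
  next
    case (Suc k)
    then obtain C where C: "0 \<le> C" "\<And>s d :: real. \<bar>(s + d) ^ (k + 2) - s ^ (k + 2) - real (k + 2) * s ^ (k + 1) * d\<bar> \<le>
       C * (d\<^sup>2 * \<bar>s\<bar> ^ k + \<bar>d\<bar> ^ (k + 2))" by blast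
    have "\<bar>(s + d) ^ (Suc k + 2) - s ^ (Suc k + 2) - real (Suc k + 2) * s ^ (Suc k + 1) * d\<bar> \<le>
       (3 * C + real (k + 2)) * (d\<^sup>2 * \<bar>s\<bar> ^ (Suc k) + \<bar>d\<bar> ^ (Suc k + 2))" for s d :: real
    proof -
      define R where "R = (s + d) ^ (k + 2) - s ^ (k + 2) - real (k + 2) * s ^ (k + 1) * d"
      define V where "V = d\<^sup>2 * \<bar>s\<bar> ^ (Suc k) + \<bar>d\<bar> ^ (Suc k + 2)"
      have "(s + d) ^ (Suc k + 2) - s ^ (Suc k + 2) - real (Suc k + 2) * s ^ (Suc k + 1) * d =
          (s + d) * R + real (k + 2) * (s ^ (k + 1) * d\<^sup>2)"
        unfolding R_def by (simp add: algebra_simps power2_eq_square)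
      then have "\<bar>(s + d) ^ (Suc k + 2) - s ^ (Suc k + 2) - real (Suc k + 2) * s ^ (Suc k + 1) * d\<bar> \<le>
          \<bar>s + d\<bar> * \<bar>R\<bar> + real (k + 2) * (d\<^sup>2 * \<bar>s\<bar> ^ Suc k)"
        using abs_triangle_ineq[of "(s + d) * R" "real (k + 2) * (s ^ (k + 1) * d\<^sup>2)"]
        by (simp add: abs_mult power_abs mult_ac)
      also have "\<bar>s + d\<bar> * \<bar>R\<bar> \<le> (\<bar>s\<bar> + \<bar>d\<bar>) * (C * (d\<^sup>2 * \<bar>s\<bar> ^ k + \<bar>d\<bar> ^ (k + 2)))"
        using C(2)[of s d] by (intro mult_mono) (auto simp: R_def)
      also have "\<dots> \<le> C * (3 * V)"
      proof -
        have v: "\<bar>s\<bar> * \<bar>d\<bar> ^ (k + 2) \<le> V \<and> \<bar>d\<bar> * (d\<^sup>2 * \<bar>s\<bar> ^ k) \<le> V"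
        proof (cases "\<bar>s\<bar> \<le> \<bar>d\<bar>")
          case True
          then have "\<bar>s\<bar> * \<bar>d\<bar> ^ (k + 2) \<le> \<bar>d\<bar> * \<bar>d\<bar> ^ (k + 2)"
            and "\<bar>d\<bar> * (d\<^sup>2 * \<bar>s\<bar> ^ k) \<le> \<bar>d\<bar> * (d\<^sup>2 * \<bar>d\<bar> ^ k)"
            by (auto intro!: mult_right_mono mult_left_mono power_mono)
          moreover have "d\<^sup>2 * \<bar>d\<bar> ^ k = \<bar>d\<bar> ^ (k + 2)" by (simp add: power_add power2_eq_square)
          ultimately show ?thesis unfolding V_def by (simp add: add_increasing)
        next
          case False
          then have 1: "\<bar>s\<bar> * (d\<^sup>2 * \<bar>d\<bar> ^ k) \<le> \<bar>s\<bar> * (d\<^sup>2 * \<bar>s\<bar> ^ k)"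
            and 2: "\<bar>d\<bar> * (d\<^sup>2 * \<bar>s\<bar> ^ k) \<le> \<bar>s\<bar> * (d\<^sup>2 * \<bar>s\<bar> ^ k)"
            by (auto intro!: mult_right_mono mult_left_mono power_mono)
          have 3: "d\<^sup>2 * \<bar>d\<bar> ^ k = \<bar>d\<bar> ^ (k + 2)" by (simp add: power_add power2_eq_square)
          have "\<bar>s\<bar> * (d\<^sup>2 * \<bar>s\<bar> ^ k) = d\<^sup>2 * \<bar>s\<bar> ^ Suc k" by simp
          moreover have "\<dots> \<le> V" unfolding V_def by simp
          ultimately have "\<bar>s\<bar> * (d\<^sup>2 * \<bar>s\<bar> ^ k) \<le> V" by (rule ord_eq_le_trans)
          then show ?thesis using order_trans[OF 1] order_trans[OF 2] unfolding 3 by blast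
        qed
        have "(\<bar>s\<bar> + \<bar>d\<bar>) * (d\<^sup>2 * \<bar>s\<bar> ^ k + \<bar>d\<bar> ^ (k + 2)) =
            V + \<bar>s\<bar> * \<bar>d\<bar> ^ (k + 2) + \<bar>d\<bar> * (d\<^sup>2 * \<bar>s\<bar> ^ k)"
          unfolding V_def by (simp add: algebra_simps)
        also have "\<dots> \<le> 3 * V" using v by linarith
        finally show ?thesis using C(1) by (simp add: mult.left_commute mult_left_mono)
      qed
      also have "real (k + 2) * (d\<^sup>2 * \<bar>s\<bar> ^ Suc k) \<le> real (k + 2) * V"
        unfolding V_def by (intro mult_left_mono) auto
      finally show ?thesis unfolding V_def by (simp add: algebra_simps)
    qed
    then show ?case using C(1) by (intro exI[of _ "3 * C + real (k + 2)"]) auto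
  qed
  then show thesis using that by blast
qed

text \<open>Even trigonometric polynomials. The expectation of such a function is a combination of values of the
characteristic function; the inductive form lets linear facts be proved on cosines only, without
naming the coefficients.\<close>
inductive cos_poly :: "(real \<Rightarrow> real) \<Rightarrow> bool" where
  base: "cos_poly (\<lambda>x. cos (real k * x))"
| add: "cos_poly f \<Longrightarrow> cos_poly g \<Longrightarrow> cos_poly (\<lambda>x. f x + g x)"
| scale: "cos_poly f \<Longrightarrow> cos_poly (\<lambda>x. c * f x)"

lemma cos_poly_times_cos: "cos_poly f \<Longrightarrow> cos_poly (\<lambda>x. f x * cos x)"
proof (induction rule: cos_poly.induct)
  case (base k)
  have "cos_poly (\<lambda>x. (1/2) * (cos (real (k + 1) * x) + cos (real (if k = 0 then 1 else k - 1) * x)))"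
    by (intro cos_poly.intros)
  moreover have "(1/2) * (cos (real (k + 1) * x) + cos (real (if k = 0 then 1 else k - 1) * x)) =
      cos (real k * x) * cos x" for x
  proof -
    have "cos (real (if k = 0 then 1 else k - 1) * x) = cos (real k * x - x)"
      by (cases k) (auto simp: algebra_simps)
    moreover have "cos (real (k + 1) * x) = cos (real k * x + x)" by (simp add: algebra_simps)
    ultimately show ?thesis by (simp add: cos_add cos_diff)
  qed
  ultimately show ?case by simp
next
  case (add f g)
  then show ?case using cos_poly.add[OF add.IH] by (simp add: algebra_simps)
next
  case (scale f c)
  then show ?case using cos_poly.scale[OF scale.IH, of c] by (simp add: algebra_simps)
qed

lemma cos_poly_sine_power: "cos_poly (\<lambda>x. sin (x / 2) ^ (2 * m))"
proof (induction m)
  case 0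
  show ?case using cos_poly.base[of 0] by simp
next
  case (Suc m)
  have "cos_poly (\<lambda>x. (1/2) * sin (x / 2) ^ (2 * m) + (- 1/2) * (sin (x / 2) ^ (2 * m) * cos x))"
    by (intro cos_poly.add cos_poly.scale Suc cos_poly_times_cos)
  moreover have "(1/2) * sin (x / 2) ^ (2 * m) + (- 1/2) * (sin (x / 2) ^ (2 * m) * cos x) =
     sin (x / 2) ^ (2 * Suc m)" for x :: real
  proof -
    have "sin (x / 2) ^ 2 = (1 - cos x) / 2" using cos_double_sin[of "x / 2"] by simp
    moreover have "sin (x / 2) ^ (2 * Suc m) = sin (x / 2) ^ (2 * m) * sin (x / 2) ^ 2"
      by (simp add: power2_eq_square)
    ultimately show ?thesis by (simp only:) (simp add: algebra_simps)
  qed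
  ultimately show ?case by simp
qed

text \<open>The generator of the centred process, applied to the function that maps \<open>x\<close> to \<open>f(ux)\<close>; the
derivatives of \<open>f\<close> are passed as arguments.\<close>
definition centred_generator ::
    "real \<Rightarrow> real measure \<Rightarrow> real \<Rightarrow> (real \<Rightarrow> real) \<Rightarrow> (real \<Rightarrow> real) \<Rightarrow> (real \<Rightarrow> real) \<Rightarrow> real \<Rightarrow> real" where
  "centred_generator \<sigma> \<nu> u f f' f'' x =
     \<sigma>\<^sup>2 / 2 * u\<^sup>2 * f'' (u * x) + (LINT y|\<nu>. f (u * (x + y)) - f (u * x) - u * y * f' (u * x))"

text \<open>Kolmogorov's forward equation \<open>d/ds E f(uY(s)) = E (Af)(Y(s))\<close>. The two sides are the functions \<open>F\<close> and
\<open>G\<close>, defined on the whole line, so that the differentiation at time 0 is two-sided.\<close>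
definition forward_equation ::
    "'a measure \<Rightarrow> (real \<Rightarrow> 'a \<Rightarrow> real) \<Rightarrow> real \<Rightarrow> real measure \<Rightarrow> real \<Rightarrow> (real \<Rightarrow> real) \<Rightarrow>
     (real \<Rightarrow> real) \<Rightarrow> (real \<Rightarrow> real) \<Rightarrow> (real \<Rightarrow> real) \<Rightarrow> (real \<Rightarrow> real) \<Rightarrow> bool" where
  "forward_equation M Y \<sigma> \<nu> u f f' f'' F G \<longleftrightarrow>
     (\<forall>x. (f has_real_derivative f' x) (at x)) \<and> (\<forall>x. (f' has_real_derivative f'' x) (at x)) \<and>
     (\<forall>x. integrable \<nu> (\<lambda>y. f (u * (x + y)) - f (u * x) - u * y * f' (u * x))) \<and>
     (\<forall>s\<ge>0. integrable M (\<lambda>\<omega>. f (u * Y s \<omega>)) \<and> (LINT \<omega>|M. f (u * Y s \<omega>)) = F s \<and>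
        integrable M (\<lambda>\<omega>. centred_generator \<sigma> \<nu> u f f' f'' (Y s \<omega>)) \<and>
        (LINT \<omega>|M. centred_generator \<sigma> \<nu> u f f' f'' (Y s \<omega>)) = G s) \<and>
     (\<forall>s. (F has_real_derivative G s) (at s))"

lemma forward_equationD:
  assumes "forward_equation M Y \<sigma> \<nu> u f f' f'' F G"
  shows "\<forall>x. (f has_real_derivative f' x) (at x)" "\<forall>x. (f' has_real_derivative f'' x) (at x)"
    "integrable \<nu> (\<lambda>y. f (u * (x + y)) - f (u * x) - u * y * f' (u * x))"
    "\<forall>s\<ge>0. integrable M (\<lambda>\<omega>. f (u * Y s \<omega>)) \<and> (LINT \<omega>|M. f (u * Y s \<omega>)) = F s \<and>
        integrable M (\<lambda>\<omega>. centred_generator \<sigma> \<nu> u f f' f'' (Y s \<omega>)) \<and>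
        (LINT \<omega>|M. centred_generator \<sigma> \<nu> u f f' f'' (Y s \<omega>)) = G s"
    "\<forall>s. (F has_real_derivative G s) (at s)"
  using assms unfolding forward_equation_def by blast+

text \<open>For a cosine of frequency \<open>v\<close>, applying the generator multiplies \<open>exp(ivx)\<close> by the exponent at \<open>v\<close>, and so does
differentiating \<open>exp(s \<psi>(v))\<close> in time. Both sides are linear in the function.\<close>
lemma (in prob_space) forward_equation_cos_poly:
  fixes Y :: "real \<Rightarrow> 'a \<Rightarrow> real"
  assumes Y: "\<And>s. 0 \<le> s \<Longrightarrow> Y s \<in> borel_measurable M"
    and lm: "levy_measure \<nu>" and i2: "integrable \<nu> (\<lambda>x. x\<^sup>2)"
    and ch: "\<And>s v. 0 \<le> s \<Longrightarrow> (CLINT \<omega>|M. iexp (v * Y s \<omega>)) = exp (complex_of_real s * centred_exponent \<sigma> \<nu> v)"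
    and f: "cos_poly f"
  shows "\<exists>f' f'' F G. forward_equation M Y \<sigma> \<nu> u f f' f'' F G"
  using f
proof (induction rule: cos_poly.induct)
  case (base k)
  define v where "v = real k * u"
  define z where "z = centred_exponent \<sigma> \<nu> v"
  let ?f = "\<lambda>x. cos (real k * x)" and ?f' = "\<lambda>x. - real k * sin (real k * x)"
    and ?f'' = "\<lambda>x. - (real k)\<^sup>2 * cos (real k * x)"
  have jump: "?f (u * (x + y)) - ?f (u * x) - u * y * ?f' (u * x) = Re (iexp (v * x) * centred_kernel v y)" for x y
  proof -
    have "Re (iexp (v * x) * centred_kernel v y) = cos (v * x) * (cos (v * y) - 1) - sin (v * x) * (sin (v * y) - v * y)"
      by (simp add: centred_kernel_def Re_exp Im_exp)
    also have "\<dots> = cos (v * x + v * y) - cos (v * x) + v * y * sin (v * x)"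
      by (simp add: cos_add algebra_simps)
    finally show ?thesis by (simp add: v_def algebra_simps)
  qed
  have ik: "complex_integrable \<nu> (\<lambda>y. iexp (v * x) * centred_kernel v y)" for x
    using centred_kernel_integrable[OF lm i2] by (rule integrable_mult_right)
  have gen: "centred_generator \<sigma> \<nu> u ?f ?f' ?f'' x = Re (z * iexp (v * x))" for x
  proof -
    have "(LINT y|\<nu>. ?f (u * (x + y)) - ?f (u * x) - u * y * ?f' (u * x)) =
        Re (iexp (v * x) * (CLINT y|\<nu>. centred_kernel v y))"
      unfolding jump by (subst integral_Re[OF ik]) simp
    moreover have "\<sigma>\<^sup>2 / 2 * u\<^sup>2 * ?f'' (u * x) = Re (iexp (v * x) * (- complex_of_real (\<sigma>\<^sup>2 / 2 * v\<^sup>2)))"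
      by (simp add: v_def Re_exp power_mult_distrib mult_ac)
    ultimately have "centred_generator \<sigma> \<nu> u ?f ?f' ?f'' x =
       Re (iexp (v * x) * (- complex_of_real (\<sigma>\<^sup>2 / 2 * v\<^sup>2) + (CLINT y|\<nu>. centred_kernel v y)))"
      unfolding centred_generator_def distrib_left plus_complex.sel by linarith
    then show ?thesis unfolding z_def centred_exponent_def by (simp only: mult.commute)
  qed
  show ?case
    unfolding forward_equation_def
  proof (rule exI[of _ ?f'], rule exI[of _ ?f''], rule exI[of _ "\<lambda>s. Re (exp (complex_of_real s * z))"],
      rule exI[of _ "\<lambda>s. Re (z * exp (complex_of_real s * z))"], intro conjI allI impI)
    show "(?f has_real_derivative ?f' x) (at x)" for x by (auto intro!: derivative_eq_intros)
    show "(?f' has_real_derivative ?f'' x) (at x)" for x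
      by (auto intro!: derivative_eq_intros simp: power2_eq_square)
    show "integrable \<nu> (\<lambda>y. ?f (u * (x + y)) - ?f (u * x) - u * y * ?f' (u * x))" for x
      unfolding jump by (rule integrable_Re[OF ik])
    fix s :: real assume s: "0 \<le> s"
    note Ys = Y[OF s]
    have v: "?f (u * a) = cos (v * a)" for a by (simp add: v_def mult_ac)
    show "integrable M (\<lambda>\<omega>. ?f (u * Y s \<omega>))" unfolding v by (rule integrable_trig(1)[OF Ys])
    show "expectation (\<lambda>\<omega>. ?f (u * Y s \<omega>)) = Re (exp (complex_of_real s * z))"
      unfolding v z_def by (rule expectation_cos[OF Ys ch[OF s]])
    have i: "complex_integrable M (\<lambda>\<omega>. z * iexp (v * Y s \<omega>))"
      using integrable_trig(4)[OF Ys] by (rule integrable_mult_right)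
    show "integrable M (\<lambda>\<omega>. centred_generator \<sigma> \<nu> u ?f ?f' ?f'' (Y s \<omega>))"
      unfolding gen by (rule integrable_Re[OF i])
    have "expectation (\<lambda>\<omega>. Re (z * iexp (v * Y s \<omega>))) = Re (CLINT \<omega>|M. z * iexp (v * Y s \<omega>))"
      by (rule integral_Re[OF i])
    also have "\<dots> = Re (z * exp (complex_of_real s * z))"
      by (simp only: integral_mult_right_zero ch[OF s] z_def)
    finally show "expectation (\<lambda>\<omega>. centred_generator \<sigma> \<nu> u ?f ?f' ?f'' (Y s \<omega>)) = Re (z * exp (complex_of_real s * z))"
      unfolding gen .
  next
    show "((\<lambda>s. Re (exp (complex_of_real s * z))) has_real_derivative Re (z * exp (complex_of_real s * z))) (at s)" for s
      unfolding Re_exp Re_complex_of_real by (auto simp: Re_exp Im_exp algebra_simps intro!: derivative_eq_intros)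
  qed
next
  case (add f g)
  from add.IH(1) obtain f' f'' F G where "forward_equation M Y \<sigma> \<nu> u f f' f'' F G" by blast
  note f = forward_equationD[OF this]
  from add.IH(2) obtain g' g'' F2 G2 where "forward_equation M Y \<sigma> \<nu> u g g' g'' F2 G2" by blast
  note g = forward_equationD[OF this]
  have e: "f (u * (x + y)) + g (u * (x + y)) - (f (u * x) + g (u * x)) - u * y * (f' (u * x) + g' (u * x)) =
     (f (u * (x + y)) - f (u * x) - u * y * f' (u * x)) + (g (u * (x + y)) - g (u * x) - u * y * g' (u * x))" for x y
    by (simp add: algebra_simps)
  have gen: "centred_generator \<sigma> \<nu> u (\<lambda>x. f x + g x) (\<lambda>x. f' x + g' x) (\<lambda>x. f'' x + g'' x) x =
     centred_generator \<sigma> \<nu> u f f' f'' x + centred_generator \<sigma> \<nu> u g g' g'' x" for x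
    unfolding centred_generator_def e Bochner_Integration.integral_add[OF f(3) g(3)]
    by (simp add: distrib_left)
  show ?case
    apply (rule exI[of _ "\<lambda>x. f' x + g' x"])
    apply (rule exI[of _ "\<lambda>x. f'' x + g'' x"])
    apply (rule exI[of _ "\<lambda>x. F x + F2 x"])
    apply (rule exI[of _ "\<lambda>x. G x + G2 x"])
    unfolding forward_equation_def gen e
    using f(1,2,4,5) g(1,2,4,5) Bochner_Integration.integrable_add[OF f(3) g(3)]
    by (auto intro!: DERIV_add)
next
  case (scale f c)
  from scale.IH obtain f' f'' F G where "forward_equation M Y \<sigma> \<nu> u f f' f'' F G" by blast
  note f = forward_equationD[OF this]
  have e: "c * f (u * (x + y)) - c * f (u * x) - u * y * (c * f' (u * x)) =
     c * (f (u * (x + y)) - f (u * x) - u * y * f' (u * x))" for x y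
    by (simp add: algebra_simps)
  have gen: "centred_generator \<sigma> \<nu> u (\<lambda>x. c * f x) (\<lambda>x. c * f' x) (\<lambda>x. c * f'' x) x =
     c * centred_generator \<sigma> \<nu> u f f' f'' x" for x
    unfolding centred_generator_def e by (simp add: distrib_left)
  show ?case
    apply (rule exI[of _ "\<lambda>x. c * f' x"])
    apply (rule exI[of _ "\<lambda>x. c * f'' x"])
    apply (rule exI[of _ "\<lambda>x. c * F x"])
    apply (rule exI[of _ "\<lambda>x. c * G x"])
    unfolding forward_equation_def gen e
    using f(1,2,4,5) integrable_mult_right[OF f(3)]
    by (auto intro!: DERIV_cmult)
qed

lemma sin_increment_bounds:
  fixes a h :: real
  shows "\<bar>sin (a + h) - sin a\<bar> \<le> \<bar>h\<bar>" "\<bar>sin (a + h) - sin a\<bar> \<le> 2"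
    "\<bar>sin (a + h) - sin a - h * cos a\<bar> \<le> 2 * h\<^sup>2"
proof -
  have "\<bar>sin (a + h) - sin a\<bar> = 2 * \<bar>sin (h / 2)\<bar> * \<bar>cos ((a + h + a) / 2)\<bar>"
    unfolding sin_diff_sin by (simp add: abs_mult)
  also have "\<dots> \<le> 2 * \<bar>sin (h / 2)\<bar> * 1" by (intro mult_left_mono) auto
  also have "\<dots> \<le> \<bar>h\<bar>" using abs_sin_x_le_abs_x[of "h / 2"] by simp
  finally show "\<bar>sin (a + h) - sin a\<bar> \<le> \<bar>h\<bar>" .
  show "\<bar>sin (a + h) - sin a\<bar> \<le> 2"
    using sin_le_one[of a] sin_le_one[of "a+h"] sin_ge_minus_one[of a] sin_ge_minus_one[of "a+h"] by linarith
  have "sin (a + h) - sin a - h * cos a = - (sin a * (1 - cos h)) + cos a * (sin h - h)"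
    by (simp add: sin_add algebra_simps)
  also have "\<bar>\<dots>\<bar> \<le> \<bar>sin a\<bar> * \<bar>1 - cos h\<bar> + \<bar>cos a\<bar> * \<bar>sin h - h\<bar>"
    using abs_triangle_ineq[of "- (sin a * (1 - cos h))" "cos a * (sin h - h)"] by (simp add: abs_mult)
  also have "\<dots> \<le> 1 * (h\<^sup>2 / 2) + 1 * (h\<^sup>2 / 2)"
    using one_minus_cos_le_sq[of h] abs_sin_minus_le_sq[of h] by (intro add_mono mult_mono) auto
  also have "\<dots> \<le> 2 * h\<^sup>2" by simp
  finally show "\<bar>sin (a + h) - sin a - h * cos a\<bar> \<le> 2 * h\<^sup>2" .
qed

text \<open>Second-order expansion of \<open>sin^(2m+2)\<close> with a remainder that retains the factor \<open>sin^(2m)\<close>. This factor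
is what couples the sine moment of order \<open>2m + 2\<close> to that of order \<open>2m\<close>. The subtracted
first-order term is \<open>2h\<close> times the derivative of \<open>sin(x/2)^(2m+2)\<close> at \<open>x = 2a\<close>, the form in which the compensator supplies it.\<close>
lemma sine_power_increment:
  obtains C :: real where "0 \<le> C"
    "\<And>a h :: real. sin (a + h) ^ (2 * Suc m) - sin a ^ (2 * Suc m)
        - 2 * h * (real (Suc m) * sin a ^ (2 * m + 1) * cos a)
      \<le> C * (h\<^sup>2 * sin a ^ (2 * m) + \<bar>sin (a + h) - sin a\<bar> ^ (2 * Suc m))"
proof -
  obtain C0 :: real where C0: "0 \<le> C0" "\<And>s d :: real. \<bar>(s + d) ^ (2 * m + 2) - s ^ (2 * m + 2) - real (2 * m + 2) * s ^ (2 * m + 1) * d\<bar> \<le>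
       C0 * (d\<^sup>2 * \<bar>s\<bar> ^ (2 * m) + \<bar>d\<bar> ^ (2 * m + 2))"
    using power_taylor2_bound[of "2 * m"] by blast
  show thesis
  proof (rule that[of "C0 + 4 * real (Suc m)"])
    show "0 \<le> C0 + 4 * real (Suc m)" using C0 by simp
    fix a h :: real
    define S d where "S = sin a" and "d = sin (a + h) - sin a"
    have S: "\<bar>S\<bar> \<le> 1" by (simp add: S_def)
    have p: "\<bar>S\<bar> ^ (2 * m) = S ^ (2 * m)" by (simp add: power_mult)
    have d2: "d\<^sup>2 \<le> h\<^sup>2" using sin_increment_bounds(1)[of a h] by (simp add: d_def abs_le_square_iff)
    have "sin (a + h) ^ (2 * Suc m) - sin a ^ (2 * Suc m) - 2 * h * (real (Suc m) * sin a ^ (2 * m + 1) * cos a)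
       = ((S + d) ^ (2 * m + 2) - S ^ (2 * m + 2) - real (2 * m + 2) * S ^ (2 * m + 1) * d)
         + real (2 * m + 2) * (S ^ (2 * m + 1) * (d - h * cos a))"
      by (simp add: S_def d_def algebra_simps)
    also have "\<dots> \<le> C0 * (h\<^sup>2 * S ^ (2 * m) + \<bar>d\<bar> ^ (2 * m + 2)) + real (2 * m + 2) * (S ^ (2 * m) * (2 * h\<^sup>2))"
    proof (intro add_mono mult_left_mono)
      have "C0 * (d\<^sup>2 * \<bar>S\<bar> ^ (2 * m) + \<bar>d\<bar> ^ (2 * m + 2)) \<le> C0 * (h\<^sup>2 * S ^ (2 * m) + \<bar>d\<bar> ^ (2 * m + 2))"
        unfolding p using d2 C0(1) by (intro mult_left_mono add_mono mult_right_mono) (auto simp: power_mult)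
      then show "(S + d) ^ (2 * m + 2) - S ^ (2 * m + 2) - real (2 * m + 2) * S ^ (2 * m + 1) * d
         \<le> C0 * (h\<^sup>2 * S ^ (2 * m) + \<bar>d\<bar> ^ (2 * m + 2))" using C0(2)[of S d] by linarith
      have "S ^ (2 * m + 1) * (d - h * cos a) \<le> \<bar>S\<bar> ^ (2 * m + 1) * \<bar>d - h * cos a\<bar>"
        by (metis abs_ge_self abs_mult power_abs)
      also have "\<dots> \<le> S ^ (2 * m) * (2 * h\<^sup>2)"
        using S sin_increment_bounds(3)[of a h]
        by (intro mult_mono) (auto simp: p d_def power_mult mult_left_le_one_le)
      finally show "S ^ (2 * m + 1) * (d - h * cos a) \<le> S ^ (2 * m) * (2 * h\<^sup>2)" .
    qed simp
    also have "\<dots> \<le> (C0 + 4 * real (Suc m)) * (h\<^sup>2 * S ^ (2 * m) + \<bar>d\<bar> ^ (2 * Suc m))"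
      by (simp add: algebra_simps)
    finally show "sin (a + h) ^ (2 * Suc m) - sin a ^ (2 * Suc m)
        - 2 * h * (real (Suc m) * sin a ^ (2 * m + 1) * cos a)
      \<le> (C0 + 4 * real (Suc m)) * (h\<^sup>2 * sin a ^ (2 * m) + \<bar>sin (a + h) - sin a\<bar> ^ (2 * Suc m))"
      by (simp add: S_def d_def)
  qed
qed

lemma sine_power_derivatives:
  assumes f': "\<And>x. ((\<lambda>x. sin (x / 2) ^ (2 * Suc m)) has_real_derivative f' x) (at x)"
    and f'': "\<And>x. (f' has_real_derivative f'' x) (at x)"
  shows "f' x = real (Suc m) * sin (x / 2) ^ (2 * m + 1) * cos (x / 2)"
    and "f'' x \<le> real (Suc m) * real (2 * m + 1) * sin (x / 2) ^ (2 * m)"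
proof -
  have 1: "f' x = real (Suc m) * sin (x / 2) ^ (2 * m + 1) * cos (x / 2)" for x
  proof -
    have "((\<lambda>x. sin (x / 2) ^ (2 * Suc m)) has_real_derivative
        real (2 * Suc m) * (cos (x / 2) * (1 / 2) * sin (x / 2) ^ (2 * Suc m - Suc 0))) (at x)"
      by (rule DERIV_power) (auto intro!: derivative_eq_intros)
    from DERIV_unique[OF f' this] show ?thesis by (simp add: field_simps)
  qed
  then show "f' x = real (Suc m) * sin (x / 2) ^ (2 * m + 1) * cos (x / 2)" .
  have "((\<lambda>x. real (Suc m) * sin (x / 2) ^ (2 * m + 1) * cos (x / 2)) has_real_derivative
      real (Suc m) * (real (2 * m + 1) * sin (x / 2) ^ (2 * m) * (cos (x / 2) * (1 / 2)) * cos (x / 2)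
        + sin (x / 2) ^ (2 * m + 1) * (- sin (x / 2) * (1 / 2)))) (at x)"
  proof -
    have p: "((\<lambda>x. sin (x / 2) ^ (2 * m + 1)) has_real_derivative
        real (2 * m + 1) * (cos (x / 2) * (1 / 2) * sin (x / 2) ^ (2 * m + 1 - Suc 0))) (at x)"
      by (rule DERIV_power) (auto intro!: derivative_eq_intros)
    have c: "((\<lambda>x. cos (x / 2)) has_real_derivative - sin (x / 2) * (1 / 2)) (at x)"
      by (auto intro!: derivative_eq_intros)
    show ?thesis
      by (rule DERIV_cong[OF DERIV_cmult[OF DERIV_mult[OF p c], of "real (Suc m)", unfolded mult.assoc[symmetric]]])
         (simp add: algebra_simps)
  qed
  moreover have "(f' has_real_derivative f'' x) (at x)" by (rule f'')
  moreover have "f' = (\<lambda>x. real (Suc m) * sin (x / 2) ^ (2 * m + 1) * cos (x / 2))" using 1 by (rule ext)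
  ultimately have "f'' x = real (Suc m) * (real (2 * m + 1) * sin (x / 2) ^ (2 * m) * (cos (x / 2) * (1 / 2)) * cos (x / 2)
        + sin (x / 2) ^ (2 * m + 1) * (- sin (x / 2) * (1 / 2)))"
    using DERIV_unique by blast
  also have "\<dots> \<le> real (Suc m) * (real (2 * m + 1) * sin (x / 2) ^ (2 * m))"
  proof (rule mult_left_mono)
    have p: "0 \<le> sin (x / 2) ^ (2 * m)" by (simp add: power_mult)
    have "sin (x / 2) ^ (2 * m + 1) * (- sin (x / 2) * (1 / 2)) = - (1/2) * (sin (x / 2) ^ (2 * m) * (sin (x / 2))\<^sup>2)"
      by (simp add: power2_eq_square)
    also have "\<dots> \<le> 0" using p by (simp add: mult_nonneg_nonneg)
    finally have a: "sin (x / 2) ^ (2 * m + 1) * (- sin (x / 2) * (1 / 2)) \<le> 0" .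
    have "real (2 * m + 1) * sin (x / 2) ^ (2 * m) * (cos (x / 2) * (1 / 2)) * cos (x / 2) =
        real (2 * m + 1) * sin (x / 2) ^ (2 * m) * ((cos (x / 2))\<^sup>2 / 2)"
      by (simp add: power2_eq_square)
    also have "\<dots> \<le> real (2 * m + 1) * sin (x / 2) ^ (2 * m) * 1"
    proof (rule mult_left_mono)
      have "(cos (x / 2))\<^sup>2 \<le> 1" by (simp add: abs_square_le_1)
      then show "(cos (x / 2))\<^sup>2 / 2 \<le> 1" by simp
    qed (use p in simp)
    finally show "real (2 * m + 1) * sin (x / 2) ^ (2 * m) * (cos (x / 2) * (1 / 2)) * cos (x / 2)
        + sin (x / 2) ^ (2 * m + 1) * (- sin (x / 2) * (1 / 2)) \<le> real (2 * m + 1) * sin (x / 2) ^ (2 * m)"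
      using a by linarith
  qed simp
  finally show "f'' x \<le> real (Suc m) * real (2 * m + 1) * sin (x / 2) ^ (2 * m)" by (simp only: mult.assoc)
qed

text \<open>The remaining term of the expansion, integrated over the jumps, has to be of order \<open>u^r\<close> with \<open>r\<close> at
most \<open>p\<close>, since only jumps of moment \<open>p\<close> are available.\<close>
lemma truncated_power_le_jump_weight:
  fixes u y d p :: real and k :: nat
  assumes u: "0 < u" "u \<le> 1" and k: "1 \<le> k" and d: "\<bar>d\<bar> \<le> u * \<bar>y\<bar>" "\<bar>d\<bar> \<le> 2" and r: "0 \<le> r" "r \<le> p" "r \<le> real (2 * k)"
  shows "\<bar>d\<bar> ^ (2 * k) \<le> 4 ^ k * u powr r * jump_weight p y"
proof (cases "\<bar>y\<bar> \<le> 1")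
  case True
  have "\<bar>d\<bar> ^ (2 * k) \<le> (u * \<bar>y\<bar>) ^ (2 * k)" using d by (intro power_mono) auto
  also have "\<dots> = u powr real (2 * k) * \<bar>y\<bar> ^ (2 * k)" using u by (subst powr_realpow) (auto simp: power_mult_distrib)
  also have "\<dots> \<le> u powr r * y\<^sup>2"
  proof (rule mult_mono)
    show "u powr real (2 * k) \<le> u powr r" using u r by (intro powr_le_powr_of_le_one) auto
    have "\<bar>y\<bar> ^ (2 * k) \<le> \<bar>y\<bar> ^ 2" using True k by (intro power_decreasing) auto
    then show "\<bar>y\<bar> ^ (2 * k) \<le> y\<^sup>2" by simp
  qed auto
  also have "\<dots> \<le> 4 ^ k * (u powr r * y\<^sup>2)" by (rule order_trans[OF _ mult_right_mono[of 1 "4 ^ k"]]) auto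
  finally show ?thesis using True by (simp add: jump_weight_small mult.assoc)
next
  case False
  have "\<bar>d\<bar> ^ (2 * k) = 4 ^ k * (\<bar>d\<bar> / 2) ^ (2 * k)" by (simp add: power_divide power_mult)
  also have "\<dots> \<le> 4 ^ k * (u powr r * jump_weight p y)"
  proof (rule mult_left_mono)
    have "(\<bar>d\<bar> / 2) ^ (2 * k) \<le> (\<bar>d\<bar> / 2) powr r"
    proof (cases "d = 0")
      case False
      then have "(\<bar>d\<bar> / 2) ^ (2 * k) = (\<bar>d\<bar> / 2) powr real (2 * k)" by (subst powr_realpow) auto
      also have "\<dots> \<le> (\<bar>d\<bar> / 2) powr r" using d r by (intro powr_le_powr_of_le_one) auto
      finally show ?thesis .
    qed (use k in \<open>auto simp: power_0_left\<close>)
    also have "\<dots> \<le> (u * \<bar>y\<bar>) powr r" using d r by (intro powr_mono2) auto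
    also have "\<dots> = u powr r * \<bar>y\<bar> powr r" using u by (simp add: powr_mult)
    also have "\<dots> \<le> u powr r * jump_weight p y"
      using False r by (intro mult_left_mono order_trans[OF powr_mono jump_weight_large]) auto
    finally show "(\<bar>d\<bar> / 2) ^ (2 * k) \<le> u powr r * jump_weight p y" .
  qed simp
  finally show ?thesis by (simp add: mult.assoc)
qed

lemma centred_exponent_Re_nonpos:
  assumes "levy_measure \<nu>" "integrable \<nu> (\<lambda>x. x\<^sup>2)"
  shows "Re (centred_exponent \<sigma> \<nu> u) \<le> 0"
  using levy_exponent_centred[OF assms, of 0 \<sigma> u] levy_exponent_Re_nonpos[OF assms(1), of 0 \<sigma> u] by simp

text \<open>Induction on \<open>m\<close>. By the forward equation the derivative in time of the sine moment of order \<open>2m + 2\<close> is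
at most a constant times \<open>u\<^sup>2\<close> times the moment of order \<open>2m\<close> plus \<open>u^r\<close>, with \<open>r = min (2m + 2) p\<close>; each
step therefore gains two powers of \<open>u\<close> until \<open>p\<close> is reached. Since this bound is uniform in
time, the mean value theorem supplies the factor \<open>s\<close>; it is absent only for \<open>m = 0\<close>, where the
moment is 1.\<close>
lemma (in prob_space) sine_moment_low_frequency:
  fixes Y :: "real \<Rightarrow> 'a \<Rightarrow> real"
  assumes Y: "\<And>s. 0 \<le> s \<Longrightarrow> Y s \<in> borel_measurable M"
    and lm: "levy_measure \<nu>" and tm: "tail_moment \<nu> p" and p: "2 \<le> p"
    and ch: "\<And>s v. 0 \<le> s \<Longrightarrow> (CLINT \<omega>|M. iexp (v * Y s \<omega>)) = exp (complex_of_real s * centred_exponent \<sigma> \<nu> v)"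
  shows "\<exists>C\<ge>0. \<forall>u s. 0 < u \<and> u \<le> 1 \<and> 0 \<le> s \<and> s \<le> 1 \<longrightarrow>
    sine_moment M (Y s) m u \<le> C * (if m = 0 then 1 else s) * u powr min (real (2 * m)) p"
proof (induction m)
  case 0
  show ?case by (intro exI[of _ 1]) (use p in \<open>simp add: prob_space\<close>)
next
  case (Suc m)
  note i2 = tail_moment_2_integrable_sq[OF lm tm p]
  define V where "V = (LINT y|\<nu>. y\<^sup>2)"
  define W where "W = (LINT y|\<nu>. jump_weight p y)"
  have V0: "0 \<le> V" "0 \<le> W" unfolding V_def W_def by (auto intro!: integral_nonneg_AE simp: jump_weight_nonneg)
  obtain C1 where C1: "0 \<le> C1" "\<And>u s. 0 < u \<Longrightarrow> u \<le> 1 \<Longrightarrow> 0 \<le> s \<Longrightarrow> s \<le> 1 \<Longrightarrow>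
    sine_moment M (Y s) m u \<le> C1 * (if m = 0 then 1 else s) * u powr min (real (2 * m)) p"
    using Suc by blast
  obtain C0 :: real where C0: "0 \<le> C0" "\<And>a h :: real. sin (a + h) ^ (2 * Suc m) - sin a ^ (2 * Suc m)
        - 2 * h * (real (Suc m) * sin a ^ (2 * m + 1) * cos a)
      \<le> C0 * (h\<^sup>2 * sin a ^ (2 * m) + \<bar>sin (a + h) - sin a\<bar> ^ (2 * Suc m))"
    using sine_power_increment by blast
  define K where "K = real (Suc m) * real (2 * m + 1)"
  define D where "D = \<sigma>\<^sup>2 / 2 * K + C0 * V + C0 * 4 ^ Suc m * W"
  have K0: "0 \<le> K" by (simp add: K_def)
  have D0: "0 \<le> D" unfolding D_def using V0 C0(1) K0 by simp
  define r where "r = min (real (2 * Suc m)) p"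
  have r: "0 \<le> r" "r \<le> p" "r \<le> real (2 * Suc m)" using p by (auto simp: r_def)
  have "sine_moment M (Y s) (Suc m) u \<le> D * (C1 + 1) * s * u powr r"
    if u: "0 < u" "u \<le> 1" and s: "0 \<le> s" "s \<le> 1" for u s
  proof -
    let ?f = "\<lambda>x. sin (x / 2) ^ (2 * Suc m) :: real"
    obtain f' f'' F G where f: "\<And>x. (?f has_real_derivative f' x) (at x)" "\<And>x. (f' has_real_derivative f'' x) (at x)"
     "\<And>x. integrable \<nu> (\<lambda>y. ?f (u * (x + y)) - ?f (u * x) - u * y * f' (u * x))"
     "\<And>s. 0 \<le> s \<Longrightarrow> expectation (\<lambda>\<omega>. ?f (u * Y s \<omega>)) = F s"
     "\<And>s. 0 \<le> s \<Longrightarrow> integrable M (\<lambda>\<omega>. centred_generator \<sigma> \<nu> u ?f f' f'' (Y s \<omega>))"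
     "\<And>s. 0 \<le> s \<Longrightarrow> expectation (\<lambda>\<omega>. centred_generator \<sigma> \<nu> u ?f f' f'' (Y s \<omega>)) = G s"
     "\<And>s. (F has_real_derivative G s) (at s)"
      using forward_equation_cos_poly[OF Y lm i2 ch cos_poly_sine_power[of "Suc m"], of u]
      unfolding forward_equation_def by blast
    have gen: "centred_generator \<sigma> \<nu> u ?f f' f'' x \<le> D * (u\<^sup>2 * sin (u * x / 2) ^ (2 * m) + u powr r)" for x
    proof -
      let ?S = "sin (u * x / 2) ^ (2 * m)"
      have S0: "0 \<le> ?S" by (simp add: power_mult)
      have jump: "?f (u * (x + y)) - ?f (u * x) - u * y * f' (u * x) \<le>
          C0 * u\<^sup>2 * ?S * y\<^sup>2 + C0 * 4 ^ Suc m * u powr r * jump_weight p y" for y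
      proof -
        let ?d = "sin (u * x / 2 + u * y / 2) - sin (u * x / 2)"
        have "?f (u * (x + y)) - ?f (u * x) - u * y * f' (u * x) \<le>
            C0 * ((u * y / 2)\<^sup>2 * ?S + \<bar>?d\<bar> ^ (2 * Suc m))"
          using C0(2)[of "u * x / 2" "u * y / 2"] unfolding sine_power_derivatives(1)[OF f(1,2)]
          by (simp add: distrib_left add_divide_distrib)
        also have "\<dots> \<le> C0 * (u\<^sup>2 * y\<^sup>2 * ?S + 4 ^ Suc m * u powr r * jump_weight p y)"
        proof (intro mult_left_mono add_mono mult_right_mono S0 C0(1))
          show "(u * y / 2)\<^sup>2 \<le> u\<^sup>2 * y\<^sup>2" by (simp add: power_mult_distrib power_divide)
          show "\<bar>?d\<bar> ^ (2 * Suc m) \<le> 4 ^ Suc m * u powr r * jump_weight p y"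
          proof (rule truncated_power_le_jump_weight[OF u _ _ sin_increment_bounds(2) r])
            have "\<bar>u * y / 2\<bar> \<le> u * \<bar>y\<bar>" using u by (simp add: abs_mult)
            then show "\<bar>?d\<bar> \<le> u * \<bar>y\<bar>" using sin_increment_bounds(1)[of "u * x / 2" "u * y / 2"] by linarith
          qed simp
        qed
        finally show ?thesis by (simp add: algebra_simps)
      qed
      have "(LINT y|\<nu>. ?f (u * (x + y)) - ?f (u * x) - u * y * f' (u * x)) \<le>
          (LINT y|\<nu>. C0 * u\<^sup>2 * ?S * y\<^sup>2 + C0 * 4 ^ Suc m * u powr r * jump_weight p y)"
        using f(3) i2 jump_weight_integrable[OF lm tm] jump by (intro integral_mono) auto
      also have "\<dots> = C0 * u\<^sup>2 * ?S * V + C0 * 4 ^ Suc m * u powr r * W"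
        using i2 jump_weight_integrable[OF lm tm] by (simp add: V_def W_def)
      finally have "centred_generator \<sigma> \<nu> u ?f f' f'' x \<le> \<sigma>\<^sup>2 / 2 * u\<^sup>2 * f'' (u * x) + (C0 * u\<^sup>2 * ?S * V + C0 * 4 ^ Suc m * u powr r * W)"
        unfolding centred_generator_def by simp
      also have "\<sigma>\<^sup>2 / 2 * u\<^sup>2 * f'' (u * x) \<le> \<sigma>\<^sup>2 / 2 * u\<^sup>2 * (K * ?S)"
        unfolding K_def using sine_power_derivatives(2)[OF f(1,2), of "u * x"] by (intro mult_left_mono) auto
      also have "\<sigma>\<^sup>2 / 2 * u\<^sup>2 * (K * ?S) + (C0 * u\<^sup>2 * ?S * V + C0 * 4 ^ Suc m * u powr r * W) =
         (\<sigma>\<^sup>2 / 2 * K + C0 * V) * (u\<^sup>2 * ?S) + (C0 * 4 ^ Suc m * W) * u powr r"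
        by (simp add: algebra_simps)
      also have "\<dots> \<le> D * (u\<^sup>2 * ?S) + D * u powr r"
      proof (intro add_mono mult_right_mono)
        show "\<sigma>\<^sup>2 / 2 * K + C0 * V \<le> D" unfolding D_def using V0 C0(1) by simp
        show "C0 * 4 ^ Suc m * W \<le> D" unfolding D_def using V0 C0(1) K0 by simp
      qed (use S0 in auto)
      finally show ?thesis by (simp add: distrib_left)
    qed
    have G: "G t \<le> D * (C1 + 1) * u powr r" if t: "0 \<le> t" "t \<le> 1" for t
    proof -
      have "G t \<le> expectation (\<lambda>\<omega>. D * (u\<^sup>2 * sin (u * Y t \<omega> / 2) ^ (2 * m) + u powr r))"
        unfolding f(6)[OF t(1), symmetric] using f(5)[OF t(1)] integrable_trig(3)[OF Y[OF t(1)]] gen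
        by (intro integral_mono) auto
      also have "\<dots> = D * (u\<^sup>2 * sine_moment M (Y t) m u + u powr r)"
        using integrable_trig(3)[OF Y[OF t(1)]] by (simp add: prob_space)
      also have "\<dots> \<le> D * (C1 * u powr r + u powr r)"
      proof (intro mult_left_mono add_mono D0 order_refl)
        have "sine_moment M (Y t) m u \<le> C1 * (if m = 0 then 1 else t) * u powr min (real (2 * m)) p"
          by (rule C1(2)[OF u t])
        also have "\<dots> \<le> C1 * 1 * u powr min (real (2 * m)) p"
          using C1(1) t by (intro mult_right_mono mult_left_mono) auto
        finally have "u\<^sup>2 * sine_moment M (Y t) m u \<le> u\<^sup>2 * (C1 * u powr min (real (2 * m)) p)"
          by (intro mult_left_mono) auto
        also have "\<dots> = C1 * u powr (2 + min (real (2 * m)) p)"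
          using u by (simp add: powr_add powr_numeral)
        also have "\<dots> \<le> C1 * u powr r"
          using C1(1) u p by (intro mult_left_mono powr_le_powr_of_le_one) (auto simp: r_def min_def)
        finally show "u\<^sup>2 * sine_moment M (Y t) m u \<le> C1 * u powr r" .
      qed
      finally show ?thesis by (simp add: algebra_simps)
    qed
    \<comment> \<open>the process starts at 0: the high-frequency bound at time 0 reads \<open>0 powr 1 = 0\<close>\<close>
    have F0: "F 0 \<le> 0"
    proof -
      have "sine_moment M (Y 0) (Suc m) u \<le> 0 powr 1 * (\<sigma>\<^sup>2 / 2 + V / 2) powr 1 * u powr (1 * 2)"
        using centred_exponent_bound[OF lm i2, of \<sigma> u] u V0
        by (intro sine_moment_high_frequency[OF Y ch centred_exponent_Re_nonpos[OF lm i2]])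
           (auto simp: V_def powr_numeral)
      then show ?thesis using f(4)[of 0] by simp
    qed
    have "F s \<le> s * (D * (C1 + 1) * u powr r)"
    proof (cases "s = 0")
      case False
      then have "0 < s" using s by simp
      from MVT2[OF this, of F G] obtain x where x: "0 < x" "x < s" "F s - F 0 = (s - 0) * G x" using f(7) by blast
      then have "F s \<le> s * G x" using F0 by simp
      also have "\<dots> \<le> s * (D * (C1 + 1) * u powr r)" using G[of x] x s by (intro mult_left_mono) auto
      finally show ?thesis .
    qed (use F0 in simp)
    then show ?thesis unfolding f(4)[OF s(1)] by (simp add: mult_ac)
  qed
  then show ?case unfolding r_def using D0 C1(1) by (intro exI[of _ "D * (C1 + 1)"]) auto
qed

lemma abs_add_powr_le:
  fixes a b q :: real assumes "0 \<le> q"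
  shows "\<bar>a + b\<bar> powr q \<le> 2 powr q * (\<bar>a\<bar> powr q + \<bar>b\<bar> powr q)"
proof -
  have "\<bar>a + b\<bar> powr q \<le> (2 * max \<bar>a\<bar> \<bar>b\<bar>) powr q" using assms by (intro powr_mono2) auto
  also have "\<dots> = 2 powr q * max \<bar>a\<bar> \<bar>b\<bar> powr q" by (simp add: powr_mult)
  also have "\<dots> \<le> 2 powr q * (\<bar>a\<bar> powr q + \<bar>b\<bar> powr q)" by (intro mult_left_mono) (auto simp: max_def)
  finally show ?thesis .
qed

text \<open>The moment is first computed for the centred process \<open>X(t) - bt\<close>; restoring the mean costs \<open>t^q\<close>, which is
smaller than \<open>t^\<kappa>\<close>. At high frequency the quadratic bound on the centred exponent suffices, because \<open>\<kappa> < 1\<close> makes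
\<open>2\<kappa> < q\<close>.\<close>
lemma moment_bound_order_ge_2:
  assumes X: "levy_process M X" and tr: "has_triplet M X \<gamma> \<sigma> \<nu>"
    and tm: "tail_moment \<nu> p" and q: "q < p" "2 \<le> q" and l: "0 < \<kappa>" "\<kappa> < 1"
  obtains C where "0 \<le> C" "\<And>t. 0 < t \<Longrightarrow> t \<le> 1 \<Longrightarrow>
    has_abs_moment M (X t) q \<and> abs_moment M (X t) q \<le> C * t powr \<kappa>"
proof -
  interpret levy_process M X by fact
  note lm = has_triplet_levy_measure[OF tr]
  have p2: "2 \<le> p" using q by simp
  note i2 = tail_moment_2_integrable_sq[OF lm tm p2]
  define b where "b = \<gamma> + (LINT x|\<nu>. x * indicator {x. 1 < \<bar>x\<bar>} x)"
  define Y where "Y t \<omega> = X t \<omega> - b * t" for t \<omega>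
  have Y[measurable]: "Y s \<in> borel_measurable M" if "0 \<le> s" for s
    unfolding Y_def using random_variable[OF that] by measurable
  have ch: "(CLINT \<omega>|M. iexp (v * Y s \<omega>)) = exp (complex_of_real s * centred_exponent \<sigma> \<nu> v)" if s: "0 \<le> s" for s v
  proof -
    have "(CLINT \<omega>|M. iexp (v * Y s \<omega>)) = (CLINT \<omega>|M. iexp (v * X s \<omega>) * exp (- (\<i> * complex_of_real (v * b * s))))"
      by (intro Bochner_Integration.integral_cong) (auto simp: Y_def exp_add[symmetric] algebra_simps)
    also have "\<dots> = exp (complex_of_real s * levy_exponent \<gamma> \<sigma> \<nu> v) * exp (- (\<i> * complex_of_real (v * b * s)))"
      by (simp only: integral_mult_left_zero has_triplet_char[OF tr s])
    also have "\<dots> = exp (complex_of_real s * centred_exponent \<sigma> \<nu> v)"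
      unfolding levy_exponent_centred[OF lm i2] b_def[symmetric] by (simp add: exp_add[symmetric] algebra_simps)
    finally show ?thesis .
  qed
  define m where "m = nat \<lceil>p\<rceil>"
  have m: "1 \<le> m" "p \<le> real (2 * m)" using p2 unfolding m_def by linarith+
  obtain C0 where C0: "0 \<le> C0" "\<And>u s. 0 < u \<Longrightarrow> u \<le> 1 \<Longrightarrow> 0 \<le> s \<Longrightarrow> s \<le> 1 \<Longrightarrow>
     sine_moment M (Y s) m u \<le> C0 * s * u powr p"
    using sine_moment_low_frequency[OF Y lm tm p2 ch, of m] m by (auto simp: min_absorb2)
  define B where "B = \<sigma>\<^sup>2 / 2 + (LINT x|\<nu>. x\<^sup>2) / 2"
  have B: "0 \<le> B" by (simp add: B_def)
  define A where "A = max C0 (B powr \<kappa>)"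
  have A0: "0 \<le> A" by (simp add: A_def le_max_iff_disj)
  let ?c = "moment_const m q p (\<kappa> * 2)"
  have l2: "\<kappa> * 2 < q" "0 < q" using l q by auto
  have c0: "0 \<le> ?c" by (rule moment_const_nonneg[OF q(1) l2(1)])
  define C where "C = 2 powr q * (?c * A + \<bar>b\<bar> powr q)"
  show thesis
  proof (rule that[of C])
    show "0 \<le> C" using c0 A0 by (simp add: C_def)
    fix t :: real assume t: "0 < t" "t \<le> 1"
    have t0: "0 \<le> t" using t by simp
    have tl: "t \<le> t powr \<kappa>" using powr_le_powr_of_le_one[of t \<kappa> 1] t l by simp
    have low: "sine_moment M (Y t) m u \<le> (t powr \<kappa> * A) * u powr p"
      if u: "0 < u" "u \<le> 1" for u
    proof -
      have "sine_moment M (Y t) m u \<le> C0 * t * u powr p"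
        by (rule C0(2)) (use u t in auto)
      also have "\<dots> \<le> A * t powr \<kappa> * u powr p"
        using tl C0(1) A0 t by (intro mult_right_mono mult_mono) (auto simp: A_def)
      finally show ?thesis by (simp add: mult_ac)
    qed
    have high: "sine_moment M (Y t) m u \<le> (t powr \<kappa> * A) * u powr (\<kappa> * 2)"
      if u: "1 \<le> u" for u
    proof -
      have "sine_moment M (Y t) m u \<le> t powr \<kappa> * B powr \<kappa> * u powr (\<kappa> * 2)"
        using centred_exponent_bound[OF lm i2, of \<sigma> u] u l m B t0
        by (intro sine_moment_high_frequency[OF Y[OF t0] ch[OF t0] centred_exponent_Re_nonpos[OF lm i2]])
           (auto simp: B_def powr_numeral)
      also have "\<dots> \<le> t powr \<kappa> * A * u powr (\<kappa> * 2)"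
        by (intro mult_right_mono mult_left_mono) (auto simp: A_def)
      finally show ?thesis .
    qed
    have tA: "0 \<le> t powr \<kappa> * A" using A0 by simp
    note mm = moment_le_of_sine_moments[OF Y[OF t0] l2(2) q(1) l2(1) tA low high]
    have le: "\<bar>X t \<omega>\<bar> powr q \<le> 2 powr q * (\<bar>Y t \<omega>\<bar> powr q + \<bar>b * t\<bar> powr q)" for \<omega>
      using abs_add_powr_le[of q "Y t \<omega>" "b * t"] l2 by (simp add: Y_def)
    have iY: "integrable M (\<lambda>\<omega>. 2 powr q * (\<bar>Y t \<omega>\<bar> powr q + \<bar>b * t\<bar> powr q))" using mm(1) by simp
    have Xm: "(\<lambda>\<omega>. \<bar>X t \<omega>\<bar> powr q) \<in> borel_measurable M" using random_variable[OF t0] by measurable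
    have "\<bar>b * t\<bar> powr q = \<bar>b\<bar> powr q * t powr q" using t by (simp add: abs_mult powr_mult)
    also have "\<dots> \<le> \<bar>b\<bar> powr q * t powr \<kappa>"
      using t l q by (intro mult_left_mono powr_le_powr_of_le_one) auto
    finally have bt: "\<bar>b * t\<bar> powr q \<le> \<bar>b\<bar> powr q * t powr \<kappa>" .
    have "\<bar>LINT \<omega>|M. \<bar>X t \<omega>\<bar> powr q\<bar> \<le> (LINT \<omega>|M. 2 powr q * (\<bar>Y t \<omega>\<bar> powr q + \<bar>b * t\<bar> powr q))"
      by (rule integral_abs_le_bound(2)[OF Xm iY]) (use le in simp)
    also have "\<dots> = 2 powr q * (abs_moment M (Y t) q + \<bar>b * t\<bar> powr q)"
      using mm(1) by (simp add: prob_space)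
    also have "\<dots> \<le> 2 powr q * (?c * (t powr \<kappa> * A) + \<bar>b\<bar> powr q * t powr \<kappa>)"
      using mm(2) bt by (intro mult_left_mono add_mono) auto
    also have "\<dots> = C * t powr \<kappa>" by (simp add: C_def algebra_simps)
    finally show "has_abs_moment M (X t) q \<and> abs_moment M (X t) q \<le> C * t powr \<kappa>"
      using integral_abs_le_bound(1)[OF Xm iY] le by auto
  qed
qed

section \<open>Lower bounds for moments\<close>

lemma sq_le_one_minus_cos: "\<bar>x\<bar> \<le> 1 \<Longrightarrow> x\<^sup>2 \<le> 4 * (1 - cos x)" for x :: real
proof -
  assume x: "\<bar>x\<bar> \<le> 1"
  define z where "z = \<bar>x\<bar> / 2"
  have z: "0 \<le> z" "z \<le> 1/2" using x by (auto simp: z_def)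
  have "z\<^sup>2 \<le> z * (1/2)" using mult_left_mono[OF z(2,1)] by (simp add: power2_eq_square)
  then have "3/4 * z \<le> sin z" using abs_sin_minus_le_sq[of z] by linarith
  then have "(3/4 * z)\<^sup>2 \<le> (sin z)\<^sup>2" using z by (intro power_mono) auto
  moreover have "cos x = 1 - 2 * (sin z)\<^sup>2" using cos_double_sin[of "x / 2"] by (cases "0 \<le> x") (auto simp: z_def)
  moreover have "(3/4 * z)\<^sup>2 = 9/64 * x\<^sup>2" by (simp add: z_def power_mult_distrib power_divide)
  ultimately have "9 * x\<^sup>2 \<le> 64 * (sin z)\<^sup>2" "cos x = 1 - 2 * (sin z)\<^sup>2" by simp_all
  then have "x\<^sup>2 \<le> 8 * (sin z)\<^sup>2" "1 - cos x = 2 * (sin z)\<^sup>2"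
    using zero_le_power2[of "sin z"] by linarith+
  then show "x\<^sup>2 \<le> 4 * (1 - cos x)" by simp
qed

lemma one_minus_cos_square: "(1 - cos x)\<^sup>2 = 2 * (1 - cos x) - (1 - cos (2 * x)) / 2" for x :: real
  unfolding cos_double_cos by (simp add: power2_eq_square field_simps)

lemma
  fixes f :: "'a \<Rightarrow> real"
  assumes "integrable M (\<lambda>\<omega>. 1 - cos (u * f \<omega>))" "integrable M (\<lambda>\<omega>. 1 - cos (2 * u * f \<omega>))"
  shows integrable_one_minus_cos_square: "integrable M (\<lambda>\<omega>. (1 - cos (u * f \<omega>))\<^sup>2)"
    and integral_one_minus_cos_square: "(LINT \<omega>|M. (1 - cos (u * f \<omega>))\<^sup>2) =
      2 * (LINT \<omega>|M. 1 - cos (u * f \<omega>)) - (LINT \<omega>|M. 1 - cos (2 * u * f \<omega>)) / 2"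
proof -
  have e: "(1 - cos (u * f \<omega>))\<^sup>2 = 2 * (1 - cos (u * f \<omega>)) - (1 - cos (2 * u * f \<omega>)) / 2" for \<omega>
    using one_minus_cos_square[of "u * f \<omega>"] by (simp add: mult.assoc)
  note i = integrable_mult_right[OF assms(1), of 2] integrable_divide[OF assms(2), of 2]
  show "integrable M (\<lambda>\<omega>. (1 - cos (u * f \<omega>))\<^sup>2)"
    unfolding e using i by (rule Bochner_Integration.integrable_diff)
  show "(LINT \<omega>|M. (1 - cos (u * f \<omega>))\<^sup>2) =
      2 * (LINT \<omega>|M. 1 - cos (u * f \<omega>)) - (LINT \<omega>|M. 1 - cos (2 * u * f \<omega>)) / 2"
    unfolding e Bochner_Integration.integral_diff[OF i] integral_mult_right_zero integral_divide_zero ..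
qed

text \<open>If the integral vanished for all \<open>u = 1/n\<close>, almost every jump size \<open>x\<close> would satisfy \<open>cos(x/n) = 1\<close> for all
\<open>n\<close>, hence \<open>x = 0\<close>.\<close>
lemma levy_measure_nonzero_cos:
  assumes lm: "levy_measure \<nu>" and nz: "\<nu> \<noteq> null_measure borel"
  obtains u where "0 < (LINT x|\<nu>. (1 - cos (u * x))\<^sup>2)"
proof (rule ccontr)
  note [measurable_cong] = levy_sets[OF lm]
  assume "\<not> thesis"
  then have le: "\<not> 0 < (LINT x|\<nu>. (1 - cos (u * x))\<^sup>2)" for u using that by blast
  have i: "integrable \<nu> (\<lambda>x. (1 - cos (u * x))\<^sup>2)" for u
    by (intro integrable_one_minus_cos_square one_minus_cos_integrable[OF lm])
  have ae: "AE x in \<nu>. (1 - cos (u * x))\<^sup>2 = 0" for u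
  proof -
    have "0 \<le> (LINT x|\<nu>. (1 - cos (u * x))\<^sup>2)" by (rule integral_nonneg_AE) simp
    then have "(LINT x|\<nu>. (1 - cos (u * x))\<^sup>2) = 0" using le[of u] by linarith
    then show ?thesis using integral_nonneg_eq_0_iff_AE[OF i] by simp
  qed
  have "AE x in \<nu>. \<forall>n. (1 - cos (1 / real (Suc n) * x))\<^sup>2 = 0"
    unfolding AE_all_countable using ae by blast
  then have "AE x in \<nu>. x = 0"
  proof eventually_elim
    case (elim x)
    obtain n where n: "\<bar>x\<bar> < real (Suc n)" using reals_Archimedean2[of "\<bar>x\<bar>"] by (metis less_Suc_eq of_nat_less_iff order_less_trans)
    then have b: "\<bar>1 / real (Suc n) * x\<bar> \<le> 1" by (simp add: abs_mult field_simps)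
    then have "(1 / real (Suc n) * x)\<^sup>2 \<le> 0" using sq_le_one_minus_cos[OF b] elim by simp
    then show ?case by simp
  qed
  then have "emeasure \<nu> {x. x \<noteq> 0} = 0"
    using AE_iff_measurable[of "{x. x \<noteq> 0}" \<nu> "\<lambda>x. x = 0"] levy_sets[OF lm] levy_space[OF lm] by auto
  then have "emeasure \<nu> ({x. x \<noteq> 0} \<union> {0}) = 0"
    using lm levy_sets[OF lm] by (subst emeasure_Un_null_set) (auto simp: levy_measure_def null_sets_def)
  moreover have "{x. x \<noteq> 0} \<union> {0} = (UNIV :: real set)" by auto
  ultimately have "emeasure \<nu> UNIV = 0" by simp
  then have "emeasure \<nu> A = 0" if "A \<in> sets \<nu>" for A
    using emeasure_mono[of A UNIV \<nu>] levy_sets[OF lm] by simp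
  then have "\<nu> = null_measure borel"
    by (intro measure_eqI) (auto simp: levy_sets[OF lm])
  then show False using nz by simp
qed

text \<open>The function \<open>(1 - cos(ux))\<^sup>2\<close> vanishes to fourth order at 0, so its expectation has at time 0 the
derivative \<open>J\<close>, the integral of that function over the Levy measure: drift and Gaussian part cancel. Values of \<open>X(t)\<close> below a
small \<open>\<delta>\<close> account for at most half of \<open>J t / 2\<close>, because there the function is at most
\<open>\<delta>\<^sup>2 u^4 (1 - cos x)\<close>, whose expectation is of order \<open>\<delta>\<^sup>2 t\<close>. The rest comes from \<open>|X(t)| > \<delta>\<close>.\<close>
lemma moment_ge_linear:
  assumes X: "levy_process M X" and tr: "has_triplet M X \<gamma> \<sigma> \<nu>"
    and nz: "\<nu> \<noteq> null_measure borel" and q: "0 < q"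
  obtains c where "0 < c"
    "\<forall>\<^sub>F t in at_right 0. has_abs_moment M (X t) q \<longrightarrow> c * t \<le> abs_moment M (X t) q"
proof -
  interpret levy_process M X by fact
  note lm = has_triplet_levy_measure[OF tr]
  let ?\<Psi> = "levy_exponent \<gamma> \<sigma> \<nu>"
  obtain u where u: "0 < (LINT x|\<nu>. (1 - cos (u * x))\<^sup>2)"
    by (rule levy_measure_nonzero_cos[OF lm nz])
  define J where "J = (LINT x|\<nu>. (1 - cos (u * x))\<^sup>2)"
  have J: "0 < J" using u by (simp add: J_def)
  have Je: "J = - 2 * Re (?\<Psi> u) + Re (?\<Psi> (2 * u)) / 2"
  proof -
    have "J = 2 * (LINT x|\<nu>. 1 - cos (u * x)) - (LINT x|\<nu>. 1 - cos (2 * u * x)) / 2"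
      unfolding J_def by (intro integral_one_minus_cos_square one_minus_cos_integrable[OF lm])
    then show ?thesis unfolding levy_exponent_Re[OF lm] by (simp add: power_mult_distrib field_simps)
  qed
  define F where "F t = 2 * (1 - Re (exp (complex_of_real t * ?\<Psi> u))) - (1 - Re (exp (complex_of_real t * ?\<Psi> (2 * u)))) / 2" for t
  have d: "((\<lambda>t. Re (exp (complex_of_real t * z))) has_real_derivative Re z) (at 0)" for z
    unfolding Re_exp by (auto intro!: derivative_eq_intros)
  have "(F has_real_derivative J) (at 0)"
    unfolding F_def Je by (rule derivative_eq_intros d refl | simp)+
  then have "((\<lambda>h. (F (0 + h) - F 0) / h) \<longlongrightarrow> J) (at 0)" by (simp add: DERIV_def)
  moreover have "F 0 = 0" by (simp add: F_def)
  ultimately have "((\<lambda>h. F h / h) \<longlongrightarrow> J) (at 0)" by simp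
  then have "((\<lambda>h. F h / h) \<longlongrightarrow> J) (at_right 0)" by (rule filterlim_mono) (auto simp: at_le)
  then have "\<forall>\<^sub>F t in at_right 0. J / 2 < F t / t" using J by (intro order_tendstoD) auto
  then have evF: "\<forall>\<^sub>F t in at_right 0. J / 2 * t \<le> F t"
    using eventually_at_right_less[of 0] by eventually_elim (simp add: field_simps)
  define B where "B = u ^ 4 * (2 * cmod (?\<Psi> 1)) + 1"
  have B: "0 < B" by (simp add: B_def add_nonneg_pos)
  define \<delta> where "\<delta> = min 1 (sqrt (J / 4 / B))"
  have \<delta>: "0 < \<delta>" "\<delta> \<le> 1" using J B by (auto simp: \<delta>_def)
  have "\<delta>\<^sup>2 \<le> (sqrt (J / 4 / B))\<^sup>2" using \<delta> by (intro power_mono) (auto simp: \<delta>_def)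
  also have "\<dots> = J / 4 / B" using J B by simp
  finally have "\<delta>\<^sup>2 * B \<le> J / 4" using B by (simp add: field_simps)
  moreover have "\<delta>\<^sup>2 * (u ^ 4 * (2 * cmod (?\<Psi> 1))) \<le> \<delta>\<^sup>2 * B" by (intro mult_left_mono) (auto simp: B_def)
  ultimately have dB: "\<delta>\<^sup>2 * (u ^ 4 * (2 * cmod (?\<Psi> 1))) \<le> J / 4" by linarith
  have pw: "(1 - cos (u * x))\<^sup>2 \<le> 4 / \<delta> powr q * \<bar>x\<bar> powr q + \<delta>\<^sup>2 * u ^ 4 * (1 - cos x)" for x
  proof (cases "\<bar>x\<bar> \<le> \<delta>")
    case True
    have "(1 - cos (u * x))\<^sup>2 \<le> ((u * x)\<^sup>2 / 2)\<^sup>2"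
      using one_minus_cos_le_sq[of "u * x"] by (intro power_mono) auto
    also have "\<dots> = u ^ 4 / 4 * (x\<^sup>2 * x\<^sup>2)"
      by (simp add: power_mult_distrib power_divide power2_eq_square power4_eq_xxxx)
    also have "\<dots> \<le> u ^ 4 / 4 * (\<delta>\<^sup>2 * (4 * (1 - cos x)))"
    proof (intro mult_left_mono mult_mono)
      show "x\<^sup>2 \<le> \<delta>\<^sup>2" using True by (simp add: abs_le_square_iff[symmetric])
      show "x\<^sup>2 \<le> 4 * (1 - cos x)" using True \<delta> by (intro sq_le_one_minus_cos) auto
    qed auto
    also have "\<dots> = \<delta>\<^sup>2 * u ^ 4 * (1 - cos x)" by simp
    also have "\<dots> \<le> 4 / \<delta> powr q * \<bar>x\<bar> powr q + \<delta>\<^sup>2 * u ^ 4 * (1 - cos x)" by simp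
    finally show ?thesis .
  next
    case False
    have "\<bar>1 - cos (u * x)\<bar> \<le> 2" using cos_ge_minus_one[of "u*x"] cos_le_one[of "u*x"] by linarith
    then have "\<bar>1 - cos (u * x)\<bar>\<^sup>2 \<le> 2\<^sup>2" by (intro power_mono) auto
    then have "(1 - cos (u * x))\<^sup>2 \<le> 4" by simp
    also have "4 \<le> 4 / \<delta> powr q * \<bar>x\<bar> powr q"
    proof -
      have "\<delta> powr q \<le> \<bar>x\<bar> powr q" using False \<delta> q by (intro powr_mono2) auto
      then show ?thesis using \<delta> by (simp add: field_simps)
    qed
    finally show ?thesis by (simp add: add_increasing2)
  qed
  show thesis
  proof (rule that[of "J / 4 * (\<delta> powr q / 4)"])
    show "0 < J / 4 * (\<delta> powr q / 4)" using J \<delta> by simp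
    show "\<forall>\<^sub>F t in at_right 0. has_abs_moment M (X t) q \<longrightarrow>
       J / 4 * (\<delta> powr q / 4) * t \<le> abs_moment M (X t) q"
      using evF eventually_at_right_less[of 0]
    proof (eventually_elim, intro impI)
      case (elim t)
      assume iq: "has_abs_moment M (X t) q"
      have t: "0 \<le> t" using elim by simp
      note Xt = random_variable[OF t]
      have ec: "expectation (\<lambda>\<omega>. 1 - cos (v * X t \<omega>)) = 1 - Re (exp (complex_of_real t * ?\<Psi> v))" for v
        using integrable_trig(1)[OF Xt, of v] expectation_cos[OF Xt has_triplet_char[OF tr t, of v]]
        by (simp add: prob_space)
      have ic: "integrable M (\<lambda>\<omega>. 1 - cos (v * X t \<omega>))" for v
        using integrable_trig(1)[OF Xt, of v] by simp
      have iS: "integrable M (\<lambda>\<omega>. (1 - cos (u * X t \<omega>))\<^sup>2)"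
        by (intro integrable_one_minus_cos_square ic)
      have "F t = expectation (\<lambda>\<omega>. (1 - cos (u * X t \<omega>))\<^sup>2)"
        unfolding F_def integral_one_minus_cos_square[OF ic ic] ec ..
      also have "\<dots> \<le> expectation (\<lambda>\<omega>. 4 / \<delta> powr q * \<bar>X t \<omega>\<bar> powr q + \<delta>\<^sup>2 * u ^ 4 * (1 - cos (1 * X t \<omega>)))"
        using iS iq ic[of 1] pw by (intro integral_mono) auto
      also have "\<dots> = 4 / \<delta> powr q * abs_moment M (X t) q + \<delta>\<^sup>2 * u ^ 4 * expectation (\<lambda>\<omega>. 1 - cos (1 * X t \<omega>))"
        using iq ic[of 1] by simp
      also have "expectation (\<lambda>\<omega>. 1 - cos (1 * X t \<omega>)) \<le> 2 * (t * cmod (?\<Psi> 1))"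
        unfolding ec using one_minus_Re_exp_le(2)[of "complex_of_real t * ?\<Psi> 1"] t
          levy_exponent_Re_nonpos[OF lm, of \<gamma> \<sigma> 1] by (simp add: norm_mult mult_nonneg_nonpos)
      then have "\<delta>\<^sup>2 * u ^ 4 * expectation (\<lambda>\<omega>. 1 - cos (1 * X t \<omega>)) \<le> \<delta>\<^sup>2 * u ^ 4 * (2 * (t * cmod (?\<Psi> 1)))"
        by (intro mult_left_mono) auto
      also have "\<dots> = \<delta>\<^sup>2 * (u ^ 4 * (2 * cmod (?\<Psi> 1))) * t" by simp
      also have "\<dots> \<le> J / 4 * t" using dB t by (rule mult_right_mono)
      finally have "J / 2 * t \<le> 4 / \<delta> powr q * abs_moment M (X t) q + J / 4 * t"
        using elim(1) by linarith
      then have "J / 4 * t \<le> 4 / \<delta> powr q * abs_moment M (X t) q" by linarith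
      then show "J / 4 * (\<delta> powr q / 4) * t \<le> abs_moment M (X t) q"
        using \<delta> by (simp add: field_simps)
    qed
  qed
qed

lemma fdd_converges_one:
  fixes g :: "real \<Rightarrow> real"
  assumes "fdd_converges M (\<lambda>t s \<omega>. X (t * s) \<omega> / a t) F N Xhat"
    and g: "continuous_on UNIV g" "\<And>x. \<bar>g x\<bar> \<le> B"
  shows "((\<lambda>t. LINT \<omega>|M. g (X t \<omega> / a t)) \<longlongrightarrow> (LINT \<omega>|N. g (Xhat 1 \<omega>))) F"
proof -
  let ?f = "\<lambda>h :: nat \<Rightarrow> real. g (h 0)"
  have "continuous_on UNIV ?f"
    by (rule continuous_on_compose2[OF g(1)]) (auto intro!: continuous_on_product_coordinates)
  moreover have "bounded (range ?f)" by (rule boundedI[of _ B]) (auto simp: g(2))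
  ultimately have "((\<lambda>t. LINT \<omega>|M. ?f (\<lambda>i. if i < 1 then X (t * (1::real)) \<omega> / a t else 0)) \<longlongrightarrow>
         (LINT \<omega>|N. ?f (\<lambda>i. if i < 1 then Xhat 1 \<omega> else 0))) F"
    using assms(1) unfolding fdd_converges_def
    by (auto dest!: spec[of _ "1::nat"] spec[of _ "\<lambda>i::nat. 1::real"] spec[of _ ?f])
  then show ?thesis by simp
qed

text \<open>The bounded continuous function \<open>min 1 |x|^q\<close> has a strictly positive expectation in the limit, as otherwise
\<open>Xhat(1)\<close> would vanish almost surely and its characteristic function would be 1.\<close>
lemma moment_ge_scaling:
  assumes X: "levy_process M X" and Z: "levy_process N Xhat" and a: "\<And>t. 0 < t \<Longrightarrow> 0 < a t"
    and fd: "fdd_converges M (\<lambda>t s \<omega>. X (t * s) \<omega> / a t) (at_right 0) N Xhat"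
    and trh: "has_triplet N Xhat \<gamma>h \<sigma>h \<nu>h" and ne: "exp (levy_exponent \<gamma>h \<sigma>h \<nu>h u) \<noteq> 1"
    and q: "0 < q"
  obtains c where "0 < c"
    "\<forall>\<^sub>F t in at_right 0. has_abs_moment M (X t) q \<longrightarrow> c * a t powr q \<le> abs_moment M (X t) q"
proof -
  interpret X: levy_process M X by fact
  interpret Z: levy_process N Xhat by fact
  let ?g = "\<lambda>x::real. min 1 (\<bar>x\<bar> powr q)"
  have Z1[measurable]: "Xhat 1 \<in> borel_measurable N" by (rule Z.random_variable) simp
  have "continuous_on UNIV (\<lambda>x::real. \<bar>x\<bar> powr q)"
    by (rule continuous_on_powr') (use q in \<open>auto intro!: continuous_intros\<close>)
  then have cg: "continuous_on UNIV ?g" by (intro continuous_on_min continuous_on_const)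
  have lim: "((\<lambda>t. LINT \<omega>|M. ?g (X t \<omega> / a t)) \<longlongrightarrow> (LINT \<omega>|N. ?g (Xhat 1 \<omega>))) (at_right 0)"
    by (rule fdd_converges_one[OF fd cg, where B = 1]) auto
  have ig: "integrable N (\<lambda>\<omega>. ?g (Xhat 1 \<omega>))"
    by (rule Z.integrable_const_bound[where B = 1]) auto
  have pos: "0 < (LINT \<omega>|N. ?g (Xhat 1 \<omega>))"
  proof (rule ccontr)
    assume "\<not> ?thesis"
    moreover have "0 \<le> (LINT \<omega>|N. ?g (Xhat 1 \<omega>))" by (rule integral_nonneg_AE) simp
    ultimately have "(LINT \<omega>|N. ?g (Xhat 1 \<omega>)) = 0" by linarith
    then have "AE \<omega> in N. ?g (Xhat 1 \<omega>) = 0" using integral_nonneg_eq_0_iff_AE[OF ig] by simp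
    then have "AE \<omega> in N. iexp (u * Xhat 1 \<omega>) = 1" by eventually_elim (auto simp: min_def split: if_splits)
    then have "(CLINT \<omega>|N. iexp (u * Xhat 1 \<omega>)) = (CLINT \<omega>|N. 1)" by (intro integral_cong_AE) auto
    then show False using ne has_triplet_char[OF trh, of 1 u] by (simp add: Z.prob_space)
  qed
  define c where "c = (LINT \<omega>|N. ?g (Xhat 1 \<omega>)) / 2"
  have c: "0 < c" "c < (LINT \<omega>|N. ?g (Xhat 1 \<omega>))" using pos by (auto simp: c_def)
  show thesis
  proof (rule that[OF c(1)])
    show "\<forall>\<^sub>F t in at_right 0. has_abs_moment M (X t) q \<longrightarrow> c * a t powr q \<le> abs_moment M (X t) q"
      using order_tendstoD(1)[OF lim c(2)] eventually_at_right_less[of 0]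
    proof (eventually_elim, intro impI)
      case (elim t)
      assume iq: "has_abs_moment M (X t) q"
      note at = a[OF elim(2)]
      have [measurable]: "X t \<in> borel_measurable M" using elim by (intro X.random_variable) auto
      have e: "\<bar>x / a t\<bar> powr q = \<bar>x\<bar> powr q / a t powr q" for x
        using at by (simp add: powr_divide)
      have "c \<le> (LINT \<omega>|M. ?g (X t \<omega> / a t))" using elim by simp
      also have "\<dots> \<le> (LINT \<omega>|M. \<bar>X t \<omega>\<bar> powr q / a t powr q)"
        unfolding e using iq
        by (intro integral_mono integrable_divide X.integrable_const_bound[where B = 1 and f = "\<lambda>\<omega>. min 1 (\<bar>X t \<omega>\<bar> powr q / a t powr q)"]) auto
      also have "\<dots> = abs_moment M (X t) q / a t powr q" by simp
      finally show "c * a t powr q \<le> abs_moment M (X t) q" using at by (simp add: field_simps)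
    qed
  qed
qed

section \<open>Convergence of the exponents\<close>

lemma levy_exponent_continuous_comp:
  assumes lm: "levy_measure \<nu>" and f: "continuous_on S f"
  shows "continuous_on S (\<lambda>u. levy_exponent \<gamma> \<sigma> \<nu> (f u))"
  by (rule continuous_on_compose2[OF levy_exponent_continuous[OF lm] f]) simp

lemma cmod_iexp_diff_le: "cmod (iexp a - iexp b) \<le> min 2 \<bar>a - b\<bar>"
proof -
  have "iexp a - iexp b = iexp b * (iexp (a - b) - 1)"
    by (simp add: algebra_simps exp_add[symmetric])
  then have "cmod (iexp a - iexp b) = cmod (iexp (a - b) - 1)" by (simp add: norm_mult)
  also have "\<dots> \<le> \<bar>a - b\<bar>" using iexp_approx1[of "a - b" 0] by simp
  finally have 1: "cmod (iexp a - iexp b) \<le> \<bar>a - b\<bar>" .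
  have "cmod (iexp a - iexp b) \<le> cmod (iexp a) + cmod (iexp b)" by (rule norm_triangle_ineq4)
  then show ?thesis using 1 by simp
qed

text \<open>A modulus of continuity of the characteristic function that is the expectation of a bounded continuous function of
the variable, and hence passes to the limit in law. This gives equicontinuity without tightness.\<close>
lemma (in prob_space) char_increment_le:
  assumes Y[measurable]: "Y \<in> borel_measurable M" and uv: "\<bar>u - v\<bar> \<le> \<delta>"
  shows "cmod ((CLINT \<omega>|M. iexp (u * Y \<omega>)) - (CLINT \<omega>|M. iexp (v * Y \<omega>))) \<le>
    expectation (\<lambda>\<omega>. min 2 (\<delta> * \<bar>Y \<omega>\<bar>))"
proof -
  note i = integrable_trig(4)[OF Y]
  have d: "0 \<le> \<delta>" using uv by linarith
  have "(CLINT \<omega>|M. iexp (u * Y \<omega>)) - (CLINT \<omega>|M. iexp (v * Y \<omega>)) =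
      (CLINT \<omega>|M. iexp (u * Y \<omega>) - iexp (v * Y \<omega>))"
    by (rule Bochner_Integration.integral_diff[OF i i, symmetric])
  also have "cmod \<dots> \<le> (LINT \<omega>|M. cmod (iexp (u * Y \<omega>) - iexp (v * Y \<omega>)))"
    by (rule integral_norm_bound)
  also have "\<dots> \<le> expectation (\<lambda>\<omega>. min 2 (\<delta> * \<bar>Y \<omega>\<bar>))"
  proof (rule integral_mono)
    show "integrable M (\<lambda>\<omega>. cmod (iexp (u * Y \<omega>) - iexp (v * Y \<omega>)))"
      by (intro integrable_norm Bochner_Integration.integrable_diff i)
    show "integrable M (\<lambda>\<omega>. min 2 (\<delta> * \<bar>Y \<omega>\<bar>))"
      by (rule integrable_const_bound[where B = 2]) (use d in auto)
    fix \<omega>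
    have "\<bar>u * Y \<omega> - v * Y \<omega>\<bar> = \<bar>u - v\<bar> * \<bar>Y \<omega>\<bar>" by (simp add: abs_mult[symmetric] algebra_simps)
    also have "\<dots> \<le> \<delta> * \<bar>Y \<omega>\<bar>" using uv by (intro mult_right_mono) auto
    finally show "cmod (iexp (u * Y \<omega>) - iexp (v * Y \<omega>)) \<le> min 2 (\<delta> * \<bar>Y \<omega>\<bar>)"
      using cmod_iexp_diff_le[of "u * Y \<omega>" "v * Y \<omega>"] by linarith
  qed
  finally show ?thesis .
qed

lemma (in prob_space) truncated_first_moment_small:
  assumes Y[measurable]: "Y \<in> borel_measurable M" and e: "0 < \<epsilon>"
  obtains n :: nat where "expectation (\<lambda>\<omega>. min 2 (1 / real (Suc n) * \<bar>Y \<omega>\<bar>)) < \<epsilon>"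
proof -
  have "(\<lambda>n. expectation (\<lambda>\<omega>. min 2 (1 / real (Suc n) * \<bar>Y \<omega>\<bar>))) \<longlonglongrightarrow> expectation (\<lambda>\<omega>. 0)"
  proof (rule integral_dominated_convergence[where w = "\<lambda>_. 2"])
    show "AE \<omega> in M. (\<lambda>n. min 2 (1 / real (Suc n) * \<bar>Y \<omega>\<bar>)) \<longlonglongrightarrow> 0"
    proof (rule AE_I2)
      fix \<omega>
      have "(\<lambda>n. 1 / real (Suc n) * \<bar>Y \<omega>\<bar>) \<longlonglongrightarrow> 0 * \<bar>Y \<omega>\<bar>"
        by (intro tendsto_mult LIMSEQ_Suc[OF lim_1_over_n] tendsto_const)
      then have "(\<lambda>n. min 2 (1 / real (Suc n) * \<bar>Y \<omega>\<bar>)) \<longlonglongrightarrow> min 2 (0 * \<bar>Y \<omega>\<bar>)"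
        by (intro tendsto_min tendsto_const)
      then show "(\<lambda>n. min 2 (1 / real (Suc n) * \<bar>Y \<omega>\<bar>)) \<longlonglongrightarrow> 0" by simp
    qed
  qed auto
  then have "(\<lambda>n. expectation (\<lambda>\<omega>. min 2 (1 / real (Suc n) * \<bar>Y \<omega>\<bar>))) \<longlonglongrightarrow> 0" by simp
  then have "\<forall>\<^sub>F n in sequentially. expectation (\<lambda>\<omega>. min 2 (1 / real (Suc n) * \<bar>Y \<omega>\<bar>)) < \<epsilon>"
    using e by (intro order_tendstoD) auto
  then show thesis using that by (auto dest!: eventually_happens)
qed

text \<open>If \<open>exp(d)\<close> stays near 1 along a path that starts at \<open>d = 0\<close>, then \<open>d\<close> cannot wander to another multiple of
\<open>2\<pi>i\<close>: its imaginary part would have to cross \<open>\<pi>/2\<close> or \<open>-\<pi>/2\<close>, where the real part of \<open>exp(d)\<close> is 0.\<close>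
lemma log_lift_small:
  fixes d :: "real \<Rightarrow> complex"
  assumes d: "continuous_on {0..1} d" "d 0 = 0"
    and e: "\<eta> < 1/2" "\<And>u. u \<in> {0..1} \<Longrightarrow> cmod (exp (d u) - 1) \<le> \<eta>"
    and u: "u \<in> {0..1}"
  shows "cmod (d u) \<le> 2 * \<eta>"
proof -
  have im: "\<bar>Im (d u)\<bar> < pi / 2"
  proof (rule ccontr)
    assume "\<not> ?thesis"
    then have *: "pi / 2 \<le> \<bar>Im (d u)\<bar>" by simp
    have "continuous_on {0..u} (\<lambda>w. \<bar>Im (d w)\<bar>)"
      by (intro continuous_intros continuous_on_subset[OF d(1)]) (use u in auto)
    then obtain w where w: "0 \<le> w" "w \<le> u" "\<bar>Im (d w)\<bar> = pi / 2"
      using IVT'[of "\<lambda>w. \<bar>Im (d w)\<bar>" 0 "pi / 2" u] * u d(2) by auto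
    then have "Im (d w) = pi / 2 \<or> Im (d w) = - (pi / 2)" by linarith
    then have "cos (Im (d w)) = 0" by (metis cos_minus cos_pi_half)
    then have "Re (exp (d w) - 1) = - 1" by (simp add: Re_exp)
    then have "1 \<le> cmod (exp (d w) - 1)" using abs_Re_le_cmod[of "exp (d w) - 1"] by simp
    moreover have "cmod (exp (d w) - 1) \<le> \<eta>" using w u by (intro e) auto
    ultimately show False using e(1) by linarith
  qed
  then have "d u = Ln (exp (d u))" using pi_gt_zero by (subst Ln_exp) auto
  also have "\<dots> = Ln (1 + (exp (d u) - 1))" by simp
  finally have "cmod (d u) = cmod (Ln (1 + (exp (d u) - 1)))" by simp
  also have "\<dots> \<le> 2 * cmod (exp (d u) - 1)"
    using e(2)[OF u] e(1) by (intro norm_Ln_le) auto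
  finally show ?thesis using e(2)[OF u] by linarith
qed

text \<open>The characteristic functions converge at the points of a finite grid and are equicontinuous, hence converge uniformly on the
unit interval. The limit is bounded away from 0 there, so the quotient is uniformly near 1 and
\<open>log_lift_small\<close> applies to the difference of the exponents.\<close>
lemma exponents_converge_uniformly:
  assumes X: "levy_process M X" and Z: "levy_process N Xhat" and a: "\<And>t. 0 < t \<Longrightarrow> 0 < a t"
    and fd: "fdd_converges M (\<lambda>t s \<omega>. X (t * s) \<omega> / a t) (at_right 0) N Xhat"
    and tr: "has_triplet M X \<gamma> \<sigma> \<nu>" and trh: "has_triplet N Xhat \<gamma>h \<sigma>h \<nu>h"
    and e: "0 < \<epsilon>"
  shows "\<forall>\<^sub>F t in at_right 0. \<forall>u\<in>{0..1}.
    cmod (complex_of_real t * levy_exponent \<gamma> \<sigma> \<nu> (u / a t) - levy_exponent \<gamma>h \<sigma>h \<nu>h u) \<le> \<epsilon>"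
proof -
  interpret X: levy_process M X by fact
  interpret Z: levy_process N Xhat by fact
  note lm = has_triplet_levy_measure[OF tr] and lmh = has_triplet_levy_measure[OF trh]
  have Z1[measurable]: "Xhat 1 \<in> borel_measurable N" by (rule Z.random_variable) simp
  let ?\<phi> = "\<lambda>t u. exp (complex_of_real t * levy_exponent \<gamma> \<sigma> \<nu> (u / a t))"
  let ?\<psi> = "\<lambda>u. exp (levy_exponent \<gamma>h \<sigma>h \<nu>h u)"
  have ch: "(CLINT \<omega>|M. iexp (u * (X t \<omega> / a t))) = ?\<phi> t u" if "0 < t" for t u
    using has_triplet_char[OF tr, of t "u / a t"] that by (simp add: mult.commute)
  have chh: "(CLINT \<omega>|N. iexp (u * Xhat 1 \<omega>)) = ?\<psi> u" for u
    using has_triplet_char[OF trh, of 1 u] by simp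
  have Xt: "(\<lambda>\<omega>. X t \<omega> / a t) \<in> borel_measurable M" if "0 < t" for t
    by (intro borel_measurable_divide X.random_variable borel_measurable_const) (use that in simp)
  have pw: "((\<lambda>t. ?\<phi> t u) \<longlongrightarrow> ?\<psi> u) (at_right 0)" for u
  proof -
    have c: "((\<lambda>t. LINT \<omega>|M. cos (u * (X t \<omega> / a t))) \<longlongrightarrow> (LINT \<omega>|N. cos (u * Xhat 1 \<omega>))) (at_right 0)"
      by (rule fdd_converges_one[OF fd, where B = 1]) (auto intro!: continuous_intros)
    have s: "((\<lambda>t. LINT \<omega>|M. sin (u * (X t \<omega> / a t))) \<longlongrightarrow> (LINT \<omega>|N. sin (u * Xhat 1 \<omega>))) (at_right 0)"
      by (rule fdd_converges_one[OF fd, where B = 1]) (auto intro!: continuous_intros)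
    have h1: "((\<lambda>t. Complex (LINT \<omega>|M. cos (u * (X t \<omega> / a t))) (LINT \<omega>|M. sin (u * (X t \<omega> / a t)))) \<longlongrightarrow>
        Complex (LINT \<omega>|N. cos (u * Xhat 1 \<omega>)) (LINT \<omega>|N. sin (u * Xhat 1 \<omega>))) (at_right 0)"
      by (intro tendsto_Complex c s)
    have h2: "Complex (LINT \<omega>|N. cos (u * Xhat 1 \<omega>)) (LINT \<omega>|N. sin (u * Xhat 1 \<omega>)) = ?\<psi> u"
      unfolding Z.expectation_cos[OF Z1 chh] Z.expectation_sin[OF Z1 chh] by (rule complex_surj)
    have h3: "\<forall>\<^sub>F t in at_right 0. Complex (LINT \<omega>|M. cos (u * (X t \<omega> / a t))) (LINT \<omega>|M. sin (u * (X t \<omega> / a t))) = ?\<phi> t u"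
      using eventually_at_right_less[of 0]
    proof eventually_elim
      case (elim t)
      show ?case
        unfolding X.expectation_cos[OF Xt[OF elim] ch[OF elim]] X.expectation_sin[OF Xt[OF elim] ch[OF elim]]
        by (rule complex_surj)
    qed
    show ?thesis using h1 unfolding tendsto_cong[OF h3] h2 .
  qed
  obtain w where w: "w \<in> {0..1::real}" "\<And>u. u \<in> {0..1} \<Longrightarrow> cmod (?\<psi> w) \<le> cmod (?\<psi> u)"
  proof -
    have cont: "continuous_on {0..1::real} (\<lambda>u. cmod (?\<psi> u))"
      by (intro continuous_intros levy_exponent_continuous_comp[OF lmh])
    have "\<exists>w\<in>{0..1}. \<forall>u\<in>{0..1}. cmod (?\<psi> w) \<le> cmod (?\<psi> u)"
      by (rule continuous_attains_inf[OF compact_Icc _ cont]) simp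
    then show thesis using that by blast
  qed
  define c where "c = cmod (?\<psi> w)"
  have c: "0 < c" by (simp add: c_def)
  define \<eta> where "\<eta> = min (1/3) (\<epsilon> / 2)"
  have \<eta>: "0 < \<eta>" "\<eta> < 1/2" "2 * \<eta> \<le> \<epsilon>" using e by (auto simp: \<eta>_def)
  define \<rho> where "\<rho> = \<eta> * c / 3"
  have \<rho>: "0 < \<rho>" using \<eta> c by (simp add: \<rho>_def)
  obtain n where n: "(LINT \<omega>|N. min 2 (1 / real (Suc n) * \<bar>Xhat 1 \<omega>\<bar>)) < \<rho>"
    using Z.truncated_first_moment_small[OF Z1 \<rho>] .
  define K where "K = Suc n"
  have eq: "\<forall>\<^sub>F t in at_right 0. (LINT \<omega>|M. min 2 (1 / real K * \<bar>X t \<omega> / a t\<bar>)) < \<rho>"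
  proof (rule order_tendstoD(2)[OF fdd_converges_one[OF fd, where B = 2]])
    show "continuous_on UNIV (\<lambda>x::real. min 2 (1 / real K * \<bar>x\<bar>))" by (intro continuous_intros)
    show "\<bar>min 2 (1 / real K * \<bar>x\<bar>)\<bar> \<le> 2" for x :: real by auto
  qed (use n in \<open>simp add: K_def\<close>)
  have grid: "\<forall>\<^sub>F t in at_right 0. \<forall>j\<in>{..K}. cmod (?\<phi> t (real j / real K) - ?\<psi> (real j / real K)) < \<rho>"
  proof (subst eventually_ball_finite_distrib)
    show "\<forall>j\<in>{..K}. \<forall>\<^sub>F t in at_right 0. cmod (?\<phi> t (real j / real K) - ?\<psi> (real j / real K)) < \<rho>"
      using tendstoD[OF pw \<rho>] unfolding dist_norm by blast
  qed simp
  show ?thesis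
    using eq grid eventually_at_right_less[of 0]
  proof (eventually_elim, intro ballI)
    case (elim t)
    fix u :: real assume u: "u \<in> {0..1}"
    have close: "cmod (?\<phi> t u - ?\<psi> u) \<le> \<eta> * c" if u: "u \<in> {0..1}" for u
    proof -
      define j where "j = nat \<lfloor>u * K\<rfloor>"
      define v where "v = real j / real K"
      have K0: "0 < real K" by (simp add: K_def)
      have j: "real j \<le> u * K" "u * K < real j + 1" using u K0 unfolding j_def by (auto simp: zero_le_mult_iff)
      have "u - v = (u * K - real j) / real K" using K0 by (simp add: v_def field_simps)
      moreover have "\<bar>u * K - real j\<bar> \<le> 1" using j by linarith
      ultimately have uv: "\<bar>u - v\<bar> \<le> 1 / real K" using K0 by (simp add: divide_right_mono)
      have "u * real K \<le> 1 * real K" using u K0 by (intro mult_right_mono) auto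
      then have "j \<le> K" using j(1) by linarith
      then have 1: "cmod (?\<phi> t v - ?\<psi> v) \<le> \<rho>" using elim(2) by (auto simp: v_def intro: less_imp_le)
      have 2: "cmod (?\<phi> t u - ?\<phi> t v) \<le> \<rho>"
        using X.char_increment_le[OF Xt[OF elim(3)] uv] elim(1)
        unfolding ch[OF elim(3)] by simp
      have 3: "cmod (?\<psi> v - ?\<psi> u) \<le> \<rho>"
        using Z.char_increment_le[OF Z1 uv] n unfolding chh K_def by (simp add: norm_minus_commute)
      have tri: "cmod (x + y + z) \<le> cmod x + cmod y + cmod z" for x y z
        using norm_triangle_ineq[of "x + y" z] norm_triangle_ineq[of x y] by linarith
      have "cmod (?\<phi> t u - ?\<psi> u) \<le> cmod (?\<phi> t u - ?\<phi> t v) + cmod (?\<phi> t v - ?\<psi> v) + cmod (?\<psi> v - ?\<psi> u)"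
        using tri[of "?\<phi> t u - ?\<phi> t v" "?\<phi> t v - ?\<psi> v" "?\<psi> v - ?\<psi> u"] by simp
      then show ?thesis using 1 2 3 by (simp add: \<rho>_def)
    qed
    let ?d = "\<lambda>u. complex_of_real t * levy_exponent \<gamma> \<sigma> \<nu> (u / a t) - levy_exponent \<gamma>h \<sigma>h \<nu>h u"
    have "cmod (?d u) \<le> 2 * \<eta>"
    proof (rule log_lift_small[OF _ _ \<eta>(2) _ u])
      show "continuous_on {0..1} ?d"
        using a[OF elim(3)] by (intro continuous_intros levy_exponent_continuous_comp[OF lm] levy_exponent_continuous_comp[OF lmh]) auto
      show "?d 0 = 0" by (simp add: levy_exponent_0[OF lm] levy_exponent_0[OF lmh])
      fix u :: real assume u: "u \<in> {0..1}"
      have "exp (?d u) - 1 = (?\<phi> t u - ?\<psi> u) / ?\<psi> u" by (simp add: exp_diff diff_divide_distrib)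
      then have "cmod (exp (?d u) - 1) = cmod (?\<phi> t u - ?\<psi> u) / cmod (?\<psi> u)" by (simp add: norm_divide)
      also have "\<dots> \<le> (\<eta> * c) / c"
        using close[OF u] w(2)[OF u] c \<eta> by (intro frac_le) (auto simp: c_def)
      finally show "cmod (exp (?d u) - 1) \<le> \<eta>" using c by simp
    qed
    then show "cmod (?d u) \<le> \<epsilon>" using \<eta>(3) by linarith
  qed
qed

section \<open>Regular variation of the scaling function\<close>

text \<open>Put \<open>g_t(u) = t P(u/a(t))\<close>, which is close to \<open>H(u)\<close>, and \<open>r = a(st)/a(t)\<close>. Then \<open>s g_t(u) = g_(st)(ru)\<close>, so
that \<open>s |H(u)|\<close> is close to \<open>|H(ru)| = r^\<alpha> |H(u)|\<close>. Convergence is known on the unit interval only; hence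
the comparison is made at \<open>u = 1\<close> if \<open>r \<le> 1\<close> and at \<open>u = 1/r\<close> otherwise. In the second case \<open>r\<close> has to be
bounded first (by \<open>r^\<alpha> \<le> 2s\<close>), which is why \<open>\<epsilon>\<close> is also required to be at most \<open>K/4\<close>.\<close>

lemma scaling_ratio_self_similar:
  fixes a :: "real \<Rightarrow> real" and P H :: "real \<Rightarrow> real"
  assumes a: "\<And>t. 0 < t \<Longrightarrow> 0 < a t" and K: "0 < K" and al: "0 < \<alpha>"
    and H: "\<And>u. 0 < u \<Longrightarrow> u \<le> 1 \<Longrightarrow> \<bar>H u\<bar> = K * u powr \<alpha>"
    and conv: "\<And>\<epsilon>. 0 < \<epsilon> \<Longrightarrow> \<forall>\<^sub>F t in at_right 0. \<forall>u\<in>{0..1}. \<bar>t * P (u / a t) - H u\<bar> \<le> \<epsilon>"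
    and \<eta>: "0 < \<eta>"
  shows "\<exists>t0>0. \<forall>t s. 0 < t \<and> t \<le> t0 \<and> 1/2 \<le> s \<and> s \<le> 1 \<longrightarrow> \<bar>(a (s * t) / a t) powr \<alpha> - s\<bar> \<le> \<eta>"
proof -
  define \<epsilon> where "\<epsilon> = min (K * \<eta> / 4) (K / 4)"
  have \<epsilon>: "0 < \<epsilon>" "\<epsilon> \<le> K * \<eta> / 4" "\<epsilon> \<le> K / 4" using K \<eta> by (auto simp: \<epsilon>_def)
  obtain b where b: "0 < b" "\<And>t. 0 < t \<Longrightarrow> t < b \<Longrightarrow> \<forall>u\<in>{0..1}. \<bar>t * P (u / a t) - H u\<bar> \<le> \<epsilon>"
    using conv[OF \<epsilon>(1)] unfolding eventually_at_right_field by auto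
  show ?thesis
  proof (intro exI[of _ "b/2"] conjI allI impI)
    show "0 < b / 2" using b by simp
    fix t s :: real assume ts: "0 < t \<and> t \<le> b / 2 \<and> 1/2 \<le> s \<and> s \<le> 1"
    define r where "r = a (s * t) / a t"
    have st: "0 < s * t" "s * t \<le> t" using ts by (auto intro: mult_left_le_one_le)
    have r: "0 < r" using a[of t] a[OF st(1)] ts by (simp add: r_def)
    have g: "\<bar>t * P (u / a t) - H u\<bar> \<le> \<epsilon>" if "u \<in> {0..1}" for u using b(2)[of t] ts b(1) that by auto
    have gs: "\<bar>s * t * P (u / a (s * t)) - H u\<bar> \<le> \<epsilon>" if "u \<in> {0..1}" for u
      using b(2)[OF st(1)] st ts b(1) that by auto
    show "\<bar>r powr \<alpha> - s\<bar> \<le> \<eta>"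
    proof (cases "r \<le> 1")
      case True
      have e: "r / a (s * t) = 1 / a t" using a[OF st(1)] a[of t] ts by (simp add: r_def)
      have 1: "\<bar>s * t * P (1 / a t) - H r\<bar> \<le> \<epsilon>" using gs[of r] True r e by simp
      have "\<bar>s * (t * P (1 / a t) - H 1)\<bar> \<le> 1 * \<epsilon>"
        unfolding abs_mult using g[of 1] ts by (intro mult_mono) auto
      then have 2: "\<bar>s * t * P (1 / a t) - s * H 1\<bar> \<le> \<epsilon>" by (simp add: algebra_simps)
      have "\<bar>\<bar>H r\<bar> - \<bar>s * H 1\<bar>\<bar> \<le> 2 * \<epsilon>" using 1 2 by linarith
      moreover have "\<bar>H r\<bar> = K * r powr \<alpha>" "\<bar>s * H 1\<bar> = K * s"
        using H[of r] H[of 1] r True ts by (auto simp: abs_mult)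
      ultimately have "\<bar>K * (r powr \<alpha> - s)\<bar> \<le> 2 * \<epsilon>" by (simp add: algebra_simps)
      then have "K * \<bar>r powr \<alpha> - s\<bar> \<le> 2 * \<epsilon>" using K by (simp add: abs_mult)
      also have "\<dots> \<le> K * (\<eta> / 2)" using \<epsilon>(2) by simp
      finally have "K * \<bar>r powr \<alpha> - s\<bar> \<le> K * (\<eta> / 2)" .
      then have "\<bar>r powr \<alpha> - s\<bar> \<le> \<eta> / 2" using K by (simp only: mult_le_cancel_left_pos)
      then show ?thesis using \<eta> by linarith
    next
      case False
      then have ra: "1 < r powr \<alpha>" using al by (simp add: gr_one_powr)
      define w where "w = 1 / r"
      have w: "0 < w" "w \<le> 1" using False r by (auto simp: w_def)
      have e: "w / a t = 1 / a (s * t)" using a[OF st(1)] a[of t] ts by (simp add: w_def r_def)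
      have 1: "\<bar>s * t * P (w / a t) - H 1\<bar> \<le> \<epsilon>" using gs[of 1] e by simp
      have "\<bar>s * (t * P (w / a t) - H w)\<bar> \<le> 1 * \<epsilon>"
        unfolding abs_mult using g[of w] w ts by (intro mult_mono) auto
      then have 2: "\<bar>s * t * P (w / a t) - s * H w\<bar> \<le> \<epsilon>" by (simp add: algebra_simps)
      have "\<bar>\<bar>H 1\<bar> - \<bar>s * H w\<bar>\<bar> \<le> 2 * \<epsilon>" using 1 2 by linarith
      moreover have "\<bar>H 1\<bar> = K" "\<bar>s * H w\<bar> = K * (s * w powr \<alpha>)"
        using H[of w] H[of 1] w ts by (auto simp: abs_mult)
      ultimately have 3: "K - K * (s * w powr \<alpha>) \<le> 2 * \<epsilon>" by linarith
      have wr: "w powr \<alpha> = 1 / r powr \<alpha>" using r by (simp add: w_def powr_divide)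
      have "K * (r powr \<alpha>) - K * s = (K - K * (s * w powr \<alpha>)) * r powr \<alpha>"
      proof -
        have "w powr \<alpha> * r powr \<alpha> = 1" using ra r by (simp add: wr)
        then show ?thesis by (simp add: left_diff_distrib mult.assoc)
      qed
      also have "\<dots> \<le> 2 * \<epsilon> * r powr \<alpha>" using 3 ra by (intro mult_right_mono) auto
      finally have 4: "K * (r powr \<alpha>) - K * s \<le> 2 * \<epsilon> * r powr \<alpha>" .
      have "2 * \<epsilon> * r powr \<alpha> \<le> K / 2 * r powr \<alpha>" using \<epsilon>(3) ra by (intro mult_right_mono) auto
      then have "K * (r powr \<alpha>) \<le> K * (2 * s)" using 4 by linarith
      then have "r powr \<alpha> \<le> 2 * s" using K by (simp only: mult_le_cancel_left_pos)
      then have "2 * \<epsilon> * r powr \<alpha> \<le> 2 * (K * \<eta> / 4) * 2" using \<epsilon> ts by (intro mult_mono) auto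
      then have "K * (r powr \<alpha>) \<le> K * (s + \<eta>)" using 4 by (simp add: algebra_simps)
      then have "r powr \<alpha> \<le> s + \<eta>" using K by (simp only: mult_le_cancel_left_pos)
      then show ?thesis using ra ts by linarith
    qed
  qed
qed

lemma halving_exists:
  fixes t t0 :: real assumes "0 < t" "0 < t0"
  obtains n :: nat where "t0 / 2 ^ n \<le> t"
proof -
  obtain n where "t0 / t < 2 ^ n" using real_arch_pow[of 2 "t0 / t"] by auto
  then show thesis using that[of n] assms by (simp add: field_simps)
qed

text \<open>The hypothesis on halving propagates the bound from \<open>t\<close> to \<open>t/2\<close>; the other one starts it on the whole
interval from \<open>t0/2\<close> to \<open>t0\<close>, so that times that are not dyadic fractions of \<open>t0\<close> are covered.\<close>
lemma dyadic_lower_power_bound: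
  fixes A :: "real \<Rightarrow> real"
  assumes t0: "0 < t0" and A: "\<And>t. 0 < t \<Longrightarrow> 0 < A t" and w: "0 \<le> w"
    and half: "\<And>t. 0 < t \<Longrightarrow> t \<le> t0 \<Longrightarrow> (1/2) powr w * A t \<le> A (t / 2)"
    and base: "\<And>s. 1/2 \<le> s \<Longrightarrow> s \<le> 1 \<Longrightarrow> A t0 / 4 \<le> A (s * t0)"
  shows "\<exists>c>0. \<forall>t. 0 < t \<and> t \<le> t0 \<longrightarrow> c * t powr w \<le> A t"
proof -
  define c where "c = A t0 / 4 / t0 powr w"
  have c: "0 < c" using A t0 by (simp add: c_def)
  have "c * t powr w \<le> A t" if "t0 / 2 ^ n \<le> t" "0 < t" "t \<le> t0" for n t
    using that
  proof (induction n arbitrary: t)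
    case 0
    then have "t = t0" by simp
    then show ?case using base[of 1] t0 by (simp add: c_def)
  next
    case (Suc n)
    show ?case
    proof (cases "t0 / 2 \<le> t")
      case True
      have "c * t powr w \<le> c * t0 powr w" using Suc c w by (intro mult_left_mono powr_mono2) auto
      also have "\<dots> \<le> A (t / t0 * t0)"
        using base[of "t / t0"] True Suc t0 by (simp add: c_def field_simps)
      finally show ?thesis using t0 by simp
    next
      case False
      have "c * (2 * t) powr w \<le> A (2 * t)" using Suc.prems False by (intro Suc.IH) (auto simp: field_simps)
      then have "(1/2) powr w * (c * (2 * t) powr w) \<le> (1/2) powr w * A (2 * t)" by (intro mult_left_mono) auto
      also have "\<dots> \<le> A (2 * t / 2)" using False Suc by (intro half) auto
      finally show ?thesis using Suc.prems by (simp add: powr_mult powr_divide)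
    qed
  qed
  then show ?thesis using c halving_exists[OF _ t0] by (intro exI[of _ c]) metis
qed

lemma dyadic_upper_power_bound:
  fixes A :: "real \<Rightarrow> real"
  assumes t0: "0 < t0" and A: "\<And>t. 0 < t \<Longrightarrow> 0 < A t" and w: "0 \<le> w"
    and half: "\<And>t. 0 < t \<Longrightarrow> t \<le> t0 \<Longrightarrow> A (t / 2) \<le> (1/2) powr w * A t"
    and base: "\<And>s. 1/2 \<le> s \<Longrightarrow> s \<le> 1 \<Longrightarrow> A (s * t0) \<le> 2 * A t0"
  shows "\<exists>C>0. \<forall>t. 0 < t \<and> t \<le> t0 \<longrightarrow> A t \<le> C * t powr w"
proof -
  define c where "c = 2 * A t0 / (t0 / 2) powr w"
  have c: "0 < c" using A t0 by (simp add: c_def)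
  have c1: "2 * A t0 = c * (t0 / 2) powr w" using t0 by (simp add: c_def)
  have "A t \<le> c * t powr w" if "t0 / 2 ^ n \<le> t" "0 < t" "t \<le> t0" for n t
    using that
  proof (induction n arbitrary: t)
    case 0
    then have t: "t = t0" by simp
    have "A t0 \<le> c * (t0 / 2) powr w" using base[of 1] c1 by simp
    also have "\<dots> \<le> c * t0 powr w" using t0 c w by (intro mult_left_mono powr_mono2) auto
    finally show ?case using t by simp
  next
    case (Suc n)
    show ?case
    proof (cases "t0 / 2 \<le> t")
      case True
      have "A (t / t0 * t0) \<le> c * (t0 / 2) powr w"
        unfolding c1[symmetric] using True Suc t0 by (intro base) (auto simp: field_simps)
      also have "\<dots> \<le> c * t powr w" using True t0 c w by (intro mult_left_mono powr_mono2) auto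
      finally show ?thesis using t0 by simp
    next
      case False
      have "A (2 * t / 2) \<le> (1/2) powr w * A (2 * t)" using False Suc by (intro half) auto
      also have "A (2 * t) \<le> c * (2 * t) powr w" using Suc.prems False by (intro Suc.IH) (auto simp: field_simps)
      then have "(1/2) powr w * A (2 * t) \<le> (1/2) powr w * (c * (2 * t) powr w)" by (intro mult_left_mono) auto
      finally show ?thesis using Suc.prems by (simp add: powr_mult powr_divide)
    qed
  qed
  then show ?thesis using c halving_exists[OF _ t0] by (intro exI[of _ c]) metis
qed

text \<open>The preceding lemmas are applied to \<open>a(t)^\<alpha>\<close>, which halves approximately when \<open>t\<close> halves.\<close>
lemma scaling_function_power_bounds:
  fixes a :: "real \<Rightarrow> real" and P H :: "real \<Rightarrow> real"
  assumes a: "\<And>t. 0 < t \<Longrightarrow> 0 < a t" and K: "0 < K" and al: "0 < \<alpha>"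
    and H: "\<And>u. 0 < u \<Longrightarrow> u \<le> 1 \<Longrightarrow> \<bar>H u\<bar> = K * u powr \<alpha>"
    and conv: "\<And>\<epsilon>. 0 < \<epsilon> \<Longrightarrow> \<forall>\<^sub>F t in at_right 0. \<forall>u\<in>{0..1}. \<bar>t * P (u / a t) - H u\<bar> \<le> \<epsilon>"
    and w: "1 / \<alpha> < w" and v: "0 < v" "v < 1 / \<alpha>"
  obtains c C t0 where "0 < c" "0 < C" "0 < t0"
    "\<And>t. 0 < t \<Longrightarrow> t \<le> t0 \<Longrightarrow> c * t powr w \<le> a t"
    "\<And>t. 0 < t \<Longrightarrow> t \<le> t0 \<Longrightarrow> a t \<le> C * t powr v"
proof -
  have wa: "1 < w * \<alpha>" and va: "v * \<alpha> < 1" "0 \<le> v * \<alpha>" using w v al by (auto simp: field_simps)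
  have lw: "(1/2) powr (w * \<alpha>) < (1/2::real)" using wa powr_less_mono'[of "1/2" 1 "w * \<alpha>"] by simp
  have lv: "1/2 < (1/2::real) powr (v * \<alpha>)" using va powr_less_mono'[of "1/2" "v * \<alpha>" 1] by simp
  define \<eta> where "\<eta> = min (1/4) (min (1/2 - (1/2) powr (w * \<alpha>)) ((1/2) powr (v * \<alpha>) - 1/2))"
  have "0 < \<eta>" using lw lv by (simp add: \<eta>_def)
  moreover have "\<eta> \<le> 1/4" unfolding \<eta>_def by (rule min.cobounded1)
  moreover have "\<eta> \<le> 1/2 - (1/2) powr (w * \<alpha>)"
    unfolding \<eta>_def by (rule order_trans[OF min.cobounded2 min.cobounded1])
  moreover have "\<eta> \<le> (1/2) powr (v * \<alpha>) - 1/2"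
    unfolding \<eta>_def by (rule order_trans[OF min.cobounded2 min.cobounded2])
  ultimately have \<eta>: "0 < \<eta>" "\<eta> \<le> 1/4" "\<eta> \<le> 1/2 - (1/2) powr (w * \<alpha>)" "\<eta> \<le> (1/2) powr (v * \<alpha>) - 1/2"
    by blast+
  obtain t0 where t0: "0 < t0" "\<And>t s. 0 < t \<Longrightarrow> t \<le> t0 \<Longrightarrow> 1/2 \<le> s \<Longrightarrow> s \<le> 1 \<Longrightarrow> \<bar>(a (s * t) / a t) powr \<alpha> - s\<bar> \<le> \<eta>"
    using scaling_ratio_self_similar[OF a K al H conv \<eta>(1)] by blast
  define A where "A t = a t powr \<alpha>" for t
  have A: "0 < A t" if "0 < t" for t using a[OF that] by (simp add: A_def)
  have ratio: "(s - \<eta>) * A t \<le> A (s * t)" "A (s * t) \<le> (s + \<eta>) * A t"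
    if "0 < t" "t \<le> t0" "1/2 \<le> s" "s \<le> 1" for t s
  proof -
    have "0 < s * t" using that by simp
    then have "(a (s * t) / a t) powr \<alpha> = A (s * t) / A t"
      using a[of t] a[of "s * t"] that by (simp add: A_def powr_divide)
    then have "\<bar>A (s * t) / A t - s\<bar> \<le> \<eta>" using t0(2)[OF that] by simp
    then have "s - \<eta> \<le> A (s * t) / A t" "A (s * t) / A t \<le> s + \<eta>" by linarith+
    then show "(s - \<eta>) * A t \<le> A (s * t)" "A (s * t) \<le> (s + \<eta>) * A t"
      using A[OF that(1)] by (auto simp: field_simps)
  qed
  have "\<exists>c>0. \<forall>t. 0 < t \<and> t \<le> t0 \<longrightarrow> c * t powr (w * \<alpha>) \<le> A t"
  proof (rule dyadic_lower_power_bound[OF t0(1) A])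
    fix t assume t: "0 < t" "t \<le> t0"
    have "(1/2) powr (w * \<alpha>) * A t \<le> (1/2 - \<eta>) * A t" using \<eta> A[OF t(1)] by (intro mult_right_mono) auto
    then show "(1/2) powr (w * \<alpha>) * A t \<le> A (t / 2)" using ratio(1)[of t "1/2"] t by simp
  next
    fix s :: real assume s: "1/2 \<le> s" "s \<le> 1"
    have "1/4 * A t0 \<le> (s - \<eta>) * A t0" using s \<eta> A[OF t0(1)] by (intro mult_right_mono) auto
    then show "A t0 / 4 \<le> A (s * t0)" using ratio(1)[of t0 s] s t0 by simp
  qed (use wa in auto)
  then obtain c where c: "0 < c" "\<And>t. 0 < t \<Longrightarrow> t \<le> t0 \<Longrightarrow> c * t powr (w * \<alpha>) \<le> A t" by blast
  have "\<exists>C>0. \<forall>t. 0 < t \<and> t \<le> t0 \<longrightarrow> A t \<le> C * t powr (v * \<alpha>)"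
  proof (rule dyadic_upper_power_bound[OF t0(1) A _ _ _])
    fix t assume t: "0 < t" "t \<le> t0"
    have "(1/2 + \<eta>) * A t \<le> (1/2) powr (v * \<alpha>) * A t" using \<eta> A[OF t(1)] by (intro mult_right_mono) auto
    then show "A (t / 2) \<le> (1/2) powr (v * \<alpha>) * A t" using ratio(2)[of t "1/2"] t by simp
  next
    fix s :: real assume s: "1/2 \<le> s" "s \<le> 1"
    have "(s + \<eta>) * A t0 \<le> 2 * A t0" using s \<eta> A[OF t0(1)] by (intro mult_right_mono) auto
    then show "A (s * t0) \<le> 2 * A t0" using ratio(2)[of t0 s] s t0 by simp
  qed (use va in auto)
  then obtain C where C: "0 < C" "\<And>t. 0 < t \<Longrightarrow> t \<le> t0 \<Longrightarrow> A t \<le> C * t powr (v * \<alpha>)" by blast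
  have root: "(d * t powr (z * \<alpha>)) powr (1 / \<alpha>) = d powr (1 / \<alpha>) * t powr z" if "0 < d" for d t z
    using that al by (simp add: powr_mult powr_powr)
  have Ar: "A t powr (1 / \<alpha>) = a t" if "0 < t" for t
    using a[OF that] al by (simp add: A_def powr_powr)
  show thesis
  proof (rule that[of "c powr (1 / \<alpha>)" "C powr (1 / \<alpha>)" t0])
    show "0 < c powr (1 / \<alpha>)" "0 < C powr (1 / \<alpha>)" "0 < t0" using c C t0 by auto
    fix t assume t: "0 < t" "t \<le> t0"
    have "(c * t powr (w * \<alpha>)) powr (1 / \<alpha>) \<le> A t powr (1 / \<alpha>)"
      using c(2)[OF t] c(1) al by (intro powr_mono2) auto
    then show "c powr (1 / \<alpha>) * t powr w \<le> a t" unfolding root[OF c(1)] Ar[OF t(1)] .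
    have "A t powr (1 / \<alpha>) \<le> (C * t powr (v * \<alpha>)) powr (1 / \<alpha>)"
      using C(2)[OF t] A[OF t(1)] al by (intro powr_mono2) auto
    then show "a t \<le> C powr (1 / \<alpha>) * t powr v" unfolding root[OF C(1)] Ar[OF t(1)] .
  qed
qed

text \<open>For a large frequency \<open>v\<close> take the first dyadic time \<open>t\<close> with \<open>v a(t) \<le> 1\<close>. Boundedness of \<open>t \<Psi>(u/a(t))\<close> on the
unit interval gives \<open>|\<Psi>(v)| \<le> D/t\<close>, and \<open>1 < v a(2t)\<close> bounds \<open>1/t\<close> by a multiple of \<open>v^\<theta>\<close>.\<close>
lemma growth_from_scaling:
  fixes \<Psi> :: "real \<Rightarrow> complex"
  assumes a: "\<And>t. 0 < t \<Longrightarrow> 0 < a t" and a0: "(a \<longlongrightarrow> 0) (at_right 0)"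
    and t0: "0 < t0" and C: "0 < C" and th: "0 < \<theta>"
    and up: "\<And>t. 0 < t \<Longrightarrow> t \<le> t0 \<Longrightarrow> a t \<le> C * t powr (1 / \<theta>)"
    and bd: "\<And>t u. 0 < t \<Longrightarrow> t \<le> t0 \<Longrightarrow> u \<in> {0..1} \<Longrightarrow> cmod (complex_of_real t * \<Psi> (u / a t)) \<le> D"
  obtains B where "\<And>v. 1 \<le> v \<Longrightarrow> cmod (\<Psi> v) \<le> B * v powr \<theta>"
proof (rule that)
  fix v :: real assume v: "1 \<le> v"
  let ?B = "D / t0 + 2 * D * C powr \<theta>"
  have D: "0 \<le> D" using order_trans[OF norm_ge_zero bd[of t0 0]] t0 by simp
  have psi: "cmod (\<Psi> v) \<le> D / t" if t: "0 < t" "t \<le> t0" "v * a t \<le> 1" for t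
  proof -
    have "cmod (complex_of_real t * \<Psi> (v * a t / a t)) \<le> D"
      using v a[OF t(1)] t by (intro bd) auto
    then have "t * cmod (\<Psi> v) \<le> D" using a[OF t(1)] t by (simp add: norm_mult)
    then show ?thesis using t by (simp add: field_simps)
  qed
  have v1: "1 \<le> v powr \<theta>" using v th by (simp add: ge_one_powr_ge_zero)
  define \<tau> where "\<tau> n = t0 / 2 ^ n" for n :: nat
  have \<tau>: "0 < \<tau> n" "\<tau> n \<le> t0" for n using t0 by (auto simp: \<tau>_def divide_le_eq)
  have "\<tau> \<longlonglongrightarrow> 0"
    unfolding \<tau>_def divide_inverse power_inverse[symmetric]
    by (rule tendsto_mult_right_zero) (simp add: LIMSEQ_power_zero)
  then have "filterlim \<tau> (at_right 0) sequentially"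
    unfolding filterlim_at using less_imp_neq[OF \<tau>(1), symmetric] by (simp add: \<tau>(1))
  then have "(\<lambda>n. a (\<tau> n)) \<longlonglongrightarrow> 0" by (rule filterlim_compose[OF a0])
  then have "\<forall>\<^sub>F n in sequentially. a (\<tau> n) < 1 / v" using v by (intro order_tendstoD) auto
  then obtain m where "a (\<tau> m) < 1 / v" by (auto dest!: eventually_happens)
  then have m: "v * a (\<tau> m) \<le> 1" using v by (simp add: field_simps)
  define n where "n = (LEAST n. v * a (\<tau> n) \<le> 1)"
  have n: "v * a (\<tau> n) \<le> 1" unfolding n_def by (rule LeastI[of _ m]) (rule m)
  show "cmod (\<Psi> v) \<le> ?B * v powr \<theta>"
  proof (cases n)
    case 0
    have "cmod (\<Psi> v) \<le> D / t0" using psi[OF \<tau> n] 0 by (simp add: \<tau>_def)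
    also have "\<dots> \<le> ?B" using D C by simp
    also have "\<dots> \<le> ?B * v powr \<theta>" using v1 D C t0 mult_left_mono[OF v1, of ?B] by simp
    finally show ?thesis .
  next
    case (Suc k)
    have "\<not> v * a (\<tau> k) \<le> 1" using not_less_Least[of k "\<lambda>n. v * a (\<tau> n) \<le> 1"] Suc by (simp add: n_def)
    then have "1 \<le> v * a (\<tau> k)" by simp
    also have "\<dots> \<le> v * (C * \<tau> k powr (1 / \<theta>))" using v up[OF \<tau>] by (intro mult_left_mono) auto
    finally have "1 \<le> (v * (C * \<tau> k powr (1 / \<theta>))) powr \<theta>" using th by (simp add: ge_one_powr_ge_zero)
    also have "\<dots> = v powr \<theta> * C powr \<theta> * \<tau> k" using v C \<tau>(1)[of k] th by (simp add: powr_mult powr_powr)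
    finally have "1 / \<tau> k \<le> v powr \<theta> * C powr \<theta>" using \<tau>(1)[of k] by (simp add: field_simps)
    then have "2 * D * (1 / \<tau> k) \<le> 2 * D * (v powr \<theta> * C powr \<theta>)" using D by (intro mult_left_mono) auto
    moreover have "cmod (\<Psi> v) \<le> 2 * D * (1 / \<tau> k)" using psi[OF \<tau> n] Suc by (simp add: \<tau>_def mult_ac)
    moreover have "0 \<le> D / t0 * v powr \<theta>" using D t0 by simp
    ultimately show ?thesis by (simp add: algebra_simps)
  qed
qed

section \<open>Moments under a small-time limit\<close>

text \<open>Power bounds with exponents arbitrarily close to \<open>w\<close> suffice for a limit on the logarithmic scale. The lower
bound may presuppose integrability, which the upper bound supplies.\<close>

lemma has_tau_zero_minusI:
  assumes w: "0 < w"
    and up: "\<And>\<kappa>. 0 < \<kappa> \<Longrightarrow> \<kappa> < w \<Longrightarrow> \<exists>C. \<forall>\<^sub>F t in at_right 0.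
        has_abs_moment M (X t) q \<and> abs_moment M (X t) q \<le> C * t powr \<kappa>"
    and low: "\<And>\<kappa>. w < \<kappa> \<Longrightarrow> \<exists>c>0. \<forall>\<^sub>F t in at_right 0.
        has_abs_moment M (X t) q \<longrightarrow> c * t powr \<kappa> \<le> abs_moment M (X t) q"
  shows "has_tau_zero M X q (- w)"
  unfolding has_tau_zero_def
proof
  let ?E = "\<lambda>t. LINT \<omega>|M. \<bar>X t \<omega>\<bar> powr q"
  obtain C0 where C0: "\<forall>\<^sub>F t in at_right 0. has_abs_moment M (X t) q \<and> ?E t \<le> C0 * t powr (w / 2)"
    using up[of "w / 2"] w by auto
  then have int: "\<forall>\<^sub>F t in at_right 0. has_abs_moment M (X t) q" by eventually_elim simp
  obtain c0 where c0: "0 < c0" "\<forall>\<^sub>F t in at_right 0. has_abs_moment M (X t) q \<longrightarrow> c0 * t powr (w + 1) \<le> ?E t"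
    using low[of "w + 1"] by auto
  show pos: "\<forall>\<^sub>F t in at_right 0. has_abs_moment M (X t) q \<and> 0 < ?E t"
    using int c0(2) eventually_at_right_less[of 0]
  proof eventually_elim
    case (elim t)
    have "0 < c0 * t powr (w + 1)" using elim c0(1) by simp
    then show ?case using elim by auto
  qed
  have small: "\<forall>\<^sub>F t in at_right 0. \<bar>ln C / ln (1 / t)\<bar> < e" if "0 < e" for C e :: real
  proof -
    have "((\<lambda>t. - (ln C / ln t)) \<longlongrightarrow> - 0) (at_right 0)"
      by (intro tendsto_minus tendsto_divide_0[OF tendsto_const] filterlim_at_bot_imp_at_infinity ln_at_0)
    from tendstoD[OF this that] show ?thesis
      using eventually_at_right_less[of 0] by eventually_elim (auto simp: dist_real_def ln_div)
  qed
  have lt1: "\<forall>\<^sub>F t in at_right (0::real). t < 1"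
    unfolding eventually_at_right_field by (intro exI[of _ 1]) auto
  show "((\<lambda>t. ln (?E t) / ln (1 / t)) \<longlongrightarrow> - w) (at_right 0)"
  proof (rule tendstoI)
    fix e :: real assume e: "0 < e"
    define k where "k = max (w - e / 2) (w / 2)"
    have k: "0 < k" "k < w" "w - e / 2 \<le> k" using e w by (auto simp: k_def)
    obtain C where C: "\<forall>\<^sub>F t in at_right 0. has_abs_moment M (X t) q \<and> ?E t \<le> C * t powr k"
      using up[OF k(1,2)] by auto
    obtain c where c: "0 < c" "\<forall>\<^sub>F t in at_right 0. has_abs_moment M (X t) q \<longrightarrow> c * t powr (w + e / 2) \<le> ?E t"
      using low[of "w + e / 2"] e by auto
    have e2: "0 < e / 2" using e by simp
    show "\<forall>\<^sub>F t in at_right 0. dist (ln (?E t) / ln (1 / t)) (- w) < e"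
      using pos C c(2) small[OF e2, of C] small[OF e2, of c] eventually_at_right_less[of 0] lt1
    proof eventually_elim
      case (elim t)
      let ?L = "ln (1 / t)"
      have L: "0 < ?L" using elim by (simp add: ln_div)
      have E: "0 < ?E t" "?E t \<le> C * t powr k" "c * t powr (w + e / 2) \<le> ?E t" using elim by auto
      have tk: "ln (t powr z) = - z * ?L" for z using elim by (simp add: ln_powr ln_div)
      have tp: "0 < t powr z" for z using elim by simp
      have C0: "0 < C" using less_le_trans[OF E(1,2)] tp[of k] by (simp add: zero_less_mult_iff)
      have "ln (?E t) \<le> ln (C * t powr k)" using E by simp
      also have "\<dots> = ln C - k * ?L" using C0 tp tk by (simp add: ln_mult)
      finally have "ln (?E t) / ?L \<le> (ln C - k * ?L) / ?L" using L by (intro divide_right_mono) auto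
      also have "\<dots> = ln C / ?L - k" using L by (simp add: diff_divide_distrib)
      finally have 1: "ln (?E t) / ?L \<le> ln C / ?L - k" .
      have "ln (c * t powr (w + e / 2)) \<le> ln (?E t)" using E c tp by simp
      moreover have "ln (c * t powr (w + e / 2)) = ln c - (w + e / 2) * ?L" using c tp tk by (simp add: ln_mult)
      ultimately have "(ln c - (w + e / 2) * ?L) / ?L \<le> ln (?E t) / ?L" using L by (intro divide_right_mono) auto
      moreover have "(ln c - (w + e / 2) * ?L) / ?L = ln c / ?L - (w + e / 2)" using L by (simp add: diff_divide_distrib)
      ultimately have 2: "ln c / ?L - (w + e / 2) \<le> ln (?E t) / ?L" by simp
      show ?case using 1 2 elim(4,5) k(3) unfolding dist_real_def by linarith
    qed
  qed
qed

text \<open>The common setting of the three kinds of limit. They differ in which part of the limit exponent is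
homogeneous: the real part for a Brownian or stable limit, the imaginary part for a drift, whose real
part is 0. Using the real part in the stable case avoids the drift term altogether.\<close>
locale small_time_scaling_limit =
  X: levy_process M X + Z: levy_process N Xhat
  for M :: "'a measure" and X :: "real \<Rightarrow> 'a \<Rightarrow> real" and N :: "'b measure" and Xhat :: "real \<Rightarrow> 'b \<Rightarrow> real" +
  fixes a :: "real \<Rightarrow> real" and \<gamma> \<sigma> :: real and \<nu> :: "real measure"
    and \<gamma>h \<sigma>h :: real and \<nu>h :: "real measure" and \<alpha> K :: real and part :: "complex \<Rightarrow> real"
  assumes a_pos: "\<And>t. 0 < t \<Longrightarrow> 0 < a t"
    and a_tendsto: "(a \<longlongrightarrow> 0) (at_right 0)"
    and fdd: "fdd_converges M (\<lambda>t s \<omega>. X (t * s) \<omega> / a t) (at_right 0) N Xhat"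
    and triplet: "has_triplet M X \<gamma> \<sigma> \<nu>"
    and limit_triplet: "has_triplet N Xhat \<gamma>h \<sigma>h \<nu>h"
    and part: "part = Re \<or> part = Im"
    and homogeneous: "\<And>u. 0 < u \<Longrightarrow> u \<le> 1 \<Longrightarrow> \<bar>part (levy_exponent \<gamma>h \<sigma>h \<nu>h u)\<bar> = K * u powr \<alpha>"
    and K_pos: "0 < K" and alpha_pos: "0 < \<alpha>" and alpha_le: "\<alpha> \<le> 2"
    and limit_nonzero: "\<exists>u. exp (levy_exponent \<gamma>h \<sigma>h \<nu>h u) \<noteq> 1"
begin

abbreviation "\<Psi> \<equiv> levy_exponent \<gamma> \<sigma> \<nu>"
abbreviation "\<Psi>h \<equiv> levy_exponent \<gamma>h \<sigma>h \<nu>h"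

lemmas levy = has_triplet_levy_measure[OF triplet]
lemmas limit_levy = has_triplet_levy_measure[OF limit_triplet]

lemma exponents_converge:
  "0 < \<epsilon> \<Longrightarrow> \<forall>\<^sub>F t in at_right 0. \<forall>u\<in>{0..1}. cmod (complex_of_real t * \<Psi> (u / a t) - \<Psi>h u) \<le> \<epsilon>"
  by (rule exponents_converge_uniformly[OF X.levy_process_axioms Z.levy_process_axioms a_pos fdd triplet limit_triplet])

lemma part_exponents_converge:
  assumes "0 < \<epsilon>"
  shows "\<forall>\<^sub>F t in at_right 0. \<forall>u\<in>{0..1}. \<bar>t * part (\<Psi> (u / a t)) - part (\<Psi>h u)\<bar> \<le> \<epsilon>"
  using exponents_converge[OF assms]
proof eventually_elim
  case (elim t)
  have "\<bar>t * part x - part y\<bar> \<le> cmod (complex_of_real t * x - y)" for x y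
    using part abs_Re_le_cmod[of "complex_of_real t * x - y"] abs_Im_le_cmod[of "complex_of_real t * x - y"] by auto
  then show ?case using elim order_trans by blast
qed

lemma scaling_bounds:
  assumes "1 / \<alpha> < w" "0 < v" "v < 1 / \<alpha>"
  shows "\<exists>c C t0. 0 < c \<and> 0 < C \<and> 0 < t0 \<and>
    (\<forall>t. 0 < t \<and> t \<le> t0 \<longrightarrow> c * t powr w \<le> a t \<and> a t \<le> C * t powr v)"
proof (rule scaling_function_power_bounds[where a = a, OF a_pos K_pos alpha_pos homogeneous part_exponents_converge assms])
  fix c C t0 :: real
  assume "0 < c" "0 < C" "0 < t0" "\<And>t. 0 < t \<Longrightarrow> t \<le> t0 \<Longrightarrow> c * t powr w \<le> a t"
    "\<And>t. 0 < t \<Longrightarrow> t \<le> t0 \<Longrightarrow> a t \<le> C * t powr v"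
  then show ?thesis by blast
qed

lemma exponent_growth:
  assumes "\<alpha> < \<theta>"
  shows "\<exists>B. \<forall>v\<ge>1. cmod (\<Psi> v) \<le> B * v powr \<theta>"
proof -
  have th: "0 < \<theta>" "1 / \<theta> < 1 / \<alpha>" "1 / \<alpha> < 2 / \<alpha>" using assms alpha_pos by (auto simp: frac_less2 divide_strict_right_mono)
  obtain c C t0 where C: "0 < C" "0 < t0" "\<And>t. 0 < t \<Longrightarrow> t \<le> t0 \<Longrightarrow> a t \<le> C * t powr (1 / \<theta>)"
    using scaling_bounds[OF th(3) _ th(2)] th(1) by (auto simp: zero_less_divide_1_iff)
  obtain b where b: "0 < b" "\<And>t. 0 < t \<Longrightarrow> t < b \<Longrightarrow> \<forall>u\<in>{0..1}. cmod (complex_of_real t * \<Psi> (u / a t) - \<Psi>h u) \<le> 1"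
    using exponents_converge[of 1] unfolding eventually_at_right_field by auto
  have cont: "continuous_on {0..1} (\<lambda>u. cmod (\<Psi>h u))"
    by (intro continuous_intros levy_exponent_continuous_comp[OF limit_levy])
  have "\<exists>w\<in>{0..1}. \<forall>u\<in>{0..1}. cmod (\<Psi>h u) \<le> cmod (\<Psi>h w)"
    by (rule continuous_attains_sup[OF compact_Icc _ cont]) simp
  then obtain w where w: "\<And>u. u \<in> {0..1} \<Longrightarrow> cmod (\<Psi>h u) \<le> cmod (\<Psi>h w)" by blast
  show ?thesis
  proof (rule growth_from_scaling[where a = a and \<Psi> = \<Psi> and \<theta> = \<theta> and C = C and D = "cmod (\<Psi>h w) + 1" and ?t0.0 = "min t0 (b / 2)",
      OF a_pos a_tendsto _ C(1) th(1)])
    show "0 < min t0 (b / 2)" using C(2) b(1) by simp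
    show "a t \<le> C * t powr (1 / \<theta>)" if "0 < t" "t \<le> min t0 (b / 2)" for t using C(3) that by simp
    fix t u assume t: "0 < t" "t \<le> min t0 (b / 2)" and u: "u \<in> {0..1::real}"
    have "cmod (complex_of_real t * \<Psi> (u / a t) - \<Psi>h u) \<le> 1" using b t u by auto
    then show "cmod (complex_of_real t * \<Psi> (u / a t)) \<le> cmod (\<Psi>h w) + 1"
      using w[OF u] norm_triangle_sub[of "complex_of_real t * \<Psi> (u / a t)" "\<Psi>h u"] by linarith
  next
    fix B assume "\<And>v. 1 \<le> v \<Longrightarrow> cmod (\<Psi> v) \<le> B * v powr \<theta>"
    then show ?thesis by blast
  qed
qed

lemma moment_lower_scaling:
  assumes q: "0 < q" and k: "q / \<alpha> < \<kappa>"
  shows "\<exists>c>0. \<forall>\<^sub>F t in at_right 0.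
    has_abs_moment M (X t) q \<longrightarrow> c * t powr \<kappa> \<le> abs_moment M (X t) q"
proof -
  have w: "1 / \<alpha> < \<kappa> / q" using k q alpha_pos by (simp add: field_simps)
  obtain c C t0 where c: "0 < c" "0 < t0" "\<And>t. 0 < t \<Longrightarrow> t \<le> t0 \<Longrightarrow> c * t powr (\<kappa> / q) \<le> a t"
    using scaling_bounds[OF w, of "1 / (2 * \<alpha>)"] alpha_pos by (auto simp: divide_strict_left_mono)
  obtain u where ne: "exp (\<Psi>h u) \<noteq> 1" using limit_nonzero by blast
  obtain c2 where c2: "0 < c2" "\<forall>\<^sub>F t in at_right 0. has_abs_moment M (X t) q \<longrightarrow> c2 * a t powr q \<le> abs_moment M (X t) q"
    by (rule moment_ge_scaling[OF X.levy_process_axioms Z.levy_process_axioms a_pos fdd limit_triplet ne q])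
  have t0: "\<forall>\<^sub>F t in at_right 0. t \<le> t0"
    unfolding eventually_at_right_field using c(2) by (intro exI[of _ t0]) auto
  show ?thesis
  proof (intro exI[of _ "c2 * c powr q"] conjI)
    show "0 < c2 * c powr q" using c c2 by simp
    show "\<forall>\<^sub>F t in at_right 0. has_abs_moment M (X t) q \<longrightarrow>
        c2 * c powr q * t powr \<kappa> \<le> abs_moment M (X t) q"
      using c2(2) t0 eventually_at_right_less[of 0]
    proof (eventually_elim, intro impI)
      case (elim t)
      assume iq: "has_abs_moment M (X t) q"
      have "c powr q * t powr \<kappa> = (c * t powr (\<kappa> / q)) powr q" using c q by (simp add: powr_mult powr_powr)
      also have "\<dots> \<le> a t powr q" using c(3) elim c(1) q by (intro powr_mono2) auto
      finally have "c2 * (c powr q * t powr \<kappa>) \<le> c2 * a t powr q" using c2(1) by (intro mult_left_mono) auto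
      then show "c2 * c powr q * t powr \<kappa> \<le> abs_moment M (X t) q" using elim iq by simp
    qed
  qed
qed

lemma eventually_small: "\<forall>\<^sub>F t in at_right (0::real). 0 < t \<and> t \<le> 1"
  unfolding eventually_at_right_field by (intro exI[of _ 1]) auto

text \<open>Upper bound: for \<open>q < 2\<close> choose \<open>\<theta>\<close> strictly between \<open>\<alpha>\<close> and \<open>q/\<kappa>\<close>; for \<open>q \<ge> 2\<close> the minimum is 1, as
\<open>\<alpha> \<le> 2\<close>. Lower bound: the scaling bound if \<open>q/\<alpha> < \<kappa>\<close>, the linear one otherwise.\<close>
lemma tau_zero_general:
  assumes nz: "\<nu> \<noteq> null_measure borel" and q: "0 < q" "ereal q < beta_inf \<nu>"
  shows "has_tau_zero M X q (- min (q / \<alpha>) 1)"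
proof (rule has_tau_zero_minusI)
  show "0 < min (q / \<alpha>) 1" using q alpha_pos by simp
  obtain p where p: "q < p" "tail_moment \<nu> p" by (rule beta_inf_tail_moment[OF levy q(2)])
  fix \<kappa> :: real
  show "\<exists>C. \<forall>\<^sub>F t in at_right 0.
      has_abs_moment M (X t) q \<and> abs_moment M (X t) q \<le> C * t powr \<kappa>"
    if k: "0 < \<kappa>" "\<kappa> < min (q / \<alpha>) 1"
  proof -
    have "\<exists>C. \<forall>t. 0 < t \<and> t \<le> 1 \<longrightarrow>
      has_abs_moment M (X t) q \<and> abs_moment M (X t) q \<le> C * t powr \<kappa>"
    proof (cases "q < 2")
      case True
      have aq: "\<alpha> < q / \<kappa>" using k alpha_pos by (simp add: field_simps)
      obtain \<theta> where th: "\<alpha> < \<theta>" and "\<theta> < q / \<kappa>" using dense[OF aq] by blast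
      then have "\<kappa> * \<theta> < q" using k by (simp add: field_simps)
      obtain B where "\<And>v. 1 \<le> v \<Longrightarrow> cmod (\<Psi> v) \<le> B * v powr \<theta>" using exponent_growth[OF th] by blast
      from moment_bound_order_less_2[OF X.levy_process_axioms triplet p(2) q(1) p(1) True this k(1) _ \<open>\<kappa> * \<theta> < q\<close>]
      show ?thesis using k by (metis less_imp_le min_less_iff_conj)
    next
      case False
      from moment_bound_order_ge_2[OF X.levy_process_axioms triplet p(2,1) _ k(1)]
      show ?thesis using k False by (metis min_less_iff_conj not_less)
    qed
    then obtain C where "\<And>t. 0 < t \<Longrightarrow> t \<le> 1 \<Longrightarrow>
      has_abs_moment M (X t) q \<and> abs_moment M (X t) q \<le> C * t powr \<kappa>" by blast
    then show ?thesis using eventually_small by (intro exI[of _ C]) (auto elim!: eventually_mono)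
  qed
  show "\<exists>c>0. \<forall>\<^sub>F t in at_right 0.
      has_abs_moment M (X t) q \<longrightarrow> c * t powr \<kappa> \<le> abs_moment M (X t) q"
    if k: "min (q / \<alpha>) 1 < \<kappa>"
  proof (cases "q / \<alpha> < \<kappa>")
    case True
    then show ?thesis by (rule moment_lower_scaling[OF q(1)])
  next
    case False
    then have k1: "1 < \<kappa>" using k by (auto simp: min_def split: if_splits)
    obtain c where c: "0 < c"
      "\<forall>\<^sub>F t in at_right 0. has_abs_moment M (X t) q \<longrightarrow> c * t \<le> abs_moment M (X t) q"
      by (rule moment_ge_linear[OF X.levy_process_axioms triplet nz q(1)])
    show ?thesis
    proof (intro exI[of _ c] conjI c(1))
      show "\<forall>\<^sub>F t in at_right 0. has_abs_moment M (X t) q \<longrightarrow> c * t powr \<kappa> \<le> abs_moment M (X t) q"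
        using c(2) eventually_small
      proof eventually_elim
        case (elim t)
        have "t powr \<kappa> \<le> t powr 1" using elim k1 by (intro powr_le_powr_of_le_one) auto
        then have "c * t powr \<kappa> \<le> c * t" using elim c(1) by (intro mult_left_mono) auto
        then show ?case using elim by auto
      qed
    qed
  qed
qed

text \<open>Without jumps \<open>X(t)\<close> has the law of \<open>\<gamma>t + \<sigma> sqrt(t) Z\<close> with \<open>Z\<close> standard normal, so \<open>t^r\<close> can be factored out,
where \<open>r = 1/2\<close>, or \<open>r = 1\<close> when there is no Gaussian part.\<close>
lemma gaussian_moment_bound:
  assumes null: "\<nu> = null_measure borel" and q: "0 < q" and r: "r = 1/2 \<or> \<sigma> = 0 \<and> r = 1"
  shows "\<exists>C. \<forall>\<^sub>F t in at_right 0.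
     has_abs_moment M (X t) q \<and> abs_moment M (X t) q \<le> C * t powr (r * q)"
proof -
  let ?G = "std_normal_distribution"
  interpret G: real_distribution ?G by (rule real_dist_normal_dist)
  define h where "h x = \<bar>\<gamma>\<bar> + \<bar>\<sigma>\<bar> * \<bar>x\<bar>" for x
  obtain m :: nat where m: "q \<le> real (2 * m)"
    using real_arch_simple[of q] by (metis mult_2 of_nat_add of_nat_0_le_iff le_add_same_cancel1 order_trans)
  have hm: "h x powr q \<le> 2 powr q * (\<bar>\<gamma>\<bar> powr q + \<bar>\<sigma>\<bar> powr q * (1 + x ^ (2 * m)))" for x
  proof -
    have "\<bar>x\<bar> powr q \<le> 1 + x ^ (2 * m)"
    proof (cases "\<bar>x\<bar> \<le> 1")
      case True
      then have "\<bar>x\<bar> powr q \<le> 1 powr q" using q by (intro powr_mono2) auto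
      then have "\<bar>x\<bar> powr q \<le> 1" by simp
      moreover have "0 \<le> x ^ (2 * m)" by (simp add: power_mult)
      ultimately show ?thesis by linarith
    next
      case False
      then have "\<bar>x\<bar> powr q \<le> \<bar>x\<bar> powr real (2 * m)" using m by (intro powr_mono) auto
      also have "\<dots> = \<bar>x\<bar> ^ (2 * m)" using False by (subst powr_realpow) auto
      also have "\<dots> = x ^ (2 * m)" by (simp add: power_mult)
      finally show ?thesis by simp
    qed
    then have "\<bar>\<sigma>\<bar> powr q * \<bar>x\<bar> powr q \<le> \<bar>\<sigma>\<bar> powr q * (1 + x ^ (2 * m))" by (intro mult_left_mono) auto
    moreover have "h x powr q \<le> 2 powr q * (\<bar>\<gamma>\<bar> powr q + (\<bar>\<sigma>\<bar> * \<bar>x\<bar>) powr q)"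
      using abs_add_powr_le[of q "\<bar>\<gamma>\<bar>" "\<bar>\<sigma>\<bar> * \<bar>x\<bar>"] q by (simp add: h_def abs_mult)
    ultimately show ?thesis by (simp add: powr_mult) (smt (verit) mult_left_mono powr_ge_zero)
  qed
  have hmeas[measurable]: "h \<in> borel_measurable borel" unfolding h_def by measurable
  have ih: "integrable ?G (\<lambda>x. h x powr q)"
  proof (rule integral_abs_le_bound(1))
    show "integrable ?G (\<lambda>x. 2 powr q * (\<bar>\<gamma>\<bar> powr q + \<bar>\<sigma>\<bar> powr q * (1 + x ^ (2 * m))))"
      using integrable_std_normal_distribution_moment by auto
    show "\<bar>h x powr q\<bar> \<le> 2 powr q * (\<bar>\<gamma>\<bar> powr q + \<bar>\<sigma>\<bar> powr q * (1 + x ^ (2 * m)))" for x using hm[of x] by simp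
  qed measurable
  define C where "C = (LINT x|?G. h x powr q)"
  have "has_abs_moment M (X t) q \<and> abs_moment M (X t) q \<le> C * t powr (r * q)"
    if t: "0 < t" "t \<le> 1" for t
  proof -
    have [measurable]: "X t \<in> borel_measurable M" using t by (intro X.random_variable) auto
    let ?Y = "\<lambda>x. \<gamma> * t + \<sigma> * sqrt t * x"
    have "distr M borel (X t) = distr ?G borel ?Y"
    proof (rule Levy_uniqueness)
      show "real_distribution (distr M borel (X t))" by (rule X.real_distribution_distr) measurable
      show "real_distribution (distr ?G borel ?Y)" by (rule G.real_distribution_distr) measurable
      show "char (distr M borel (X t)) = char (distr ?G borel ?Y)"
      proof
        fix u
        have "char (distr M borel (X t)) u = (CLINT \<omega>|M. iexp (u * X t \<omega>))"
          unfolding char_def by (rule integral_distr) measurable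
        also have "\<dots> = exp (complex_of_real t * \<Psi> u)" using has_triplet_char[OF triplet] t by simp
        finally have 1: "char (distr M borel (X t)) u = exp (complex_of_real t * \<Psi> u)" .
        have "char (distr ?G borel ?Y) u = (CLINT x|?G. iexp (u * ?Y x))"
          unfolding char_def by (rule integral_distr) measurable
        also have "\<dots> = (CLINT x|?G. iexp (u * \<gamma> * t) * iexp ((u * \<sigma> * sqrt t) * x))"
          by (intro Bochner_Integration.integral_cong) (auto simp: exp_add[symmetric] algebra_simps)
        also have "\<dots> = iexp (u * \<gamma> * t) * char ?G (u * \<sigma> * sqrt t)"
          unfolding char_def by (rule integral_mult_right_zero)
        also have "\<dots> = iexp (u * \<gamma> * t) * complex_of_real (exp (- ((u * \<sigma> * sqrt t)\<^sup>2) / 2))"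
          unfolding char_std_normal_distribution ..
        also have "\<dots> = exp (complex_of_real t * \<Psi> u)"
          unfolding null levy_exponent_null_measure using t by (simp add: exp_of_real[symmetric] exp_add[symmetric] power_mult_distrib algebra_simps)
        finally show "char (distr M borel (X t)) u = char (distr ?G borel ?Y) u" using 1 by simp
      qed
    qed
    then have eq: "abs_moment M (X t) q = (LINT x|?G. \<bar>?Y x\<bar> powr q)"
      "has_abs_moment M (X t) q \<longleftrightarrow> integrable ?G (\<lambda>x. \<bar>?Y x\<bar> powr q)"
    proof -
      assume d: "distr M borel (X t) = distr ?G borel ?Y"
      have f: "(\<lambda>x::real. \<bar>x\<bar> powr q) \<in> borel_measurable borel" by measurable
      have "abs_moment M (X t) q = (LINT x|distr M borel (X t). \<bar>x\<bar> powr q)"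
        by (rule integral_distr[symmetric]) measurable
      also have "\<dots> = (LINT x|?G. \<bar>?Y x\<bar> powr q)" unfolding d by (rule integral_distr) measurable
      finally show "abs_moment M (X t) q = (LINT x|?G. \<bar>?Y x\<bar> powr q)" .
      have "has_abs_moment M (X t) q \<longleftrightarrow> integrable (distr M borel (X t)) (\<lambda>x. \<bar>x\<bar> powr q)"
        by (rule integrable_distr_eq[symmetric]) measurable
      also have "\<dots> \<longleftrightarrow> integrable ?G (\<lambda>x. \<bar>?Y x\<bar> powr q)" unfolding d by (rule integrable_distr_eq) measurable
      finally show "has_abs_moment M (X t) q \<longleftrightarrow> integrable ?G (\<lambda>x. \<bar>?Y x\<bar> powr q)" .
    qed
    have bound: "\<bar>?Y x\<bar> powr q \<le> t powr (r * q) * h x powr q" for x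
    proof -
      have rt: "\<bar>\<gamma>\<bar> * t \<le> \<bar>\<gamma>\<bar> * t powr r" using t r powr_le_powr_of_le_one[of t r 1] by (intro mult_left_mono) auto
      have st: "\<bar>\<sigma>\<bar> * sqrt t = \<bar>\<sigma>\<bar> * t powr r"
        using r powr_half_sqrt[of t] t by (metis abs_zero less_imp_le mult_zero_left)
      have "\<bar>?Y x\<bar> \<le> \<bar>\<gamma> * t\<bar> + \<bar>\<sigma> * sqrt t * x\<bar>" by (rule abs_triangle_ineq)
      also have "\<dots> = \<bar>\<gamma>\<bar> * t + \<bar>\<sigma>\<bar> * sqrt t * \<bar>x\<bar>" using t by (simp add: abs_mult)
      also have "\<dots> \<le> t powr r * h x" unfolding st h_def using rt by (simp add: algebra_simps)
      finally have "\<bar>?Y x\<bar> powr q \<le> (t powr r * h x) powr q" using q by (intro powr_mono2) auto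
      also have "\<dots> = t powr (r * q) * h x powr q" by (simp add: powr_mult powr_powr h_def)
      finally show ?thesis .
    qed
    have ib: "integrable ?G (\<lambda>x. t powr (r * q) * h x powr q)" using ih by simp
    have mY: "(\<lambda>x. \<bar>?Y x\<bar> powr q) \<in> borel_measurable ?G" by measurable
    have "\<bar>LINT x|?G. \<bar>?Y x\<bar> powr q\<bar> \<le> (LINT x|?G. t powr (r * q) * h x powr q)"
      by (rule integral_abs_le_bound(2)[OF mY ib]) (use bound in simp)
    moreover have "integrable ?G (\<lambda>x. \<bar>?Y x\<bar> powr q)"
      by (rule integral_abs_le_bound(1)[OF mY ib]) (use bound in simp)
    ultimately show ?thesis unfolding eq C_def by (simp add: mult.commute)
  qed
  then show ?thesis using eventually_small by (intro exI[of _ C]) (auto elim!: eventually_mono)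
qed

lemma tau_zero_null:
  assumes null: "\<nu> = null_measure borel" and q: "0 < q" and r: "r = 1/2 \<or> \<sigma> = 0 \<and> r = 1" and al: "r = 1 / \<alpha>"
  shows "has_tau_zero M X q (- (q / \<alpha>))"
proof (rule has_tau_zero_minusI)
  show "0 < q / \<alpha>" using q alpha_pos by simp
  fix \<kappa> :: real
  obtain C where C: "\<forall>\<^sub>F t in at_right 0.
     has_abs_moment M (X t) q \<and> abs_moment M (X t) q \<le> C * t powr (r * q)"
    using gaussian_moment_bound[OF null q r] by blast
  show "\<exists>C. \<forall>\<^sub>F t in at_right 0.
      has_abs_moment M (X t) q \<and> abs_moment M (X t) q \<le> C * t powr \<kappa>" if k: "\<kappa> < q / \<alpha>"
  proof (rule exI[of _ "\<bar>C\<bar>"])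
    show "\<forall>\<^sub>F t in at_right 0. has_abs_moment M (X t) q \<and> abs_moment M (X t) q \<le> \<bar>C\<bar> * t powr \<kappa>"
      using C eventually_small
    proof eventually_elim
      case (elim t)
      have "C * t powr (r * q) \<le> \<bar>C\<bar> * t powr \<kappa>"
        using elim k al by (intro mult_mono powr_le_powr_of_le_one) auto
      then show ?case using elim by auto
    qed
  qed
qed (rule moment_lower_scaling[OF q])

end

section \<open>The index of the small jumps\<close>

context small_time_scaling_limit
begin

text \<open>The dyadic domination is used once more, now with the Levy measure in place of a probability measure and the jump size,
cut off at 1, in place of the random variable; the growth of the real part of \<open>\<Psi>\<close> bounds the
high-frequency terms.\<close>
lemma small_jump_moment_finite:
  assumes b: "\<alpha> < \<beta>" "\<beta> < 2"
  shows "(\<integral>\<^sup>+x\<in>{x. \<bar>x\<bar> \<le> 1}. ennreal (\<bar>x\<bar> powr \<beta>) \<partial>\<nu>) < \<infinity>"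
proof -
  note [measurable_cong] = levy_sets[OF levy]
  obtain \<theta> where th: "\<alpha> < \<theta>" "\<theta> < \<beta>" using dense[OF b(1)] by blast
  obtain B where B: "\<And>v. 1 \<le> v \<Longrightarrow> cmod (\<Psi> v) \<le> B * v powr \<theta>" using exponent_growth[OF th(1)] by blast
  have B0: "0 \<le> B" using order_trans[OF norm_ge_zero B[of 1]] by simp
  let ?Y = "\<lambda>x::real. x * indicator {x. \<bar>x\<bar> \<le> 1} x"
  let ?F = "\<lambda>u. \<integral>\<^sup>+x. ennreal (sin (u * ?Y x / 2) ^ (2 * 1)) \<partial>\<nu>"
  define L where "L = (LINT x|\<nu>. min 1 (x\<^sup>2))"
  have L0: "0 \<le> L" unfolding L_def by (rule integral_nonneg_AE) auto
  define A where "A = L + B"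
  have [measurable]: "?Y \<in> borel_measurable \<nu>" by measurable
  have low: "?F u \<le> ennreal (A * u powr 2)" if u: "0 < u" "u \<le> 1" for u
  proof -
    have pw: "sin (u * ?Y x / 2) ^ (2 * 1) \<le> u\<^sup>2 * min 1 (x\<^sup>2)" for x
    proof (cases "\<bar>x\<bar> \<le> 1")
      case True
      have "(sin (u * x / 2))\<^sup>2 \<le> (u * x / 2)\<^sup>2" using abs_sin_x_le_abs_x[of "u * x / 2"] by (simp only: abs_le_square_iff)
      also have "\<dots> \<le> u\<^sup>2 * x\<^sup>2" by (simp add: power_mult_distrib power_divide)
      finally show ?thesis using True by (simp add: abs_square_le_1)
    qed simp
    have "?F u \<le> (\<integral>\<^sup>+x. ennreal (u\<^sup>2 * min 1 (x\<^sup>2)) \<partial>\<nu>)" by (intro nn_integral_mono ennreal_leI pw)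
    also have "\<dots> = ennreal (u\<^sup>2 * L)"
      using levy_integrable_min[OF levy] by (subst nn_integral_eq_integral) (auto simp: L_def)
    also have "\<dots> \<le> ennreal (A * u powr 2)"
      using u B0 by (intro ennreal_leI) (simp add: A_def powr_numeral mult.commute mult_right_mono)
    finally show ?thesis .
  qed
  have high: "?F u \<le> ennreal (A * u powr \<theta>)" if u: "1 \<le> u" for u
  proof -
    have pw: "sin (u * ?Y x / 2) ^ (2 * 1) \<le> 1 - cos (u * x)" for x
    proof (cases "\<bar>x\<bar> \<le> 1")
      case True
      have "1 - cos (u * x) = 2 * (sin (u * x / 2))\<^sup>2" using cos_double_sin[of "u * x / 2"] by simp
      then show ?thesis using True by simp
    qed simp
    have "?F u \<le> (\<integral>\<^sup>+x. ennreal (1 - cos (u * x)) \<partial>\<nu>)" by (intro nn_integral_mono ennreal_leI pw)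
    also have "\<dots> = ennreal (LINT x|\<nu>. 1 - cos (u * x))"
      by (rule nn_integral_eq_integral[OF one_minus_cos_integrable[OF levy]]) simp
    also have "\<dots> \<le> ennreal (A * u powr \<theta>)"
    proof (rule ennreal_leI)
      have "0 \<le> \<sigma>\<^sup>2 / 2 * u\<^sup>2" by simp
      then have "(LINT x|\<nu>. 1 - cos (u * x)) \<le> - Re (\<Psi> u)" unfolding levy_exponent_Re[OF levy] by linarith
      also have "\<dots> \<le> cmod (\<Psi> u)" using abs_Re_le_cmod[of "\<Psi> u"] by linarith
      also have "\<dots> \<le> B * u powr \<theta>" by (rule B[OF u])
      also have "\<dots> \<le> A * u powr \<theta>" using L0 by (intro mult_right_mono) (auto simp: A_def)
      finally show "(LINT x|\<nu>. 1 - cos (u * x)) \<le> A * u powr \<theta>" .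
    qed
    finally show ?thesis .
  qed
  have b0: "0 < \<beta>" using b alpha_pos by simp
  have "(\<integral>\<^sup>+x\<in>{x. \<bar>x\<bar> \<le> 1}. ennreal (\<bar>x\<bar> powr \<beta>) \<partial>\<nu>) = (\<integral>\<^sup>+x. ennreal (\<bar>?Y x\<bar> powr \<beta>) \<partial>\<nu>)"
    by (intro nn_integral_cong) (auto simp: indicator_def)
  also have "\<dots> \<le> ennreal (2 powr \<beta> / sin (1/2) ^ (2 * 1)) * dyadic_sum \<beta> ?F"
    by (rule nn_integral_powr_le_dyadic_sum[OF _ b0]) measurable
  also have "\<dots> \<le> ennreal (2 powr \<beta> / sin (1/2) ^ (2 * 1)) *
      ennreal (A * (1 / (1 - 2 powr (\<theta> - \<beta>)) + 1 / (1 - 2 powr (\<beta> - 2))))"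
    using L0 B0 by (intro mult_left_mono dyadic_sum_le[OF b0 b(2) th(2) _ low high]) (auto simp: A_def)
  also have "\<dots> < \<infinity>" by (simp add: ennreal_mult_less_top)
  finally show ?thesis .
qed

text \<open>A finite moment of order \<open>\<beta> < \<alpha>\<close> would make the jump part of \<open>\<Psi>(v)\<close> at most of order \<open>v^\<beta>\<close>, which is negligible in
\<open>t \<Psi>(u/a(t))\<close>. Only the Gaussian part, proportional to \<open>u\<^sup>2\<close>, would survive in the limit, whereas the
limit is proportional to \<open>u^\<alpha>\<close> with \<open>\<alpha> < 2\<close>; the frequencies 1 and 1/2 tell them apart.\<close>
lemma small_jump_moment_infinite:
  assumes part: "part = Re" and al: "\<alpha> < 2" and b: "0 \<le> \<beta>" "\<beta> < \<alpha>"
  shows "\<not> (\<integral>\<^sup>+x\<in>{x. \<bar>x\<bar> \<le> 1}. ennreal (\<bar>x\<bar> powr \<beta>) \<partial>\<nu>) < \<infinity>"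
proof
  note [measurable_cong] = levy_sets[OF levy]
  assume fin: "(\<integral>\<^sup>+x\<in>{x. \<bar>x\<bar> \<le> 1}. ennreal (\<bar>x\<bar> powr \<beta>) \<partial>\<nu>) < \<infinity>"
  have i1: "integrable \<nu> (\<lambda>x. \<bar>x\<bar> powr \<beta> * indicator {x. \<bar>x\<bar> \<le> 1} x)"
  proof (rule integrableI_nonneg)
    have "(\<integral>\<^sup>+x. ennreal (\<bar>x\<bar> powr \<beta> * indicator {x. \<bar>x\<bar> \<le> 1} x) \<partial>\<nu>) = (\<integral>\<^sup>+x\<in>{x. \<bar>x\<bar> \<le> 1}. ennreal (\<bar>x\<bar> powr \<beta>) \<partial>\<nu>)"
      by (intro nn_integral_cong) (auto simp: indicator_def)
    then show "(\<integral>\<^sup>+x. ennreal (\<bar>x\<bar> powr \<beta> * indicator {x. \<bar>x\<bar> \<le> 1} x) \<partial>\<nu>) < \<infinity>" using fin by simp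
    show "(\<lambda>x. \<bar>x\<bar> powr \<beta> * indicator {x. \<bar>x\<bar> \<le> 1} x) \<in> borel_measurable \<nu>" by measurable
  qed auto
  define V where "V x = \<bar>x\<bar> powr \<beta> * indicator {x. \<bar>x\<bar> \<le> 1} x + min 1 (x\<^sup>2)" for x
  have iV: "integrable \<nu> (\<lambda>x. c * V x)" for c
    unfolding V_def using i1 levy_integrable_min[OF levy] by simp
  define D where "D = (LINT x|\<nu>. V x)"
  have D0: "0 \<le> D" unfolding D_def by (rule integral_nonneg_AE) (simp add: V_def)
  have jump: "(LINT x|\<nu>. 1 - cos (v * x)) \<le> 2 * D * v powr \<beta>" if v: "1 \<le> v" for v
  proof -
    have pw: "\<bar>1 - cos (v * x)\<bar> \<le> 2 * v powr \<beta> * V x" for x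
    proof (cases "\<bar>x\<bar> \<le> 1")
      case True
      have "\<bar>1 - cos (v * x)\<bar> \<le> 2 * \<bar>v * x\<bar> powr \<beta>"
        using one_minus_cos_le_powr[of \<beta> "v * x"] b al by simp
      also have "\<dots> = 2 * v powr \<beta> * \<bar>x\<bar> powr \<beta>" using v by (simp add: abs_mult powr_mult)
      also have "\<dots> \<le> 2 * v powr \<beta> * V x" using True by (intro mult_left_mono) (auto simp: V_def)
      finally show ?thesis .
    next
      case False
      then have "1 \<le> x\<^sup>2" by (metis abs_square_le_1 linorder_le_cases not_le)
      then have "V x = 1" using False by (simp add: V_def)
      moreover have "1 \<le> v powr \<beta>" using v b by (simp add: ge_one_powr_ge_zero)
      ultimately have "2 \<le> 2 * v powr \<beta> * V x" by simp
      moreover have "\<bar>1 - cos (v * x)\<bar> \<le> 2" using cos_ge_minus_one[of "v * x"] cos_le_one[of "v * x"] by linarith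
      ultimately show ?thesis by linarith
    qed
    have "\<bar>LINT x|\<nu>. 1 - cos (v * x)\<bar> \<le> (LINT x|\<nu>. 2 * v powr \<beta> * V x)"
      by (rule integral_abs_le_bound(2)[OF _ iV pw]) measurable
    then show ?thesis by (simp add: D_def mult_ac)
  qed
  \<comment> \<open>any exponent above \<open>1/\<alpha>\<close> with \<open>w \<beta> < 1\<close> would do; this one also covers \<open>\<beta> = 0\<close>\<close>
  define w where "w = 2 / (\<alpha> + \<beta>)"
  have w: "1 / \<alpha> < w" "w * \<beta> < 1" "0 < w" using b alpha_pos by (auto simp: w_def field_simps)
  obtain c C t0 where c: "0 < c" "0 < t0" "\<And>t. 0 < t \<Longrightarrow> t \<le> t0 \<Longrightarrow> c * t powr w \<le> a t"
    using scaling_bounds[OF w(1), of "1 / (2 * \<alpha>)"] alpha_pos by (auto simp: divide_strict_left_mono)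
  define J where "J v = (LINT x|\<nu>. 1 - cos (v * x))" for v
  have J0: "0 \<le> J v" for v unfolding J_def by (rule integral_nonneg_AE) auto
  have Jlim: "((\<lambda>t. t * J (u / a t)) \<longlongrightarrow> 0) (at_right 0)" if u: "0 < u" for u
  proof (rule tendsto_sandwich)
    show "\<forall>\<^sub>F t in at_right 0. 0 \<le> t * J (u / a t)"
      using eventually_at_right_less[of 0] by eventually_elim (simp add: J0)
    have "\<forall>\<^sub>F t in at_right 0. a t < u" using order_tendstoD(2)[OF a_tendsto u] .
    moreover have "\<forall>\<^sub>F t in at_right 0. t \<le> t0"
      unfolding eventually_at_right_field using c(2) by (intro exI[of _ t0]) auto
    ultimately show "\<forall>\<^sub>F t in at_right 0. t * J (u / a t) \<le> 2 * D * (u / c) powr \<beta> * t powr (1 - w * \<beta>)"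
      using eventually_at_right_less[of 0]
    proof eventually_elim
      case (elim t)
      have ct: "0 < c * t powr w" using c(1) elim by simp
      have "J (u / a t) \<le> 2 * D * (u / a t) powr \<beta>"
        unfolding J_def using a_pos[of t] elim by (intro jump) (auto simp: field_simps)
      also have "\<dots> \<le> 2 * D * (u / (c * t powr w)) powr \<beta>"
        using ct c(3)[of t] elim u b D0 a_pos[of t] by (intro mult_left_mono powr_mono2 divide_left_mono) auto
      also have "(u / (c * t powr w)) powr \<beta> = (u / c) powr \<beta> / t powr (w * \<beta>)"
        using u c(1) by (simp add: powr_divide powr_mult powr_powr)
      finally have "t * J (u / a t) \<le> t * (2 * D * ((u / c) powr \<beta> / t powr (w * \<beta>)))"
        using elim by (intro mult_left_mono) auto
      also have "\<dots> = 2 * D * (u / c) powr \<beta> * t powr (1 - w * \<beta>)" using elim by (simp add: powr_diff)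
      finally show ?case .
    qed
    have "((\<lambda>t::real. t powr (1 - w * \<beta>)) \<longlongrightarrow> 0 powr (1 - w * \<beta>)) (at_right 0)"
      using w(2) eventually_at_right_less[of "0::real"]
      by (intro tendsto_powr') (auto intro!: tendsto_ident_at elim: eventually_mono)
    then show "((\<lambda>t. 2 * D * (u / c) powr \<beta> * t powr (1 - w * \<beta>)) \<longlongrightarrow> 0) (at_right 0)"
      using tendsto_mult_right_zero by auto
  qed simp
  define k where "k t = \<sigma>\<^sup>2 / 2 * t / (a t)\<^sup>2" for t
  have klim: "((\<lambda>t. k t * u\<^sup>2) \<longlongrightarrow> K * u powr \<alpha>) (at_right 0)" if u: "0 < u" "u \<le> 1" for u
  proof -
    have "Re (\<Psi>h u) \<le> 0" by (rule levy_exponent_Re_nonpos[OF limit_levy])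
    then have h: "Re (\<Psi>h u) = - (K * u powr \<alpha>)" using homogeneous[OF u] part by simp
    have "((\<lambda>t. t * Re (\<Psi> (u / a t))) \<longlongrightarrow> Re (\<Psi>h u)) (at_right 0)"
    proof (rule tendstoI)
      fix e :: real assume "0 < e"
      then have "0 < e / 2" by simp
      from part_exponents_converge[OF this] show "\<forall>\<^sub>F t in at_right 0. dist (t * Re (\<Psi> (u / a t))) (Re (\<Psi>h u)) < e"
      proof eventually_elim
        case (elim t)
        then have "\<bar>t * Re (\<Psi> (u / a t)) - Re (\<Psi>h u)\<bar> \<le> e / 2" using u part by auto
        then show ?case using \<open>0 < e\<close> by (simp add: dist_real_def)
      qed
    qed
    then have "((\<lambda>t. - (t * Re (\<Psi> (u / a t))) - t * J (u / a t)) \<longlongrightarrow> - Re (\<Psi>h u) - 0) (at_right 0)"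
      by (intro tendsto_diff tendsto_minus Jlim u)
    moreover have "- (t * Re (\<Psi> (u / a t))) - t * J (u / a t) = k t * u\<^sup>2" for t
      unfolding levy_exponent_Re[OF levy] J_def k_def by (simp add: power_divide algebra_simps)
    ultimately show ?thesis using h by simp
  qed
  have "((\<lambda>t. k t) \<longlongrightarrow> K) (at_right 0)" using klim[of 1] by simp
  then have "((\<lambda>t. k t * (1/2)\<^sup>2) \<longlongrightarrow> K * (1/2)\<^sup>2) (at_right 0)" by (intro tendsto_mult tendsto_const)
  from tendsto_unique[OF _ this klim[of "1/2"]] have "K * (1/2)\<^sup>2 = K * (1/2) powr \<alpha>" by simp
  then have "(1/2::real) powr 2 = (1/2) powr \<alpha>" using K_pos by (simp add: powr_numeral)
  then show False using powr_inj[of "1/2" 2 \<alpha>] al by simp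
qed

lemma beta_zero_eq_alpha:
  assumes part: "part = Re" and al: "\<alpha> < 2"
  shows "beta_zero \<nu> = \<alpha>"
proof -
  define S where "S = {\<beta>. 0 \<le> \<beta> \<and> (\<integral>\<^sup>+x\<in>{x. \<bar>x\<bar> \<le> 1}. ennreal (\<bar>x\<bar> powr \<beta>) \<partial>\<nu>) < \<infinity>}"
  have mem: "\<beta> \<in> S" if "\<alpha> < \<beta>" "\<beta> < 2" for \<beta>
    using small_jump_moment_finite[OF that] that alpha_pos by (simp add: S_def)
  have lb: "\<alpha> \<le> \<beta>" if "\<beta> \<in> S" for \<beta>
    using small_jump_moment_infinite[OF part al, of \<beta>] that by (force simp: S_def not_le[symmetric])
  have "S \<noteq> {}" using mem dense[OF al] by blast
  then have "\<alpha> \<le> Inf S" using lb by (intro cInf_greatest) auto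
  moreover have "Inf S \<le> \<alpha>"
  proof (rule dense_ge_bounded[OF al])
    fix \<beta> assume "\<alpha> < \<beta>" "\<beta> < 2"
    then show "Inf S \<le> \<beta>" using lb by (intro cInf_lower mem bdd_belowI[of _ \<alpha>]) auto
  qed
  ultimately show ?thesis unfolding beta_zero_def S_def[symmetric] by simp
qed

end

section \<open>Brownian, drift and stable limits\<close>

text \<open>Substituting \<open>y = ux\<close> in the integral of \<open>1 - cos(ux)\<close> extracts the factor \<open>u^\<alpha>\<close>.\<close>

lemma stable_exponent_Re:
  assumes al: "0 < \<alpha>" and c: "0 \<le> cp" "0 \<le> cm" "0 < cp + cm"
    and lm: "levy_measure (stable_levy_measure \<alpha> cp cm)"
  obtains K where "0 < K" "\<And>u. 0 < u \<Longrightarrow> Re (levy_exponent \<gamma> 0 (stable_levy_measure \<alpha> cp cm) u) = - (K * u powr \<alpha>)"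
proof -
  define g :: "real \<Rightarrow> real" where "g x = cp * x powr (-1 - \<alpha>) * indicator {0<..} x + cm * \<bar>x\<bar> powr (-1 - \<alpha>) * indicator {..<0} x" for x
  have g0: "0 \<le> g x" for x using c by (simp add: g_def)
  have [measurable]: "g \<in> borel_measurable borel" unfolding g_def by measurable
  let ?\<nu> = "stable_levy_measure \<alpha> cp cm"
  have nu: "?\<nu> = density lborel (\<lambda>x. ennreal (g x))" unfolding stable_levy_measure_def g_def ..
  have I: "(LINT x|?\<nu>. 1 - cos (u * x)) = (LINT x|lborel. g x * (1 - cos (u * x)))" for u
    unfolding nu by (subst integral_density) (auto simp: g0)
  have int: "integrable lborel (\<lambda>x. g x * (1 - cos (u * x)))" for u
    using one_minus_cos_integrable[OF lm, of u] unfolding nu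
    by (subst (asm) integrable_density) (auto simp: g0)
  have gs: "g (x / u) = u powr (1 + \<alpha>) * g x" if u: "0 < u" for u x
  proof -
    have "\<bar>x / u\<bar> powr (-1 - \<alpha>) = u powr (1 + \<alpha>) * \<bar>x\<bar> powr (-1 - \<alpha>)"
    proof -
      have e: "-1 - \<alpha> = - (1 + \<alpha>)" by simp
      have f: "\<bar>x / u\<bar> powr (1 + \<alpha>) = \<bar>x\<bar> powr (1 + \<alpha>) / u powr (1 + \<alpha>)"
        using u by (simp add: powr_divide)
      show ?thesis unfolding e powr_minus f by (simp add: divide_inverse)
    qed
    then show ?thesis using u by (cases x "0::real" rule: linorder_cases) (auto simp: g_def indicator_def field_simps)
  qed
  define K where "K = (LINT x|lborel. g x * (1 - cos x))"
  have scale: "(LINT x|lborel. g x * (1 - cos (u * x))) = K * u powr \<alpha>" if u: "0 < u" for u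
  proof -
    have "(LINT x|lborel. g x * (1 - cos (u * x))) = \<bar>1 / u\<bar> *\<^sub>R (LINT x|lborel. g (0 + 1 / u * x) * (1 - cos (u * (0 + 1 / u * x))))"
      using u by (intro lborel_integral_real_affine) auto
    also have "\<dots> = 1 / u * (LINT x|lborel. u powr (1 + \<alpha>) * (g x * (1 - cos x)))"
      using u gs[OF u] by (simp add: mult.assoc)
    also have "\<dots> = (u powr (1 + \<alpha>) / u) * K" by (simp add: K_def)
    also have "u powr (1 + \<alpha>) / u = u powr \<alpha>" using u by (simp add: powr_add)
    finally show ?thesis by (simp add: mult.commute)
  qed
  have K0: "0 < K"
  proof (rule ccontr)
    assume "\<not> 0 < K"
    moreover have "0 \<le> K" unfolding K_def by (rule integral_nonneg_AE) (simp add: g0)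
    ultimately have "K = 0" by simp
    then have "AE x in lborel. g x * (1 - cos x) = 0"
      using integral_nonneg_eq_0_iff_AE[OF int[of 1]] by (simp add: K_def g0)
    moreover define I :: "real set" where "I = (if 0 < cp then {0<..<1} else {-1<..<0})"
    have "g x * (1 - cos x) \<noteq> 0" if "x \<in> I" for x
    proof -
      have x: "x \<noteq> 0" "\<bar>x\<bar> \<le> 1" using that by (auto simp: I_def split: if_splits)
      then have "0 < x\<^sup>2" "x\<^sup>2 \<le> 4 * (1 - cos x)" using sq_le_one_minus_cos[of x] by auto
      moreover have "0 < g x" using that c by (auto simp: I_def g_def split: if_splits)
      ultimately show ?thesis by auto
    qed
    ultimately have "AE x in lborel. x \<notin> I" by (auto elim!: eventually_mono)
    then have "emeasure lborel I = 0"
      by (subst (asm) AE_iff_measurable[of I]) (auto simp: I_def)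
    then show False by (auto simp: I_def split: if_splits)
  qed
  show thesis
  proof (rule that[OF K0])
    fix u :: real assume u: "0 < u"
    show "Re (levy_exponent \<gamma> 0 ?\<nu> u) = - (K * u powr \<alpha>)"
      unfolding levy_exponent_Re[OF lm] I scale[OF u] by simp
  qed
qed

text \<open>A Gaussian part would make \<open>|\<Psi>(v)|\<close> grow quadratically, against \<open>exponent_growth\<close>. It matters for the drift limit
without jumps, where \<open>X\<close> has to be a pure drift for the moments to be of order \<open>t^q\<close> for all \<open>q\<close>.\<close>
lemma (in small_time_scaling_limit) no_gaussian_part:
  assumes al: "\<alpha> < 2" and null: "\<nu> = null_measure borel"
  shows "\<sigma> = 0"
proof (rule ccontr)
  assume s: "\<sigma> \<noteq> 0"
  obtain \<theta> where th: "\<alpha> < \<theta>" "\<theta> < 2" using dense[OF al] by blast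
  obtain B where B: "\<And>v. 1 \<le> v \<Longrightarrow> cmod (\<Psi> v) \<le> B * v powr \<theta>" using exponent_growth[OF th(1)] by blast
  have le: "v powr (2 - \<theta>) \<le> 2 * B / \<sigma>\<^sup>2" if v: "1 \<le> v" for v
  proof -
    have "\<sigma>\<^sup>2 / 2 * v\<^sup>2 = - Re (\<Psi> v)" unfolding null levy_exponent_null_measure by simp
    also have "\<dots> \<le> cmod (\<Psi> v)" using abs_Re_le_cmod[of "\<Psi> v"] by linarith
    also have "\<dots> \<le> B * v powr \<theta>" by (rule B[OF v])
    finally have "\<sigma>\<^sup>2 / 2 * v\<^sup>2 \<le> B * v powr \<theta>" .
    then show ?thesis using s v by (simp add: powr_diff powr_numeral field_simps)
  qed
  have "0 \<le> B" using order_trans[OF norm_ge_zero B[of 1]] by simp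
  then have C: "1 \<le> 2 * B / \<sigma>\<^sup>2 + 1" by simp
  define v where "v = (2 * B / \<sigma>\<^sup>2 + 1) powr (1 / (2 - \<theta>))"
  have "1 \<le> v" using C th unfolding v_def by (intro ge_one_powr_ge_zero) auto
  moreover have "v powr (2 - \<theta>) = 2 * B / \<sigma>\<^sup>2 + 1" using C th unfolding v_def powr_powr by simp
  ultimately show False using le[of v] by simp
qed

theorem theorem4p1:
  fixes M :: "'a measure" and X :: "real \<Rightarrow> 'a \<Rightarrow> real"
    and N :: "'b measure" and Xhat :: "real \<Rightarrow> 'b \<Rightarrow> real"
    and a :: "real \<Rightarrow> real" and \<gamma> \<sigma> :: real and \<nu> :: "real measure"
  assumes "levy_process M X"
    and "levy_process N Xhat"
    and "\<And>t. 0 < t \<Longrightarrow> 0 < a t"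
    and "(a \<longlongrightarrow> 0) (at_right 0)"
    and "fdd_converges M (\<lambda>t s \<omega>. X (t * s) \<omega> / a t) (at_right 0) N Xhat"
    and "has_triplet M X \<gamma> \<sigma> \<nu>"
  shows
    "(brownian_limit N Xhat \<longrightarrow>
        (\<nu> \<noteq> null_measure borel \<longrightarrow>
           (\<forall>q. 0 < q \<and> ereal q < beta_inf \<nu> \<longrightarrow>
              has_tau_zero M X q (if q \<le> 2 then - (1 / 2) * q else - 1))) \<and>
        (\<nu> = null_measure borel \<longrightarrow>
           (\<forall>q. 0 < q \<and> ereal q < beta_inf \<nu> \<longrightarrow> has_tau_zero M X q (- q / 2)))) \<and>
     (drift_limit N Xhat \<longrightarrow>
        (\<nu> \<noteq> null_measure borel \<longrightarrow>
           (\<forall>q. 0 < q \<and> ereal q < beta_inf \<nu> \<longrightarrow>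
              has_tau_zero M X q (if q \<le> 1 then - q else - 1))) \<and>
        (\<nu> = null_measure borel \<longrightarrow>
           (\<forall>q. 0 < q \<and> ereal q < beta_inf \<nu> \<longrightarrow> has_tau_zero M X q (- q)))) \<and>
     ((\<exists>\<alpha>. strictly_stable N Xhat \<alpha>) \<longrightarrow>
        (\<forall>q. 0 < q \<and> ereal q < beta_inf \<nu> \<longrightarrow>
           has_tau_zero M X q
             (if q \<le> beta_zero \<nu> then - (1 / beta_zero \<nu>) * q else - 1)))"
proof (intro conjI impI)
  have scaling: "small_time_scaling_limit M X N Xhat a \<gamma> \<sigma> \<nu> \<gamma>h \<sigma>h \<nu>h \<alpha> K part"
    if "has_triplet N Xhat \<gamma>h \<sigma>h \<nu>h" "part = Re \<or> part = Im"
      "\<And>u. 0 < u \<Longrightarrow> u \<le> 1 \<Longrightarrow> \<bar>part (levy_exponent \<gamma>h \<sigma>h \<nu>h u)\<bar> = K * u powr \<alpha>"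
      "0 < K" "0 < \<alpha>" "\<alpha> \<le> 2" "exp (levy_exponent \<gamma>h \<sigma>h \<nu>h u) \<noteq> 1"
    for \<gamma>h \<sigma>h \<nu>h \<alpha> K part u
    unfolding small_time_scaling_limit_def small_time_scaling_limit_axioms_def using assms that by blast
  {
    assume "brownian_limit N Xhat"
    then obtain s where s: "0 < s" "has_triplet N Xhat 0 s (null_measure borel)"
      by (auto simp: brownian_limit_def)
    have "exp (levy_exponent 0 s (null_measure borel) 1) \<noteq> 1"
    proof -
      have "cmod (exp (levy_exponent 0 s (null_measure borel) 1)) < 1"
        using s(1) by (simp add: levy_exponent_null_measure)
      then show ?thesis by (metis less_irrefl norm_one)
    qed
    then interpret small_time_scaling_limit M X N Xhat a \<gamma> \<sigma> \<nu> 0 s "null_measure borel" 2 "s\<^sup>2 / 2" Re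
      using s by (intro scaling[where u = 1]) (auto simp: levy_exponent_null_measure powr_numeral)
    show "\<forall>q. 0 < q \<and> ereal q < beta_inf \<nu> \<longrightarrow> has_tau_zero M X q (if q \<le> 2 then - (1 / 2) * q else - 1)"
      if "\<nu> \<noteq> null_measure borel"
    proof (intro allI impI)
      fix q :: real assume q: "0 < q \<and> ereal q < beta_inf \<nu>"
      have "- min (q / 2) 1 = (if q \<le> 2 then - (1 / 2) * q else - 1)"
        by (auto simp: min_def field_simps)
      then show "has_tau_zero M X q ((if q \<le> 2 then - (1 / 2) * q else - 1))"
        using tau_zero_general[OF that, of q] q by metis
    qed
    show "\<forall>q. 0 < q \<and> ereal q < beta_inf \<nu> \<longrightarrow> has_tau_zero M X q (- q / 2)"
      if "\<nu> = null_measure borel"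
      using tau_zero_null[OF that, where r = "1/2"] by simp
  }
  {
    assume "drift_limit N Xhat"
    then obtain g where g: "g \<noteq> 0" "has_triplet N Xhat g 0 (null_measure borel)"
      by (auto simp: drift_limit_def)
    have "exp (levy_exponent g 0 (null_measure borel) (1 / g)) \<noteq> 1"
    proof
      assume *: "exp (levy_exponent g 0 (null_measure borel) (1 / g)) = 1"
      have "levy_exponent g 0 (null_measure borel) (1 / g) = \<i>"
        using g(1) by (simp add: levy_exponent_null_measure)
      then have "sin (1::real) = 0" using * by (metis Im_exp exp_zero imaginary_unit.sel mult_1 one_complex.sel(2))
      moreover have "0 < sin (1::real)" by (rule sin_gt_zero) (use pi_gt3 in auto)
      ultimately show False by simp
    qed
    then interpret small_time_scaling_limit M X N Xhat a \<gamma> \<sigma> \<nu> g 0 "null_measure borel" 1 "\<bar>g\<bar>" Im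
      using g by (intro scaling[where u = "1 / g"]) (auto simp: levy_exponent_null_measure abs_mult)
    show "\<forall>q. 0 < q \<and> ereal q < beta_inf \<nu> \<longrightarrow> has_tau_zero M X q (if q \<le> 1 then - q else - 1)"
      if "\<nu> \<noteq> null_measure borel"
    proof (intro allI impI)
      fix q :: real assume q: "0 < q \<and> ereal q < beta_inf \<nu>"
      have "- min (q / 1) 1 = (if q \<le> 1 then - q else - 1)"
        by (auto simp: min_def field_simps)
      then show "has_tau_zero M X q ((if q \<le> 1 then - q else - 1))"
        using tau_zero_general[OF that, of q] q by metis
    qed
    show "\<forall>q. 0 < q \<and> ereal q < beta_inf \<nu> \<longrightarrow> has_tau_zero M X q (- q)"
      if "\<nu> = null_measure borel"
      using tau_zero_null[OF that, where r = 1] no_gaussian_part[OF _ that] by simp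
  }
  {
    assume "\<exists>\<alpha>. strictly_stable N Xhat \<alpha>"
    then obtain \<alpha> g cp cm where st: "0 < \<alpha>" "\<alpha> < 2" "0 \<le> cp" "0 \<le> cm" "0 < cp + cm"
      "has_triplet N Xhat g 0 (stable_levy_measure \<alpha> cp cm)"
      by (auto simp: strictly_stable_def)
    obtain K where K: "0 < K" "\<And>u. 0 < u \<Longrightarrow> Re (levy_exponent g 0 (stable_levy_measure \<alpha> cp cm) u) = - (K * u powr \<alpha>)"
      using stable_exponent_Re[OF st(1,3,4,5) has_triplet_levy_measure[OF st(6)]] by blast
    have "exp (levy_exponent g 0 (stable_levy_measure \<alpha> cp cm) 1) \<noteq> 1"
    proof -
      have "cmod (exp (levy_exponent g 0 (stable_levy_measure \<alpha> cp cm) 1)) < 1" using K by simp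
      then show ?thesis by (metis less_irrefl norm_one)
    qed
    then interpret small_time_scaling_limit M X N Xhat a \<gamma> \<sigma> \<nu> g 0 "stable_levy_measure \<alpha> cp cm" \<alpha> K Re
      using st K by (intro scaling[where u = 1]) auto
    have b: "beta_zero \<nu> = \<alpha>" by (rule beta_zero_eq_alpha[OF refl st(2)])
    have "\<nu> \<noteq> null_measure borel"
    proof
      assume "\<nu> = null_measure borel"
      then have "0 \<in> {\<beta>. 0 \<le> \<beta> \<and> (\<integral>\<^sup>+x\<in>{x. \<bar>x\<bar> \<le> 1}. ennreal (\<bar>x\<bar> powr \<beta>) \<partial>\<nu>) < \<infinity>}"
        by (simp add: nn_integral_null_measure)
      then have "beta_zero \<nu> \<le> 0" unfolding beta_zero_def by (intro cInf_lower bdd_belowI[of _ 0]) auto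
      then show False using b st(1) by simp
    qed
    note that = this
    show "\<forall>q. 0 < q \<and> ereal q < beta_inf \<nu> \<longrightarrow>
      has_tau_zero M X q (if q \<le> beta_zero \<nu> then - (1 / beta_zero \<nu>) * q else - 1)"
      unfolding b
    proof (intro allI impI)
      fix q :: real assume q: "0 < q \<and> ereal q < beta_inf \<nu>"
      have "- min (q / \<alpha>) 1 = (if q \<le> \<alpha> then - (1 / \<alpha>) * q else - 1)"
        using st(1) by (auto simp: min_def field_simps)
      then show "has_tau_zero M X q ((if q \<le> \<alpha> then - (1 / \<alpha>) * q else - 1))"
        using tau_zero_general[OF that, of q] q by metis
    qed
  }
qed

end
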